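(* Let $(Z_n)_{n\ge 0}$ be the $d$-type branching process with immigration in the stationary ergodic random environment $\omega$ described in the context, and assume: (A1) $E_P(\log^+\|I_0\|_1)<\infty$; (A2) $E_P(\log^+\|M_0\|_1)<\infty$; (A3) $\lim_{n\to\infty} n^{-1}E_P(\log\|M_{n-1}\cdots M_1M_0\|_1)<0$. Suppose in addition that the sequence $(\omega_n)_{n\in\mathbb{Z}}$ is uniformly mixing, and that there exist $d+1$ probability measures $e^{(1)},\dots,e^{(d+1)}$ on $\mathbb{Z}_+^d$ and a constant $\varepsilon\in(0,1)$ such that: (i) for every $v\in\mathbb{Z}_+^d$, $$P\big(p^{(i)}_{\omega,0}(v)>\varepsilon e^{(i)}(v)\text{ for }i=1,\dots,d\text{ and }q_{\omega,0}(v)>\varepsilon e^{(d+1)}(v)\big)=1;$$ (ii) $e^{(i)}(\mathbf{0})>0$ for all $i=1,\dots,d$. Let $\nu_0=0$ and $\nu_n=\inf\{i>\nu_{n-1}:Z_i=\mathbf{0}\}$ for $n\ge1$. Then: (a) The sequence $\big((\nu_n-\nu_{n-1},Z_{[\nu_{n-1}+1,\nu_n]})\big)_{n\in\mathbb{N}}$ is uniformly mixing; more precisely, $$\sup_{m\in\mathbb{N}}\ \sup_{A\in\mathcal{G}^{\nu_{n+m}}}\ \sup_{B\in\mathcal{G}_{\nu_m},\,\mathbb{P}(B)>0}|\mathbb{P}(A\mid B)-\mathbb{P}(A)|\longrightarrow 0\quad\text{as }n\to\infty .$$ (b) The sequence $\big((\nu_n-\nu_{n-1},Z_{[\nu_{n-1}+1,\nu_n]})\big)_{n\in\mathbb{N}}$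 converges in law (under $\mathbb{P}$, as $n\to\infty$) to its stationary distribution, that is, to the law of $(\nu_1,Z_{[1,\nu_1]})$ under the probability measure $\widetilde{\mathbb{P}}$ defined in the context.
   Context: Fix an integer $d\ge 1$. The environment $\omega=(\omega_n)_{n\in\mathbb{Z}}$ is a stationary ergodic sequence of random variables with values in a measurable space $(\mathcal{S},\mathcal{B})$; its law on $(\Omega,\mathcal{F})=(\mathcal{S}^{\mathbb{Z}},\mathcal{B}^{\otimes\mathbb{Z}})$ is $P$, with expectation $E_P$. Let $\mathcal{P}_d$ be the set of probability measures on $\mathbb{Z}_+^d$ ($\mathbb{Z}_+=\mathbb{N}\cup\{0\}$), and let $q,p_1,\dots,p_d:\mathcal{S}\to\mathcal{P}_d$ be measurable. Given $\omega$, under the quenched law $P_\omega$ (expectation $E_\omega$), all of the following random vectors in $\mathbb{Z}_+^d$ are independent: the immigration vectors $X_n=(X_n^{(1)},\dots,X_n^{(d)})$, $n\in\mathbb{Z}_+$, with $X_n$ of law $q_{\omega,n}=q(\omega_{n-1})$; and the offspring vectors $L_{n,m}^{(i)}=(L_{n,m}^{(i,1)},\dots,L_{n,m}^{(i,d)})$, $n\in\mathbb{Z}_+$, $m\in\mathbb{N}$, $1\le i\le d$, with $L_{n,m}^{(i)}$ of law $p^{(i)}_{\omega,n}=p_i(\omega_n)$. The process is defined by $Z_0=\mathbf{0}=(0,\dots,0)$ and $$Z_{n+1}=\sum_{i=1}^d\sum_{m=1}^{Z_n^{(i)}+X_n^{(i)}}L_{n,m}^{(i)},\qquad n\ge 0.$$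 The joint (annealed) law is $\mathbb{P}=P\otimes P_\omega$. Write $I_n=I_n(\omega)=(E_\omega X_n^{(1)},\dots,E_\omega X_n^{(d)})$ and let $M_n=M_n(\omega)$ be the $d\times d$ matrix whose $i$th column is $(E_\omega L_{n,1}^{(i,1)},\dots,E_\omega L_{n,1}^{(i,d)})$. $\|v\|_1=\sum_i|v^{(i)}|$ for $v\in\mathbb{R}^d$, and $\|A\|_1$ is the corresponding operator norm for matrices; $\log^+x=\max\{0,\log x\}$, $\log 0=-\infty$. Uniform mixing: with $\mathcal{F}^n=\sigma(\omega_i:i\ge n)$, $\mathcal{F}_0=\sigma(\omega_i:i<0)$ and $\varphi(n)=\sup\{|P(A\mid B)-P(A)|:A\in\mathcal{F}^n,B\in\mathcal{F}_0,P(B)>0\}$, the sequence $(\omega_n)$ is called uniformly mixing if $\varphi(n)\to0$. Segments and $\sigma$-algebras: $Z_{[i,j]}=(Z_i,Z_{i+1},\dots,Z_j)$ for $i\le j$; $Z_{[\nu_{n-1}+1,\nu_n]}$ takes values in the countable discrete set of finite sequences in $\mathbb{Z}_+^d$. $\mathcal{G}^n=\sigma(Z_i:i\ge n)$ and $\mathcal{G}_n=\sigma(Z_i,\omega_i:i<n)$ (with $\omega_i$ for all integers $i<n$ and $Z_i$ for $0\le i<n$). At the (a.s. finite) random times $\nu_k$: $\mathcal{G}^{\nu_k}$ is generated by the shifted process $(Z_{\nu_k+i})_{i\ge0}$, and $\mathcal{G}_{\nu_k}$ is the $\sigma$-algebra of the past strictly before $\nu_k$, consisting of events $B$ such that for each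 $n$ there is $B_n\in\mathcal{G}_n$ with $B\cap\{\nu_k=n\}=B_n\cap\{\nu_k=n\}$. Measure $\widetilde{\mathbb{P}}$: let $\theta$ be the shift $(\theta\omega)_n=\omega_{n+1}$. Let $U_{i,n}\in\mathbb{Z}_+^d$ ($n\ge i$) count by type the descendants in generation $n$ of the immigrants arriving at time $i$, with $U_{i,i}=X_i$, so that $Z_n=\sum_{i=0}^{n-1}U_{i,n}$. Enlarge the probability space to include $X_i$ and $\mathcal{U}_i=(U_{i,n})_{n\ge i}$ also for $i<0$, so that given $\omega$ the processes $(\mathcal{U}_i)_{i\in\mathbb{Z}}$ are independent and $P_\omega(\mathcal{U}_i\in\cdot)=P_{\theta^i\omega}(\mathcal{U}_0\in\cdot)$ for $i<0$. Put $\widetilde{Z}_n=\sum_{i=-\infty}^{n-1}U_{i,n}$, $n\in\mathbb{Z}$. Then $\widetilde{\mathbb{P}}$ is the law on $\Omega\times(\mathbb{Z}_+^d)^{\mathbb{Z}_+}$ given by $\widetilde{\mathbb{P}}(\omega\in A,(Z_n)_{n\ge0}\in B)=\mathbb{P}(\omega\in A,(\widetilde{Z}_n)_{n\ge0}\in B\mid\widetilde{Z}_0=\mathbf{0})$ (under the hypotheses of the theorem the conditioning event has positive probability). *)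

theory Defs
  imports "HOL-Probability.Probability"
begin

section \<open>The environment\<close>

text \<open>An environment is a two-sided sequence \<open>\<omega> :: int \<Rightarrow> 's\<close>. Its law \<open>P\<close> is a probability measure
  on the product of copies of the measurable space \<open>S\<close> over all integers.\<close>

definition env_shift :: "int \<Rightarrow> (int \<Rightarrow> 's) \<Rightarrow> (int \<Rightarrow> 's)" where
  "env_shift k \<omega> = (\<lambda>n. \<omega> (n + k))"

definition stationary_env :: "(int \<Rightarrow> 's) measure \<Rightarrow> bool" where
  "stationary_env P \<longleftrightarrow> distr P P (env_shift 1) = P"

definition ergodic_env :: "(int \<Rightarrow> 's) measure \<Rightarrow> bool" where
  "ergodic_env P \<longleftrightarrow>
     (\<forall>A\<in>sets P. env_shift 1 -` A \<inter> space P = A \<longrightarrow> measure P A = 0 \<or> measure P A = 1)"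

section \<open>Uniform mixing\<close>

definition mix_coeff :: "'w measure \<Rightarrow> 'w set set \<Rightarrow> 'w set set \<Rightarrow> real" where
  "mix_coeff M \<A> \<B> =
     Sup {\<bar>measure M (A \<inter> B) / measure M B - measure M A\<bar> | A B.
            A \<in> \<A> \<and> B \<in> \<B> \<and> measure M B > 0}"

definition env_future :: "'s measure \<Rightarrow> (int \<Rightarrow> 's) measure \<Rightarrow> nat \<Rightarrow> (int \<Rightarrow> 's) set set" where
  "env_future S P n =
     sets (vimage_algebra (space P) (\<lambda>\<omega>. restrict \<omega> {int n..}) (PiM {int n..} (\<lambda>_. S)))"

definition env_past :: "'s measure \<Rightarrow> (int \<Rightarrow> 's) measure \<Rightarrow> (int \<Rightarrow> 's) set set" where
  "env_past S P =
     sets (vimage_algebra (space P) (\<lambda>\<omega>. restrict \<omega> {..<0}) (PiM {..<0} (\<lambda>_. S)))"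

definition unif_mixing_env :: "'s measure \<Rightarrow> (int \<Rightarrow> 's) measure \<Rightarrow> bool" where
  "unif_mixing_env S P \<longleftrightarrow> (\<lambda>n. mix_coeff P (env_future S P n) (env_past S P)) \<longlonglongrightarrow> 0"

text \<open>Sequences \<open>(Y n)\<close>, \<open>n \<ge> 1\<close>, of random variables with values in a discrete set need not be
  stationary, hence the additional supremum over the position \<open>m\<close> of the present.\<close>

definition seq_sigma :: "'w measure \<Rightarrow> (nat \<Rightarrow> 'w \<Rightarrow> 'b) \<Rightarrow> nat set \<Rightarrow> 'w set set" where
  "seq_sigma M Y K =
     sets (vimage_algebra (space M) (\<lambda>x. \<lambda>k\<in>K. Y k x) (PiM K (\<lambda>_. count_space UNIV)))"

definition unif_mixing_seq :: "'w measure \<Rightarrow> (nat \<Rightarrow> 'w \<Rightarrow> 'b) \<Rightarrow> bool" where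
  "unif_mixing_seq M Y \<longleftrightarrow>
     (\<lambda>n. SUP m\<in>{1..}. mix_coeff M (seq_sigma M Y {m + n..}) (seq_sigma M Y {1..m})) \<longlonglongrightarrow> 0"

section \<open>The branching process with immigration\<close>

text \<open>The types are the elements of the finite type \<open>'d\<close>. A sample point of the quenched law is a
  family \<open>y\<close> with \<open>y (Imm n)\<close> the immigration vector of time \<open>n\<close> and \<open>y (Off n m i)\<close> the offspring
  vector of the \<open>m\<close>-th particle of type \<open>i\<close> at time \<open>n\<close>. Particles are numbered from 1, so the
  coordinates \<open>Off n 0 i\<close> are never used.\<close>

datatype 'd source = Imm nat | Off nat nat 'd

definition quenched ::
  "('s \<Rightarrow> (nat ^ 'd) pmf) \<Rightarrow> ('d \<Rightarrow> 's \<Rightarrow> (nat ^ 'd) pmf) \<Rightarrow> (int \<Rightarrow> 's)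
     \<Rightarrow> ('d::finite source \<Rightarrow> nat ^ 'd) measure" where
  "quenched q p \<omega> = PiM UNIV (\<lambda>k. case k of
       Imm n \<Rightarrow> measure_pmf (q (\<omega> (int n - 1)))
     | Off n m i \<Rightarrow> measure_pmf (p i (\<omega> (int n))))"

definition annealed ::
  "(int \<Rightarrow> 's) measure \<Rightarrow> ('s \<Rightarrow> (nat ^ 'd) pmf) \<Rightarrow> ('d \<Rightarrow> 's \<Rightarrow> (nat ^ 'd) pmf)
     \<Rightarrow> ((int \<Rightarrow> 's) \<times> ('d::finite source \<Rightarrow> nat ^ 'd)) measure" where
  "annealed P q p = P \<bind> (\<lambda>\<omega>.
     distr (quenched q p \<omega>) (P \<Otimes>\<^sub>M PiM UNIV (\<lambda>_. count_space UNIV)) (\<lambda>y. (\<omega>, y)))"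

primrec popul :: "('d::finite source \<Rightarrow> nat ^ 'd) \<Rightarrow> nat \<Rightarrow> nat ^ 'd" where
  "popul y 0 = 0"
| "popul y (Suc n) = (\<Sum>i\<in>UNIV. \<Sum>m\<in>{1..popul y n $ i + y (Imm n) $ i}. y (Off n m i))"

section \<open>Moment assumptions\<close>

definition norm1 :: "real ^ 'd::finite \<Rightarrow> real" where
  "norm1 v = (\<Sum>i\<in>UNIV. \<bar>v $ i\<bar>)"

definition opnorm1 :: "real ^ 'd ^ 'd::finite \<Rightarrow> real" where
  "opnorm1 A = (SUP v. norm1 (A *v v) / norm1 v)"

definition log_plus :: "real \<Rightarrow> real" where
  "log_plus x = (if x \<le> 0 then 0 else max 0 (ln x))"

definition elog :: "real \<Rightarrow> ereal" where
  "elog x = (if x \<le> 0 then - \<infinity> else ereal (ln x))"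

text \<open>Expectation of an extended real random variable, as positive minus negative part
  (\<open>e2ennreal\<close> truncates at 0).\<close>

definition eexpectation :: "'w measure \<Rightarrow> ('w \<Rightarrow> ereal) \<Rightarrow> ereal" where
  "eexpectation M f =
     enn2ereal (\<integral>\<^sup>+x. e2ennreal (f x) \<partial>M) - enn2ereal (\<integral>\<^sup>+x. e2ennreal (- f x) \<partial>M)"

definition imm_mean ::
  "('s \<Rightarrow> (nat ^ 'd) pmf) \<Rightarrow> ('d::finite \<Rightarrow> 's \<Rightarrow> (nat ^ 'd) pmf) \<Rightarrow> (int \<Rightarrow> 's) \<Rightarrow> nat \<Rightarrow> real ^ 'd"
  where "imm_mean q p \<omega> n = (\<chi> j. \<integral>y. real (y (Imm n) $ j) \<partial>quenched q p \<omega>)"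

definition off_mean ::
  "('s \<Rightarrow> (nat ^ 'd) pmf) \<Rightarrow> ('d::finite \<Rightarrow> 's \<Rightarrow> (nat ^ 'd) pmf) \<Rightarrow> (int \<Rightarrow> 's) \<Rightarrow> nat
     \<Rightarrow> real ^ 'd ^ 'd"
  where "off_mean q p \<omega> n = (\<chi> j i. \<integral>y. real (y (Off n 1 i) $ j) \<partial>quenched q p \<omega>)"

primrec off_mean_prod ::
  "('s \<Rightarrow> (nat ^ 'd) pmf) \<Rightarrow> ('d::finite \<Rightarrow> 's \<Rightarrow> (nat ^ 'd) pmf) \<Rightarrow> (int \<Rightarrow> 's) \<Rightarrow> nat
     \<Rightarrow> real ^ 'd ^ 'd"
where
  "off_mean_prod q p \<omega> 0 = mat 1"
| "off_mean_prod q p \<omega> (Suc n) = off_mean q p \<omega> n ** off_mean_prod q p \<omega> n"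

text \<open>The means are a priori elements of \<open>[0, \<infinity>]\<close>, and the Bochner integrals above are 0 when they
  are infinite. Finiteness of the expected logarithm entails that they are almost surely finite,
  which is therefore spelt out in the next two conditions.\<close>

definition cond_A1 ::
  "(int \<Rightarrow> 's) measure \<Rightarrow> ('s \<Rightarrow> (nat ^ 'd) pmf) \<Rightarrow> ('d::finite \<Rightarrow> 's \<Rightarrow> (nat ^ 'd) pmf) \<Rightarrow> bool" where
  "cond_A1 P q p \<longleftrightarrow>
     (AE \<omega> in P. \<forall>j. integrable (quenched q p \<omega>) (\<lambda>y. real (y (Imm 0) $ j))) \<and>
     integrable P (\<lambda>\<omega>. log_plus (norm1 (imm_mean q p \<omega> 0)))"

definition cond_A2 ::
  "(int \<Rightarrow> 's) measure \<Rightarrow> ('s \<Rightarrow> (nat ^ 'd) pmf) \<Rightarrow> ('d::finite \<Rightarrow> 's \<Rightarrow> (nat ^ 'd) pmf) \<Rightarrow> bool" where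
  "cond_A2 P q p \<longleftrightarrow>
     (AE \<omega> in P. \<forall>i j. integrable (quenched q p \<omega>) (\<lambda>y. real (y (Off 0 1 i) $ j))) \<and>
     integrable P (\<lambda>\<omega>. log_plus (opnorm1 (off_mean q p \<omega> 0)))"

definition cond_A3 ::
  "(int \<Rightarrow> 's) measure \<Rightarrow> ('s \<Rightarrow> (nat ^ 'd) pmf) \<Rightarrow> ('d::finite \<Rightarrow> 's \<Rightarrow> (nat ^ 'd) pmf) \<Rightarrow> bool" where
  "cond_A3 P q p \<longleftrightarrow>
     (\<exists>l<0. (\<lambda>n. eexpectation P (\<lambda>\<omega>. elog (opnorm1 (off_mean_prod q p \<omega> n))) / ereal (real n))
        \<longlonglongrightarrow> l)"

section \<open>Return times to zero and excursions\<close>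

text \<open>These are functionals of a path \<open>z\<close>. The infimum of the empty set of \<open>enat\<close> is \<open>\<infinity>\<close>; the return
  times are almost surely finite for the processes considered, so that the value \<open>[]\<close> chosen for an
  infinite segment and the value \<open>None\<close> of the process shifted by \<open>\<infinity>\<close> occur only on null events.\<close>

primrec nu :: "(nat \<Rightarrow> nat ^ 'd::finite) \<Rightarrow> nat \<Rightarrow> enat" where
  "nu z 0 = 0"
| "nu z (Suc n) = Inf {enat i | i. nu z n < enat i \<and> z i = 0}"

definition excursion :: "(nat \<Rightarrow> nat ^ 'd::finite) \<Rightarrow> nat \<Rightarrow> enat \<times> (nat ^ 'd) list" where
  "excursion z n =
     (nu z n - nu z (n - 1),
      case nu z n of
        enat j \<Rightarrow> map z [Suc (the_enat (nu z (n - 1)))..<Suc j]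
      | \<infinity> \<Rightarrow> [])"

definition shifted_path :: "(nat \<Rightarrow> nat ^ 'd::finite) \<Rightarrow> nat \<Rightarrow> nat \<Rightarrow> (nat ^ 'd) option" where
  "shifted_path z k i = (case nu z k of enat j \<Rightarrow> Some (z (j + i)) | \<infinity> \<Rightarrow> None)"

definition future_at_nu ::
  "((int \<Rightarrow> 's) \<times> ('d::finite source \<Rightarrow> nat ^ 'd)) measure \<Rightarrow> nat
     \<Rightarrow> ((int \<Rightarrow> 's) \<times> ('d source \<Rightarrow> nat ^ 'd)) set set" where
  "future_at_nu M k =
     sets (vimage_algebra (space M) (\<lambda>(\<omega>, y). shifted_path (popul y) k)
             (PiM UNIV (\<lambda>_. count_space UNIV)))"

definition past_before ::
  "'s measure \<Rightarrow> ((int \<Rightarrow> 's) \<times> ('d::finite source \<Rightarrow> nat ^ 'd)) measure \<Rightarrow> nat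
     \<Rightarrow> ((int \<Rightarrow> 's) \<times> ('d source \<Rightarrow> nat ^ 'd)) set set" where
  "past_before S M n =
     sets (vimage_algebra (space M)
             (\<lambda>(\<omega>, y). (restrict (popul y) {..<n}, restrict \<omega> {..<int n}))
             (PiM {..<n} (\<lambda>_. count_space UNIV) \<Otimes>\<^sub>M PiM {..<int n} (\<lambda>_. S)))"

definition past_before_nu ::
  "'s measure \<Rightarrow> ((int \<Rightarrow> 's) \<times> ('d::finite source \<Rightarrow> nat ^ 'd)) measure \<Rightarrow> nat
     \<Rightarrow> ((int \<Rightarrow> 's) \<times> ('d source \<Rightarrow> nat ^ 'd)) set set" where
  "past_before_nu S M k =
     {B \<in> sets M. \<forall>n. \<exists>B'\<in>past_before S M n.
        B \<inter> {(\<omega>, y). nu (popul y) k = enat n} = B' \<inter> {(\<omega>, y). nu (popul y) k = enat n}}"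

section \<open>The process started in the infinite past\<close>

text \<open>\<open>lineage y n k\<close> is the number, by type, of the descendants in generation \<open>n\<close> of the immigrants
  arriving at time \<open>k \<ge> 0\<close> (and 0 if \<open>n < k\<close>). The particles of each type present at time \<open>n\<close> are
  numbered in the order of the arrival times of their immigrant ancestors.\<close>

primrec lineage :: "('d::finite source \<Rightarrow> nat ^ 'd) \<Rightarrow> nat \<Rightarrow> nat \<Rightarrow> nat ^ 'd" where
  "lineage y 0 k = (if k = 0 then y (Imm 0) else 0)"
| "lineage y (Suc n) k =
     (if k = Suc n then y (Imm (Suc n))
      else \<Sum>i\<in>UNIV. \<Sum>m\<in>{(\<Sum>l<k. lineage y n l $ i)<..(\<Sum>l\<le>k. lineage y n l $ i)}. y (Off n m i))"

definition lineage0_law ::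
  "('s \<Rightarrow> (nat ^ 'd) pmf) \<Rightarrow> ('d::finite \<Rightarrow> 's \<Rightarrow> (nat ^ 'd) pmf) \<Rightarrow> (int \<Rightarrow> 's)
     \<Rightarrow> (nat \<Rightarrow> nat ^ 'd) measure" where
  "lineage0_law q p \<omega> =
     distr (quenched q p \<omega>) (PiM UNIV (\<lambda>_. count_space UNIV)) (\<lambda>y n. lineage y n 0)"

text \<open>A point of the enlarged space is \<open>(\<omega>, y, u)\<close>, where \<open>u i r\<close> for \<open>i < 0\<close> counts the descendants in
  generation \<open>i + r\<close> of the immigrants arriving at time \<open>i\<close>.\<close>

definition enlarged ::
  "(int \<Rightarrow> 's) measure \<Rightarrow> ('s \<Rightarrow> (nat ^ 'd) pmf) \<Rightarrow> ('d::finite \<Rightarrow> 's \<Rightarrow> (nat ^ 'd) pmf)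
     \<Rightarrow> ((int \<Rightarrow> 's) \<times> ('d source \<Rightarrow> nat ^ 'd) \<times> (int \<Rightarrow> nat \<Rightarrow> nat ^ 'd)) measure" where
  "enlarged P q p = P \<bind> (\<lambda>\<omega>.
     distr (quenched q p \<omega> \<Otimes>\<^sub>M PiM {..<0} (\<lambda>i. lineage0_law q p (env_shift i \<omega>)))
       (P \<Otimes>\<^sub>M PiM UNIV (\<lambda>_. count_space UNIV)
          \<Otimes>\<^sub>M PiM {..<0} (\<lambda>_. PiM UNIV (\<lambda>_. count_space UNIV)))
       (\<lambda>(y, u). (\<omega>, y, u)))"

definition all_lineage ::
  "('d::finite source \<Rightarrow> nat ^ 'd) \<Rightarrow> (int \<Rightarrow> nat \<Rightarrow> nat ^ 'd) \<Rightarrow> int \<Rightarrow> int \<Rightarrow> nat ^ 'd" where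
  "all_lineage y u i n = (if i < 0 then u i (nat (n - i)) else lineage y (nat n) (nat i))"

definition popul_past ::
  "('d::finite source \<Rightarrow> nat ^ 'd) \<Rightarrow> (int \<Rightarrow> nat \<Rightarrow> nat ^ 'd) \<Rightarrow> int \<Rightarrow> nat ^ 'd" where
  "popul_past y u n = (\<chi> j. \<Sum>\<^sub>\<infinity>i\<in>{..<n}. all_lineage y u i n $ j)"

text \<open>The conditioning event is stated with \<open>has_sum\<close>, because \<open>infsum\<close> is also 0 for a divergent sum.
  \<open>uniform_measure M E\<close> is the conditional probability of \<open>M\<close> given \<open>E\<close>.\<close>

definition tilde_law ::
  "(int \<Rightarrow> 's) measure \<Rightarrow> ('s \<Rightarrow> (nat ^ 'd) pmf) \<Rightarrow> ('d::finite \<Rightarrow> 's \<Rightarrow> (nat ^ 'd) pmf)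
     \<Rightarrow> ((int \<Rightarrow> 's) \<times> (nat \<Rightarrow> nat ^ 'd)) measure" where
  "tilde_law P q p =
     distr (uniform_measure (enlarged P q p)
              {(\<omega>, y, u) \<in> space (enlarged P q p).
                 \<forall>j. ((\<lambda>i. all_lineage y u i 0 $ j) has_sum 0) {..<0}})
       (P \<Otimes>\<^sub>M PiM UNIV (\<lambda>_. count_space UNIV))
       (\<lambda>(\<omega>, y, u). (\<omega>, \<lambda>n. popul_past y u (int n)))"

text \<open>Convergence in law on a countable discrete set, where every function is continuous.\<close>

definition conv_in_law_discrete :: "(nat \<Rightarrow> 'b measure) \<Rightarrow> 'b measure \<Rightarrow> bool" where
  "conv_in_law_discrete \<mu> N \<longleftrightarrow>
     (\<forall>f :: 'b \<Rightarrow> real. bounded (range f) \<longrightarrow> (\<lambda>n. \<integral>x. f x \<partial>\<mu> n) \<longlonglongrightarrow> (\<integral>x. f x \<partial>N))"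

end

theory Submission
  imports Defs
begin

text \<open>By ellipticity there is a \<open>\<delta> > 0\<close> such that, whatever the environment, the process started at \<open>0\<close>
  returns to \<open>0\<close> at once with probability at least \<open>\<delta>\<close>. So with probability at least \<open>\<delta>\<^sup>N\<close> the next \<open>N\<close> excursions
  take only \<open>N\<close> time units and reveal nothing about the environment, and what follows is decoupled from
  the past up to the mixing coefficient of the gap. For a functional \<open>F\<close> of the path after the \<open>n\<close>-th
  return, let \<open>d(n)\<close> be the oscillation of its conditional expectation over all pasts of the environment.
  The renewal equation gives \<open>d(n + N) \<le> (1 - \<delta>\<^sup>N) d(n) + 2 \<delta>\<^sup>N \<phi>(N - 1)\<close>, whence \<open>d(n) \<rightarrow> 0\<close> uniformly in
  \<open>F\<close>, which is (a).

  The tilted law weighs the environment by the probability that a process started in the infinite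
  past is at \<open>0\<close> at time \<open>0\<close>. This weight depends on the past only, and the decomposition
  at the last previous zero shows that the tilted law is invariant under the shift to the next return;
  so the tilted expectation of \<open>F\<close> lies in the same interval of length \<open>d(n)\<close> for every \<open>n\<close>, which is (b).

  The weight is an infinite product of extinction probabilities of single lineages, which are controlled
  by norms of products of mean matrices. Positivity needs exponential decay of these norms only
  with positive probability, for which Garsia's maximal inequality suffices; ergodicity then makes it almost sure.
  Returns are almost surely finite because positivity of the weight forces infinitely
  many zeros.\<close>

section \<open>Return times, excursions and lineages of a path\<close>

text \<open>\<open>S\<close> is an arbitrary measurable space, so no regular conditional laws are
  used: conditional expectations are only tested against weights of the past environment. Uniform
  mixing has an error relative to the mass of the conditioning event, and so passes from events to
  weights. The weight 1 gives \<open>P\<close>-means, quenched probabilities of past events give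
  (a), \<open>past_zero_prob\<close> gives the tilted mean; all lie in one interval. The gap is
  \<open>N - 1\<close> because \<open>\<omega> (n - 1)\<close> governs the immigrants of time
  \<open>n\<close>. As the contraction factor tends to 1 with growing \<open>N\<close>, the mixing
  rate fixes \<open>N\<close> before the step is iterated. An immediate return needs some
  \<open>v0\<close> charged by \<open>e_imm\<close> and the childless death of all particles;
  \<open>e_imm\<close> may not charge \<open>0\<close>, yet strictness in (i) makes
  \<open>pmf (q _) 0\<close> positive, and with it each factor of the infinite product. Garsia's
  inequality is applied to the shift by a whole block of times, which may fail to be ergodic, so
  that it yields positive probability only. The logarithm in (A3) may have mean
  \<open>-\<infinity>\<close>, hence the truncation of its negative part.\<close>

lemma nu_Suc_enat:
  "nu z (Suc n) = enat j \<longleftrightarrow>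
     (\<exists>k<j. nu z n = enat k \<and> z j = 0 \<and> (\<forall>i. k < i \<and> i < j \<longrightarrow> z i \<noteq> 0))"
proof -
  let ?A = "{enat i | i. nu z n < enat i \<and> z i = 0}"
  have L: "?A \<noteq> {} \<Longrightarrow> nu z (Suc n) \<in> ?A \<and> (\<forall>x\<in>?A. nu z (Suc n) \<le> x)"
    by (auto simp: Inf_enat_def intro: LeastI Least_le)
  show ?thesis
  proof
    assume j: "nu z (Suc n) = enat j"
    then have "?A \<noteq> {}" unfolding nu.simps Inf_enat_def by (metis enat.distinct(1))
    with L j have A: "enat j \<in> ?A" "\<forall>x\<in>?A. enat j \<le> x" by auto
    then obtain k where k: "nu z n = enat k" by (cases "nu z n") auto
    show "\<exists>k<j. nu z n = enat k \<and> z j = 0 \<and> (\<forall>i. k < i \<and> i < j \<longrightarrow> z i \<noteq> 0)"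
      using A k by (intro exI[of _ k]) fastforce
  next
    assume "\<exists>k<j. nu z n = enat k \<and> z j = 0 \<and> (\<forall>i. k < i \<and> i < j \<longrightarrow> z i \<noteq> 0)"
    then obtain k where k: "k < j" "nu z n = enat k" "z j = 0" "\<forall>i. k < i \<and> i < j \<longrightarrow> z i \<noteq> 0"
      by auto
    then have jA: "enat j \<in> ?A" by auto
    with L obtain i where "nu z (Suc n) = enat i" "k < i" "z i = 0" "i \<le> j" using k(2) by fastforce
    with k(4) show "nu z (Suc n) = enat j" by (cases "i = j") auto
  qed
qed

lemma nu_eq_0_state: "nu z n = enat k \<Longrightarrow> z 0 = 0 \<Longrightarrow> z k = 0"
  by (cases n) (auto simp: nu_Suc_enat simp del: nu.simps(2) simp: zero_enat_def)

text \<open>Stopping time property; it lets the events \<open>nu z n = enat k\<close> be treated as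
  events of the past of \<open>k\<close> in all renewal arguments.\<close>

lemma nu_cong:
  assumes "\<And>i. i \<le> k \<Longrightarrow> z i = z' i"
  shows "nu z n = enat k \<longleftrightarrow> nu z' n = enat k"
  using assms
proof (induction n arbitrary: k)
  case (Suc n)
  have "(nu z n = enat i) = (nu z' n = enat i)" if "i < k" for i
    using that Suc.prems by (intro Suc.IH) auto
  then show ?case
    using Suc.prems unfolding nu_Suc_enat by (metis less_imp_le order_refl)
qed auto

lemma nu_shift_iff:
  assumes "nu z n = enat k"
  shows "nu z (n + m) = enat j \<longleftrightarrow> (\<exists>i. j = k + i \<and> nu (\<lambda>i. z (k + i)) m = enat i)"
proof (induction m arbitrary: j)
  case 0 then show ?case using assms by (auto simp: zero_enat_def)
next
  case (Suc m)
  show ?case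
    unfolding add_Suc_right nu_Suc_enat Suc.IH
  proof (intro iffI; elim exE conjE)
    fix l i assume *: "l < j" "z j = 0" "\<forall>i. l < i \<and> i < j \<longrightarrow> z i \<noteq> 0" "l = k + i"
      "nu (\<lambda>i. z (k + i)) m = enat i"
    show "\<exists>i. j = k + i \<and> (\<exists>ka<i. nu (\<lambda>i. z (k + i)) m = enat ka \<and> z (k + i) = 0 \<and>
        (\<forall>ia. ka < ia \<and> ia < i \<longrightarrow> z (k + ia) \<noteq> 0))"
      using * by (intro exI[of _ "j - k"]) (auto intro!: exI[of _ i])
  next
    fix i l assume *: "j = k + i" "l < i" "nu (\<lambda>i. z (k + i)) m = enat l" "z (k + i) = 0"
      "\<forall>ia. l < ia \<and> ia < i \<longrightarrow> z (k + ia) \<noteq> 0"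
    have "z a \<noteq> 0" if "k + l < a" "a < j" for a
    proof -
      have "l < a - k" "a - k < i" "k + (a - k) = a" using that *(1) by arith+
      then show ?thesis using *(5) by metis
    qed
    then show "\<exists>ka<j. (\<exists>i. ka = k + i \<and> nu (\<lambda>i. z (k + i)) m = enat i) \<and> z j = 0 \<and>
        (\<forall>i. ka < i \<and> i < j \<longrightarrow> z i \<noteq> 0)"
      using * by (intro exI[of _ "k + l"]) auto
  qed
qed

text \<open>Renewal on the level of paths. The \<open>enat\<close> form also covers infinite later
  returns, so that no separate case is needed where it is used.\<close>

lemma nu_shift:
  assumes "nu z n = enat k"
  shows "nu z (n + m) = enat k + nu (\<lambda>i. z (k + i)) m"
proof (cases "nu (\<lambda>i. z (k + i)) m")
  case (enat i)
  then show ?thesis using nu_shift_iff[OF assms, of m "k + i"] by auto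
next
  case infinity
  have "nu z (n + m) \<noteq> enat j" for j using nu_shift_iff[OF assms, of m j] infinity by auto
  then show ?thesis using infinity by auto
qed

lemma nu_infinity_mono: "nu z n = \<infinity> \<Longrightarrow> nu z (n + m) = \<infinity>"
  by (induction m) (auto simp: Inf_enat_def)

lemma nu_finite_antimono:
  assumes "nu z m = enat k" "n \<le> m"
  obtains i where "nu z n = enat i" "i \<le> k"
proof -
  obtain i where i: "nu z n = enat i"
    using nu_infinity_mono[of z n "m - n"] assms by (cases "nu z n") auto
  from nu_shift[OF this, of "m - n"] assms have "enat k = enat i + nu (\<lambda>j. z (i + j)) (m - n)"
    by simp
  then have "i \<le> k" by (cases "nu (\<lambda>j. z (i + j)) (m - n)") auto
  with i that show thesis by blast
qed

lemma shifted_path_shift: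
  assumes "nu z n = enat k"
  shows "shifted_path z (n + m) = shifted_path (\<lambda>i. z (k + i)) m"
  using nu_shift[OF assms, of m]
  by (auto simp: shifted_path_def fun_eq_iff add.assoc split: enat.splits)

text \<open>The condition \<open>0 < m\<close> excludes the dummy index: excursions are numbered
  from 1, and for \<open>m = 0\<close> the left side would still look back to the return before the
  \<open>n\<close>-th one.\<close>

lemma excursion_shift:
  assumes "nu z n = enat k" "0 < m"
  shows "excursion z (n + m) = excursion (\<lambda>i. z (k + i)) m"
proof -
  let ?z = "\<lambda>i. z (k + i)"
  have eq: "nu z (n + m) = enat k + nu ?z m" "nu z (n + m - 1) = enat k + nu ?z (m - 1)"
    using nu_shift[OF assms(1), of m] nu_shift[OF assms(1), of "m - 1"] assms(2) by simp_all
  show ?thesis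
  proof (cases "nu ?z m")
    case (enat a)
    then obtain b where b: "nu ?z (m - 1) = enat b" "b \<le> a"
      using nu_finite_antimono[of ?z m a "m - 1"] by auto
    have "map z [Suc (k + b)..<Suc (k + a)] = map ?z [Suc b..<Suc a]"
      by (rule nth_equalityI) (auto simp del: upt_Suc simp: add.assoc)
    then show ?thesis using eq enat b by (simp add: excursion_def del: upt_Suc)
  next
    case infinity
    then show ?thesis using eq by (simp add: excursion_def)
  qed
qed

text \<open>In \<open>enat\<close>, \<infinity> minus anything is \<infinity>, even \<infinity>
  minus \<infinity>, so all excursions after a missing return share one value.\<close>

lemma excursion_infinity: "nu z n = \<infinity> \<Longrightarrow> excursion z (n + m) = (\<infinity>, [])"
  using nu_infinity_mono[of z n m] by (simp add: excursion_def)

lemma excursion_cong: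
  assumes m: "nu z m = enat k" and n: "n \<le> m" and eq: "\<And>i. i \<le> k \<Longrightarrow> z i = z' i"
  shows "excursion z n = excursion z' n"
proof -
  obtain a where a: "nu z n = enat a" "a \<le> k" using m n by (rule nu_finite_antimono)
  obtain b where b: "nu z (n - 1) = enat b" "b \<le> a"
    using a(1) diff_le_self by (rule nu_finite_antimono)
  have "nu z' n = enat a" "nu z' (n - 1) = enat b"
    using a b eq nu_cong[of a z z' n] nu_cong[of b z z' "n - 1"] by auto
  moreover have "map z [Suc b..<Suc a] = map z' [Suc b..<Suc a]"
    using eq a by (auto simp del: upt_Suc)
  ultimately show ?thesis using a b by (simp add: excursion_def del: upt_Suc)
qed

section \<open>The process as a function of its sources, time shift and lineages\<close>

primrec stime :: "'d source \<Rightarrow> nat" where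
  "stime (Imm n) = n"
| "stime (Off n m i) = n"

text \<open>Precomposition with \<open>shift_source k\<close> restarts the sources at time
  \<open>k\<close>; under the quenched law this amounts to shifting the environment by
  \<open>k\<close>.\<close>

primrec shift_source :: "nat \<Rightarrow> 'd source \<Rightarrow> 'd source" where
  "shift_source k (Imm n) = Imm (n + k)"
| "shift_source k (Off n m i) = Off (n + k) m i"

lemma inj_shift_source: "inj (shift_source k)"
  by (rule injI, rename_tac a b, case_tac a; case_tac b) auto

lemma stime_shift_source[simp]: "stime (shift_source k s) = stime s + k"
  by (cases s) auto

lemma popul_cong:
  assumes "\<And>s. stime s < k \<Longrightarrow> y s = y' s" "n \<le> k"
  shows "popul y n = popul y' n"
  using assms(2)
proof (induction n)
  case (Suc n)
  then have "y (Imm n) = y' (Imm n)" "\<And>m i. y (Off n m i) = y' (Off n m i)"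
    by (auto intro!: assms(1))
  with Suc show ?case by simp
qed simp

lemma popul_restrict: "n \<le> k \<Longrightarrow> popul (restrict y {s. stime s < k}) n = popul y n"
  by (rule popul_cong[of k]) auto

text \<open>The source \<open>Imm 0\<close> is demanded separately: for \<open>k = 0\<close> no
  source is earlier than \<open>k\<close>, yet the lineage at time 0 already reads it.\<close>

lemma lineage_cong:
  assumes "\<And>s. stime s < k \<Longrightarrow> y s = y' s" "n \<le> k" "y (Imm 0) = y' (Imm 0)"
  shows "lineage y n 0 = lineage y' n 0"
  using assms(2)
proof (induction n)
  case (Suc n)
  then have "\<And>m i. y (Off n m i) = y' (Off n m i)"
    by (auto intro!: assms(1))
  with Suc show ?case by simp
qed (simp add: assms)

text \<open>An empty population leaves no particle labels behind, so from a zero on the recursion is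
  the original one run on shifted sources. This is the regeneration behind every renewal
  identity.\<close>

lemma popul_shift:
  assumes "popul y k = 0"
  shows "popul y (k + i) = popul (y \<circ> shift_source k) i"
  using assms by (induction i) (auto simp: add.commute)

text \<open>Numbering particles by arrival time of their ancestors cuts the labels
  \<open>1..\<close> of each type into consecutive blocks, one per lineage, so the offspring sum
  splits. The range \<open>k < n\<close> leaves out the immigrants of time \<open>n\<close>, who are
  counted in the population only through their children.\<close>

lemma popul_eq_sum_lineage: "popul y n = (\<Sum>k<n. lineage y n k)"
proof -
  have self: "lineage y n n = y (Imm n)" for n by (cases n) auto
  \<comment> \<open>Concatenation of the blocks between successive partial sums \<open>N k\<close>;
    a block is empty where \<open>N\<close> does not increase.\<close>
  have split: "(\<Sum>m\<in>{1..N (Suc n)}. f m) = (\<Sum>k\<le>n. \<Sum>m\<in>{N k<..N (Suc k)}. f m)"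
    if "N 0 = 0" "\<And>k. N k \<le> N (Suc k)" for N :: "nat \<Rightarrow> nat" and f :: "nat \<Rightarrow> nat ^ 'a" and n
  proof (induction n)
    case 0
    have "{1..N (Suc 0)} = {N 0<..N (Suc 0)}" using that by auto
    then show ?case by simp
  next
    case (Suc n)
    have "{1..N (Suc (Suc n))} = {1..N (Suc n)} \<union> {N (Suc n)<..N (Suc (Suc n))}"
      using that(2)[of "Suc n"] by auto
    moreover have "{1..N (Suc n)} \<inter> {N (Suc n)<..N (Suc (Suc n))} = {}" by auto
    ultimately show ?case using Suc by (simp only: sum.union_disjoint finite_atLeastAtMost
        finite_greaterThanAtMost sum.atMost_Suc)
  qed
  show "popul y n = (\<Sum>k<n. lineage y n k)"
  proof (induction n)
    case (Suc n)
    have tot: "popul y n $ i + y (Imm n) $ i = (\<Sum>l<Suc n. lineage y n l $ i)" for i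
      by (simp add: Suc self)
    have "popul y (Suc n) = (\<Sum>i\<in>UNIV. \<Sum>k\<le>n. \<Sum>m\<in>{(\<Sum>l<k. lineage y n l $ i)<..(\<Sum>l\<le>k. lineage y n l $ i)}. y (Off n m i))"
      unfolding popul.simps tot
    proof (rule sum.cong[OF refl])
      fix i
      show "(\<Sum>m\<in>{1..(\<Sum>l<Suc n. lineage y n l $ i)}. y (Off n m i)) =
        (\<Sum>k\<le>n. \<Sum>m\<in>{(\<Sum>l<k. lineage y n l $ i)<..(\<Sum>l\<le>k. lineage y n l $ i)}. y (Off n m i))"
        using split[of "\<lambda>k. \<Sum>l<k. lineage y n l $ i" "\<lambda>m. y (Off n m i)" n]
        by (simp add: lessThan_Suc_atMost[symmetric])
    qed
    also have "\<dots> = (\<Sum>k\<le>n. lineage y (Suc n) k)"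
      by (subst sum.swap) (auto intro!: sum.cong)
    finally show ?case by (simp only: lessThan_Suc_atMost)
  qed simp
qed

lemma lineage_eq_0_mono: "lineage y n 0 = 0 \<Longrightarrow> n \<le> m \<Longrightarrow> lineage y m 0 = 0"
  by (induction m) (auto simp: le_Suc_eq)

section \<open>Measurability\<close>

text \<open>It suffices to check the intersection-stable generator of cylinders, on which the
  product measure is a finite product of values of the factor kernels. The index set may be
  infinite.\<close>

lemma measurable_PiM_kernel:
  assumes K: "\<And>i. i \<in> I \<Longrightarrow> (\<lambda>x. K x i) \<in> N \<rightarrow>\<^sub>M prob_algebra (M i)"
  shows "(\<lambda>x. PiM I (K x)) \<in> N \<rightarrow>\<^sub>M prob_algebra (PiM I M)"
proof -
  have K1: "prob_space (K x i)" "sets (K x i) = sets (M i)" if "x \<in> space N" "i \<in> I" for x i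
    using measurable_space[OF K[OF that(2)] that(1)] by (auto simp: space_prob_algebra)
  show ?thesis
  proof (rule measurable_prob_algebra_generated[OF sets_PiM Int_stable_prod_algebra
        prod_algebra_sets_into_space])
    fix x assume x: "x \<in> space N"
    show "prob_space (PiM I (K x))" using K1 x by (intro prob_space_PiM) auto
    show "sets (PiM I (K x)) = sets (PiM I M)" using K1 x by (intro sets_PiM_cong) auto
  next
    fix A assume "A \<in> prod_algebra I M"
    then obtain J E where A: "A = prod_emb I M J (\<Pi>\<^sub>E j\<in>J. E j)"
      and J: "finite J" "J \<noteq> {} \<or> I = {}" "J \<subseteq> I" "\<And>i. i \<in> J \<Longrightarrow> E i \<in> sets (M i)"
      by (elim prod_algebraE) blast
    have "emeasure (PiM I (K x)) A = (\<Prod>j\<in>J. emeasure (K x j) (E j))" if x: "x \<in> space N" for x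
    proof -
      have "(\<Pi>\<^sub>E i\<in>I. space (K x i)) = (\<Pi>\<^sub>E i\<in>I. space (M i))"
        using sets_eq_imp_space_eq[OF K1(2)[OF x]] by (intro PiE_cong)
      then have "A = prod_emb I (K x) J (\<Pi>\<^sub>E j\<in>J. E j)"
        unfolding A prod_emb_def by simp
      also have "emeasure (PiM I (K x)) \<dots> = (\<Prod>j\<in>J. emeasure (K x j) (E j))"
      proof (rule emeasure_PiM_emb)
        show "E i \<in> sets (K x i)" if "i \<in> J" for i
          using K1(2)[OF x, of i] J(3,4) that by blast
      qed (use J K1(1)[OF x] in simp_all)
      finally show ?thesis .
    qed
    moreover have "(\<lambda>x. \<Prod>j\<in>J. emeasure (K x j) (E j)) \<in> borel_measurable N"
    proof (intro borel_measurable_prod_ennreal)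
      fix j assume j: "j \<in> J"
      show "(\<lambda>x. emeasure (K x j) (E j)) \<in> borel_measurable N"
        by (rule measurable_compose[OF measurable_prob_algebraD[OF K] measurable_emeasure_subprob_algebra])
          (use J(3,4) j in auto)
    qed
    ultimately show "(\<lambda>x. emeasure (PiM I (K x)) A) \<in> borel_measurable N"
      by (simp cong: measurable_cong)
  qed
qed

lemma measurable_count_space_binop:
  fixes f :: "'a \<Rightarrow> 'b::countable" and g :: "'a \<Rightarrow> 'c::countable"
  assumes "f \<in> M \<rightarrow>\<^sub>M count_space UNIV" "g \<in> M \<rightarrow>\<^sub>M count_space UNIV"
  shows "(\<lambda>x. h (f x) (g x)) \<in> M \<rightarrow>\<^sub>M count_space UNIV"
proof -
  have "(\<lambda>x. h i (g x)) \<in> M \<rightarrow>\<^sub>M count_space UNIV" for i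
    by (rule measurable_compose[OF assms(2)]) simp
  then show ?thesis by (rule measurable_compose_countable[OF _ assms(1)])
qed

lemma measurable_count_space_sum:
  fixes f :: "'i \<Rightarrow> 'a \<Rightarrow> 'b::{countable, comm_monoid_add}"
  assumes "\<And>i. i \<in> I \<Longrightarrow> f i \<in> M \<rightarrow>\<^sub>M count_space UNIV"
  shows "(\<lambda>x. \<Sum>i\<in>I. f i x) \<in> M \<rightarrow>\<^sub>M count_space UNIV"
  using assms
proof (induction I rule: infinite_finite_induct)
  case (insert i I)
  have "(\<lambda>x. f i x + (\<Sum>i\<in>I. f i x)) \<in> M \<rightarrow>\<^sub>M count_space UNIV"
    using insert by (intro measurable_count_space_binop[where h = "(+)"]) auto
  with insert show ?case by simp
qed simp_all

abbreviation sourceM :: "('d::finite source \<Rightarrow> nat ^ 'd) measure" where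
  "sourceM \<equiv> PiM UNIV (\<lambda>_. count_space UNIV)"

abbreviation pathM :: "(nat \<Rightarrow> nat ^ 'd::finite) measure" where
  "pathM \<equiv> PiM UNIV (\<lambda>_. count_space UNIV)"

lemma space_sourceM[simp]: "space sourceM = UNIV"
  by (simp add: space_PiM)

lemma source_measurable: "(\<lambda>y. y s) \<in> sourceM \<rightarrow>\<^sub>M count_space UNIV"
  by (rule measurable_component_singleton) simp

lemma offspring_measurable:
  fixes N :: "('d::finite source \<Rightarrow> nat ^ 'd) \<Rightarrow> nat ^ 'd"
  assumes "N \<in> sourceM \<rightarrow>\<^sub>M count_space UNIV"
  shows "(\<lambda>y. \<Sum>i\<in>UNIV. \<Sum>m\<in>{1..N y $ i}. y (Off n m i)) \<in> sourceM \<rightarrow>\<^sub>M count_space UNIV"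
proof -
  have "(\<lambda>y. \<Sum>i\<in>UNIV. \<Sum>m\<in>{1..v $ i}. y (Off n m i)) \<in> sourceM \<rightarrow>\<^sub>M count_space UNIV" for v :: "nat ^ 'd"
    by (intro measurable_count_space_sum source_measurable)
  then show ?thesis by (rule measurable_compose_countable[OF _ assms])
qed

lemma popul_measurable:
  "(\<lambda>y :: 'd::finite source \<Rightarrow> nat ^ 'd. popul y n) \<in> sourceM \<rightarrow>\<^sub>M count_space UNIV"
proof (induction n)
  case (Suc n)
  have "(\<lambda>y :: 'd source \<Rightarrow> nat ^ 'd. popul y n + y (Imm n)) \<in> sourceM \<rightarrow>\<^sub>M count_space UNIV"
    by (intro measurable_count_space_binop[where h = "(+)"] Suc source_measurable)
  from offspring_measurable[OF this] show ?case by simp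
qed simp

text \<open>The summation ranges are random. With the pair of block ends frozen only finitely many
  coordinates are added; the countably many possible pairs are then pasted together.\<close>

lemma lineage_measurable:
  "(\<lambda>y :: 'd::finite source \<Rightarrow> nat ^ 'd. lineage y n k) \<in> sourceM \<rightarrow>\<^sub>M count_space UNIV"
proof (induction n arbitrary: k)
  case 0 show ?case using source_measurable by (cases "k = 0") simp_all
next
  case (Suc n)
  show ?case
  proof (cases "k = Suc n")
    case False
    let ?B = "\<lambda>(y :: 'd source \<Rightarrow> nat ^ 'd) k i. \<Sum>l<k. lineage y n l $ i"
    have B: "(\<lambda>y. (\<chi> i. ?B y k i)) \<in> sourceM \<rightarrow>\<^sub>M count_space UNIV" for k
    proof (induction k)
      case (Suc k)
      have "(\<lambda>y. (\<chi> i. ?B y k i) + lineage y n k) \<in> sourceM \<rightarrow>\<^sub>M count_space UNIV"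
        by (intro measurable_count_space_binop[where h = "(+)"] Suc \<open>\<And>k. (\<lambda>y. lineage y n k) \<in> _\<close>)
      also have "(\<lambda>y. (\<chi> i. ?B y k i) + lineage y n k) = (\<lambda>y. (\<chi> i. ?B y (Suc k) i))"
        by (auto simp: vec_eq_iff)
      finally show ?case .
    qed simp
    have "(\<lambda>y. \<Sum>i\<in>UNIV. \<Sum>m\<in>{fst v $ i<..snd v $ i}. y (Off n m i)) \<in> sourceM \<rightarrow>\<^sub>M count_space UNIV"
      for v :: "(nat ^ 'd) \<times> (nat ^ 'd)"
      by (intro measurable_count_space_sum source_measurable)
    from measurable_compose_countable[where f = "\<lambda>v (y :: 'd source \<Rightarrow> nat ^ 'd).
        \<Sum>i\<in>UNIV. \<Sum>m\<in>{fst v $ i<..snd v $ i}. y (Off n m i)", OF this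
        measurable_count_space_binop[where h = Pair, OF B[of k] B[of "Suc k"]]]
    show ?thesis using False
      by (simp only: lineage.simps if_False fst_conv snd_conv vec_lambda_beta lessThan_Suc_atMost)
  qed (simp add: source_measurable)
qed

lemma path_popul_measurable: "popul \<in> sourceM \<rightarrow>\<^sub>M pathM"
  by (rule measurable_PiM_single') (auto simp: popul_measurable)

lemma shift_source_measurable: "(\<lambda>y. y \<circ> shift_source k) \<in> sourceM \<rightarrow>\<^sub>M sourceM"
  by (rule measurable_PiM_single') (auto simp: source_measurable)

lemma nu_measurable:
  "(\<lambda>z :: nat \<Rightarrow> nat ^ 'd::finite. nu z n) \<in> pathM \<rightarrow>\<^sub>M count_space UNIV"
proof -
  have c: "(\<lambda>z :: nat \<Rightarrow> nat ^ 'd. z i) \<in> pathM \<rightarrow>\<^sub>M count_space UNIV" for i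
    by (rule measurable_component_singleton) simp
  have [measurable]: "Measurable.pred pathM (\<lambda>z :: nat \<Rightarrow> nat ^ 'd. z i = 0)" for i
    by (rule measurable_compose[OF c]) simp
  have fin[measurable]: "Measurable.pred pathM (\<lambda>z :: nat \<Rightarrow> nat ^ 'd. nu z n = enat j)" for j n
  proof (induction n arbitrary: j)
    case 0 show ?case by simp
  next
    case (Suc n)
    note Suc[measurable]
    show ?case unfolding nu_Suc_enat by measurable
  qed
  show ?thesis
  proof (rule measurable_count_space_eq2_countable[THEN iffD2], safe)
    fix a :: enat
    have "Measurable.pred pathM (\<lambda>z :: nat \<Rightarrow> nat ^ 'd. nu z n = a)"
    proof (cases a)
      case infinity
      have "(nu z n = \<infinity>) = (\<forall>j. nu z n \<noteq> enat j)" for z :: "nat \<Rightarrow> nat ^ 'd" by (cases "nu z n") auto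
      then have eq: "(\<lambda>z :: nat \<Rightarrow> nat ^ 'd. nu z n = a) = (\<lambda>z. \<forall>j. nu z n \<noteq> enat j)"
        unfolding infinity by blast
      show ?thesis unfolding eq by (intro pred_intros_logic pred_intros_countable fin)
    qed (simp add: fin)
    then have "{z\<in>space pathM. nu z n = a} \<in> sets (pathM :: (nat \<Rightarrow> nat ^ 'd) measure)"
      by (rule predE)
    also have "{z\<in>space pathM. nu z n = a} = (\<lambda>z. nu z n) -` {a} \<inter> space pathM" by auto
    finally show "(\<lambda>z. nu z n) -` {a} \<inter> space pathM \<in> sets (pathM :: (nat \<Rightarrow> nat ^ 'd) measure)" .
  qed auto
qed

lemma shifted_path_measurable:
  "(\<lambda>z :: nat \<Rightarrow> nat ^ 'd::finite. shifted_path z n) \<in> pathM \<rightarrow>\<^sub>M PiM UNIV (\<lambda>_. count_space UNIV)"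
proof (rule measurable_PiM_single')
  fix i
  have "(\<lambda>z :: nat \<Rightarrow> nat ^ 'd. case a of enat j \<Rightarrow> Some (z (j + i)) | \<infinity> \<Rightarrow> None) \<in> pathM \<rightarrow>\<^sub>M count_space UNIV" for a
    by (cases a) (simp_all add: measurable_compose[OF measurable_component_singleton])
  from measurable_compose_countable[where f = "\<lambda>a (z :: nat \<Rightarrow> nat ^ 'd).
      case a of enat j \<Rightarrow> Some (z (j + i)) | \<infinity> \<Rightarrow> None", OF this nu_measurable]
  show "(\<lambda>z :: nat \<Rightarrow> nat ^ 'd. shifted_path z n i) \<in> pathM \<rightarrow>\<^sub>M count_space UNIV"
    unfolding shifted_path_def .
qed auto

lemma map_path_measurable:
  "(\<lambda>z :: nat \<Rightarrow> nat ^ 'd::finite. map z xs) \<in> pathM \<rightarrow>\<^sub>M count_space UNIV"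
proof (induction xs)
  case (Cons x xs)
  have "(\<lambda>z :: nat \<Rightarrow> nat ^ 'd. z x # map z xs) \<in> pathM \<rightarrow>\<^sub>M count_space UNIV"
    by (rule measurable_count_space_binop[where h = "(#)", OF measurable_component_singleton Cons]) simp
  then show ?case by simp
qed simp

lemma excursion_measurable:
  "(\<lambda>z :: nat \<Rightarrow> nat ^ 'd::finite. excursion z n) \<in> pathM \<rightarrow>\<^sub>M count_space UNIV"
proof -
  let ?f = "\<lambda>ab (z :: nat \<Rightarrow> nat ^ 'd). (fst ab - snd ab,
      case fst ab of enat j \<Rightarrow> map z [Suc (the_enat (snd ab))..<Suc j] | \<infinity> \<Rightarrow> [])"
  have "?f ab \<in> pathM \<rightarrow>\<^sub>M count_space UNIV" for ab :: "enat \<times> enat"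
  proof (cases "fst ab")
    case (enat j)
    then show ?thesis
      using measurable_compose[OF map_path_measurable, of "\<lambda>l. (fst ab - snd ab, l)" "count_space UNIV"]
      by (simp del: upt_Suc)
  qed simp
  from measurable_compose_countable[where f = ?f, OF this
      measurable_count_space_binop[where h = Pair, OF nu_measurable[of n] nu_measurable[of "n - 1"]]]
  show ?thesis by (simp only: excursion_def fst_conv snd_conv)
qed

section \<open>The quenched and the annealed law\<close>

definition past_sources :: "nat \<Rightarrow> 'd source set" where
  "past_sources k = {s. stime s < k}"

lemma env_shift_env_shift[simp]: "env_shift j (env_shift k \<omega>) = env_shift (j + k) \<omega>"
  by (simp add: env_shift_def add.assoc)

lemma env_shift_0[simp]: "env_shift 0 \<omega> = \<omega>"
  by (simp add: env_shift_def)

locale branching_env =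
  fixes S :: "'s measure"
    and P :: "(int \<Rightarrow> 's) measure"
    and q :: "'s \<Rightarrow> (nat ^ 'd::finite) pmf"
    and p :: "'d \<Rightarrow> 's \<Rightarrow> (nat ^ 'd) pmf"
  assumes prob_P: "prob_space P"
    and sets_P: "sets P = sets (PiM UNIV (\<lambda>_. S))"
    and stationary: "stationary_env P"
    and q_meas: "(\<lambda>s. measure_pmf (q s)) \<in> S \<rightarrow>\<^sub>M subprob_algebra (count_space UNIV)"
    and p_meas: "\<And>i. (\<lambda>s. measure_pmf (p i s)) \<in> S \<rightarrow>\<^sub>M subprob_algebra (count_space UNIV)"
begin

sublocale P: prob_space P by (rule prob_P)

abbreviation Q :: "(int \<Rightarrow> 's) \<Rightarrow> ('d source \<Rightarrow> nat ^ 'd) measure" where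
  "Q \<equiv> quenched q p"

definition source_law :: "(int \<Rightarrow> 's) \<Rightarrow> 'd source \<Rightarrow> (nat ^ 'd) measure" where
  "source_law \<omega> k = (case k of
       Imm n \<Rightarrow> measure_pmf (q (\<omega> (int n - 1)))
     | Off n m i \<Rightarrow> measure_pmf (p i (\<omega> (int n))))"

lemma quenched_eq: "Q \<omega> = PiM UNIV (source_law \<omega>)"
  by (simp add: quenched_def source_law_def[abs_def])

lemma prob_source_law: "prob_space (source_law \<omega> k)"
  by (auto simp: source_law_def measure_pmf.prob_space_axioms split: source.split)

lemma sets_source_law[simp]: "sets (source_law \<omega> k) = UNIV"
  by (auto simp: source_law_def split: source.split)

lemma space_source_law[simp]: "space (source_law \<omega> k) = UNIV"
  by (auto simp: source_law_def split: source.split)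

sublocale Q: prob_space "Q \<omega>" for \<omega>
  unfolding quenched_eq by (intro prob_space_PiM prob_source_law)

lemma sets_Q[measurable_cong, simp]: "sets (Q \<omega>) = sets sourceM"
  unfolding quenched_eq by (intro sets_PiM_cong) auto

lemma space_Q[simp]: "space (Q \<omega>) = UNIV"
  using sets_eq_imp_space_eq[OF sets_Q] by simp

lemma in_space_P: "\<omega> \<in> space P \<longleftrightarrow> (\<forall>n. \<omega> n \<in> space S)"
  by (simp add: sets_eq_imp_space_eq[OF sets_P] space_PiM PiE_UNIV_domain Pi_iff)

lemma coord_measurable: "(\<lambda>\<omega>. \<omega> n) \<in> P \<rightarrow>\<^sub>M S"
  unfolding measurable_cong_sets[OF sets_P refl] by (rule measurable_component_singleton) simp

lemma env_shift_measurable[measurable]: "env_shift k \<in> P \<rightarrow>\<^sub>M P"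
  unfolding measurable_cong_sets[OF refl sets_P]
proof (rule measurable_PiM_single')
  show "(\<lambda>\<omega>. env_shift k \<omega> i) \<in> P \<rightarrow>\<^sub>M S" for i
    unfolding env_shift_def by (rule coord_measurable)
qed (auto simp: env_shift_def in_space_P)

lemma env_shift_space[simp]: "\<omega> \<in> space P \<Longrightarrow> env_shift k \<omega> \<in> space P"
  by (simp add: in_space_P env_shift_def)

lemma distr_env_shift: "distr P P (env_shift k) = P"
proof -
  have nat: "distr P P (env_shift (int n)) = P" for n
  proof (induction n)
    case 0 show ?case
      using distr_id[of P] by (simp add: env_shift_def id_def)
  next
    case (Suc n)
    have "distr P P (env_shift (int (Suc n))) = distr (distr P P (env_shift (int n))) P (env_shift 1)"
      by (subst distr_distr) (auto simp: comp_def)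
    then show ?case using Suc stationary by (simp add: stationary_env_def)
  qed
  show ?thesis
  proof (cases "0 \<le> k")
    case True then show ?thesis using nat[of "nat k"] by simp
  next
    case False
    \<comment> \<open>A negative shift is the inverse of a positive one, which is already known to
      preserve \<open>P\<close>.\<close>
    then have "distr P P (env_shift k) = distr (distr P P (env_shift (- k))) P (env_shift k)"
      using nat[of "nat (- k)"] by simp
    also have "\<dots> = distr P P (\<lambda>\<omega>. \<omega>)"
      by (subst distr_distr) (auto simp: comp_def)
    finally show ?thesis using distr_id[of P] by (simp add: id_def)
  qed
qed

lemma nn_integral_env_shift:
  assumes "f \<in> borel_measurable P"
  shows "(\<integral>\<^sup>+\<omega>. f (env_shift k \<omega>) \<partial>P) = (\<integral>\<^sup>+\<omega>. f \<omega> \<partial>P)"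
  using nn_integral_distr[OF env_shift_measurable[of k], of f] assms
  by (simp add: distr_env_shift)

lemma AE_env_shift:
  assumes "AE \<omega> in P. R \<omega>"
  shows "AE \<omega> in P. \<forall>k. R (env_shift k \<omega>)"
proof -
  have "AE \<omega> in P. R (env_shift k \<omega>)" for k
    by (rule AE_distrD[OF env_shift_measurable], subst distr_env_shift) (rule assms)
  then show ?thesis by (simp add: AE_all_countable)
qed

lemma source_law_measurable: "(\<lambda>\<omega>. source_law \<omega> k) \<in> P \<rightarrow>\<^sub>M prob_algebra (count_space UNIV)"
proof (rule measurable_prob_algebraI[OF prob_source_law])
  show "(\<lambda>\<omega>. source_law \<omega> k) \<in> P \<rightarrow>\<^sub>M subprob_algebra (count_space UNIV)"
    using measurable_compose[OF coord_measurable q_meas] measurable_compose[OF coord_measurable p_meas]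
    by (cases k) (simp_all add: source_law_def)
qed

lemma Q_measurable[measurable]: "Q \<in> P \<rightarrow>\<^sub>M prob_algebra sourceM"
  unfolding quenched_eq[abs_def] by (intro measurable_PiM_kernel source_law_measurable)

lemma Q_measurable_subprob[measurable]: "Q \<in> P \<rightarrow>\<^sub>M subprob_algebra sourceM"
  by (rule measurable_prob_algebraD) (rule Q_measurable)

lemma nn_integral_Q_measurable:
  assumes "(\<lambda>(\<omega>, y). f \<omega> y) \<in> borel_measurable (P \<Otimes>\<^sub>M sourceM)"
  shows "(\<lambda>\<omega>. \<integral>\<^sup>+y. f \<omega> y \<partial>Q \<omega>) \<in> borel_measurable P"
  by (rule nn_integral_measurable_subprob_algebra2[OF assms Q_measurable_subprob])

lemma nn_integral_Q_measurable1:
  assumes "f \<in> borel_measurable sourceM"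
  shows "(\<lambda>\<omega>. \<integral>\<^sup>+y. f y \<partial>Q \<omega>) \<in> borel_measurable P"
  by (rule measurable_compose[OF Q_measurable_subprob nn_integral_measurable_subprob_algebra[OF assms]])

lemma distr_Q_restrict:
  "distr (Q \<omega>) (PiM K (\<lambda>_. count_space UNIV)) (\<lambda>y. restrict y K) = PiM K (source_law \<omega>)"
proof -
  have "distr (Q \<omega>) (PiM K (source_law \<omega>)) (\<lambda>y. \<lambda>n\<in>K. y (id n)) = PiM K (source_law \<omega>)"
    unfolding quenched_eq
    using distr_PiM_reindex[of UNIV "source_law \<omega>" id K] prob_source_law by simp
  moreover have "sets (PiM K (source_law \<omega>)) = sets (PiM K (\<lambda>_. count_space UNIV))"
    by (intro sets_PiM_cong) auto
  ultimately show ?thesis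
    by (simp add: restrict_def cong: distr_cong)
qed

text \<open>Injective reindexing of a product measure is again a product, and the source of time
  \<open>n + k\<close> reads the environment exactly \<open>k\<close> places later.\<close>

lemma distr_Q_shift:
  "distr (Q \<omega>) sourceM (\<lambda>y. y \<circ> shift_source k) = Q (env_shift (int k) \<omega>)"
proof -
  have eq: "source_law \<omega> (shift_source k s) = source_law (env_shift (int k) \<omega>) s" for s
    by (cases s) (auto simp: source_law_def env_shift_def algebra_simps)
  have "distr (Q \<omega>) (PiM UNIV (source_law (env_shift (int k) \<omega>))) (\<lambda>y. \<lambda>n\<in>UNIV. y (shift_source k n))
      = PiM UNIV (source_law (env_shift (int k) \<omega>))"
    unfolding quenched_eq
    using distr_PiM_reindex[where M = "source_law \<omega>" and K = UNIV and I = UNIV and f = "shift_source k",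
        OF prob_source_law inj_shift_source]
    by (simp add: eq)
  moreover have "sets (PiM UNIV (source_law (env_shift (int k) \<omega>))) = sets sourceM"
    by (intro sets_PiM_cong) auto
  ultimately show ?thesis
    unfolding quenched_eq[of "env_shift (int k) \<omega>"] by (simp add: comp_def restrict_UNIV cong: distr_cong)
qed

lemma distr_source: "distr (Q \<omega>) (count_space UNIV) (\<lambda>y. y s) = source_law \<omega> s"
proof -
  have "distr (Q \<omega>) (source_law \<omega> s) (\<lambda>y. y s) = source_law \<omega> s"
    unfolding quenched_eq using distr_PiM_component[of UNIV "source_law \<omega>" s] prob_source_law by simp
  moreover have "distr (Q \<omega>) (count_space UNIV) (\<lambda>y. y s) = distr (Q \<omega>) (source_law \<omega> s) (\<lambda>y. y s)"
    by (intro distr_cong) simp_all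
  ultimately show ?thesis by simp
qed

section \<open>Independence of past and future sources\<close>

lemma indep_sources: "Q.indep_vars \<omega> (\<lambda>_. count_space UNIV) (\<lambda>s y. y s) UNIV"
proof (subst Q.indep_vars_iff_distr_eq_PiM)
  have "distr (Q \<omega>) sourceM (\<lambda>y. y) = Q \<omega>"
    using distr_id2[of sourceM "Q \<omega>"] by simp
  then show "distr (Q \<omega>) sourceM (\<lambda>x. \<lambda>i\<in>UNIV. x i) =
      (\<Pi>\<^sub>M i\<in>UNIV. distr (Q \<omega>) (count_space UNIV) (\<lambda>y. y i))"
    by (simp only: distr_source restrict_UNIV quenched_eq[symmetric])
qed (auto simp: source_measurable)

lemma restrict_source_measurable: "(\<lambda>y. restrict y J) \<in> sourceM \<rightarrow>\<^sub>M PiM J (\<lambda>_. count_space UNIV)"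
  by (rule measurable_restrict) (rule source_measurable)

text \<open>Outside \<open>J\<close> the coordinates of a restricted family are the constant
  \<open>undefined\<close>. Functionals of full source families can thus be applied to restricted
  ones without a change of type.\<close>

lemma PiM_subset_source_measurable:
  fixes J :: "'d source set"
  shows "(\<lambda>a. a) \<in> PiM J (\<lambda>_. count_space UNIV) \<rightarrow>\<^sub>M sourceM"
proof (rule measurable_PiM_single')
  let ?R = "PiM J (\<lambda>_. count_space UNIV) :: ('d source \<Rightarrow> nat ^ 'd) measure"
  fix s
  show "(\<lambda>a. a s) \<in> ?R \<rightarrow>\<^sub>M count_space UNIV"
  proof (cases "s \<in> J")
    case False
    have "(\<lambda>a. a s) \<in> ?R \<rightarrow>\<^sub>M count_space UNIV \<longleftrightarrow>
        (\<lambda>a. undefined :: nat ^ 'd) \<in> ?R \<rightarrow>\<^sub>M count_space UNIV"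
      using False by (intro measurable_cong) (auto simp: space_PiM PiE_def extensional_def)
    then show ?thesis by simp
  qed (auto intro!: measurable_component_singleton)
qed auto

text \<open>Disjoint blocks of sources are independent, so the second block may be resampled: the
  two blocks are read off two independent copies \<open>a\<close> and \<open>b\<close>.\<close>

lemma nn_integral_split_sources:
  assumes F: "F \<in> borel_measurable (sourceM \<Otimes>\<^sub>M sourceM)"
  shows "(\<integral>\<^sup>+y. F (restrict y J, restrict y (- J)) \<partial>Q \<omega>) =
    (\<integral>\<^sup>+a. \<integral>\<^sup>+b. F (restrict a J, restrict b (- J)) \<partial>Q \<omega> \<partial>Q \<omega>)"
proof -
  let ?R = "\<lambda>J. PiM J (\<lambda>_ :: 'd source. count_space (UNIV :: (nat ^ 'd) set))"
  let ?r = "\<lambda>J (y :: 'd source \<Rightarrow> nat ^ 'd). restrict y J"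
  let ?D = "\<lambda>J. distr (Q \<omega>) (?R J) (?r J)"
  have ind: "Q.indep_var \<omega> (?R J) (?r J) (?R (- J)) (?r (- J))"
    using Q.indep_var_restrict[OF indep_sources, of J "- J"] by simp
  note r = restrict_source_measurable and id = PiM_subset_source_measurable
  have rQ: "?r J \<in> Q \<omega> \<rightarrow>\<^sub>M ?R J" for J
    using r by (simp add: measurable_cong_sets[OF sets_Q refl])
  interpret D: prob_space "?D K" for K by (rule Q.prob_space_distr[OF rQ])
  have F': "F \<in> borel_measurable (?R J \<Otimes>\<^sub>M ?R K)" for J K
    using measurable_compose[OF measurable_Pair[OF measurable_compose[OF measurable_fst id]
          measurable_compose[OF measurable_snd id]] F, of J K]
    by simp
  have s: "sets (?D J \<Otimes>\<^sub>M ?D K) = sets (?R J \<Otimes>\<^sub>M ?R K)" for J K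
    by (intro sets_pair_measure_cong) simp_all
  have F'': "F \<in> borel_measurable (?D J \<Otimes>\<^sub>M ?D K)" for J K
    using F' measurable_cong_sets[OF s refl] by blast
  have D: "distr (Q \<omega>) (?R J \<Otimes>\<^sub>M ?R (- J)) (\<lambda>y. (?r J y, ?r (- J) y)) = ?D J \<Otimes>\<^sub>M ?D (- J)"
    using Q.indep_var_distribution_eq[THEN iffD1, OF ind] by simp
  have "(\<integral>\<^sup>+y. F (?r J y, ?r (- J) y) \<partial>Q \<omega>) =
      (\<integral>\<^sup>+z. F z \<partial>distr (Q \<omega>) (?R J \<Otimes>\<^sub>M ?R (- J)) (\<lambda>y. (?r J y, ?r (- J) y)))"
    using F' by (intro nn_integral_distr[symmetric] measurable_Pair rQ) simp
  also have "\<dots> = (\<integral>\<^sup>+z. F z \<partial>(?D J \<Otimes>\<^sub>M ?D (- J)))"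
    unfolding D ..
  also have "\<dots> = (\<integral>\<^sup>+a. \<integral>\<^sup>+b. F (a, b) \<partial>?D (- J) \<partial>?D J)"
    by (rule D.nn_integral_fst[symmetric]) (rule F'')
  also have "\<dots> = (\<integral>\<^sup>+a. \<integral>\<^sup>+b. F (?r J a, b) \<partial>?D (- J) \<partial>Q \<omega>)"
    by (rule nn_integral_distr[OF rQ]) (rule D.borel_measurable_nn_integral_fst[OF F''])
  also have "\<dots> = (\<integral>\<^sup>+a. \<integral>\<^sup>+b. F (?r J a, ?r (- J) b) \<partial>Q \<omega> \<partial>Q \<omega>)"
  proof (rule nn_integral_cong)
    fix a
    have "?r J a \<in> space (?D J)" by (simp add: space_PiM)
    then have "(\<lambda>b. F (?r J a, b)) \<in> borel_measurable (?D (- J))"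
      by (rule measurable_compose[OF measurable_Pair1' F''])
    then show "(\<integral>\<^sup>+b. F (?r J a, b) \<partial>?D (- J)) = (\<integral>\<^sup>+b. F (?r J a, ?r (- J) b) \<partial>Q \<omega>)"
      by (rule nn_integral_distr[OF rQ])
  qed
  finally show ?thesis .
qed

lemma nn_integral_Q_shift:
  assumes H: "H \<in> borel_measurable sourceM"
  shows "(\<integral>\<^sup>+y. H (y \<circ> shift_source k) \<partial>Q \<omega>) = (\<integral>\<^sup>+y. H y \<partial>Q (env_shift (int k) \<omega>))"
proof -
  have "(\<lambda>y. y \<circ> shift_source k) \<in> Q \<omega> \<rightarrow>\<^sub>M sourceM"
    using shift_source_measurable by (simp add: measurable_cong_sets[OF sets_Q refl])
  then show ?thesis
    unfolding distr_Q_shift[symmetric] using H by (subst nn_integral_distr) simp_all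
qed

text \<open>Markov property at the fixed time \<open>k\<close>. That \<open>G\<close> is a
  functional of the past is expressed by its invariance under deleting all sources from time
  \<open>k\<close> on, while the shifted family reads only those.\<close>

lemma nn_integral_indep:
  assumes G: "G \<in> borel_measurable sourceM" "\<And>y. G (restrict y (past_sources k)) = G y"
    and H: "H \<in> borel_measurable sourceM"
  shows "(\<integral>\<^sup>+y. G y * H (y \<circ> shift_source k) \<partial>Q \<omega>) =
    (\<integral>\<^sup>+y. G y \<partial>Q \<omega>) * (\<integral>\<^sup>+y. H y \<partial>Q (env_shift (int k) \<omega>))"
proof -
  let ?J = "past_sources k :: 'd source set"
  have shift: "restrict y (- ?J) \<circ> shift_source k = y \<circ> shift_source k" for y :: "'d source \<Rightarrow> nat ^ 'd"
    by (auto simp: fun_eq_iff past_sources_def)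
  note Hs = measurable_compose[OF shift_source_measurable H]
  have "(\<lambda>(a, b). G a * H (b \<circ> shift_source k)) \<in> borel_measurable (sourceM \<Otimes>\<^sub>M sourceM)"
    unfolding split_beta
    by (intro borel_measurable_times_ennreal measurable_compose[OF measurable_fst G(1)]
        measurable_compose[OF measurable_snd Hs])
  from nn_integral_split_sources[OF this, of \<omega> ?J]
  have "(\<integral>\<^sup>+y. G y * H (y \<circ> shift_source k) \<partial>Q \<omega>) = (\<integral>\<^sup>+a. \<integral>\<^sup>+b. G a * H (b \<circ> shift_source k) \<partial>Q \<omega> \<partial>Q \<omega>)"
    by (simp add: G(2) shift)
  also have "\<dots> = (\<integral>\<^sup>+y. G y \<partial>Q \<omega>) * (\<integral>\<^sup>+y. H (y \<circ> shift_source k) \<partial>Q \<omega>)"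
    using G(1) Hs by (simp add: nn_integral_cmult nn_integral_multc)
  finally show ?thesis by (simp add: nn_integral_Q_shift[OF H])
qed

text \<open>Sources before time \<open>k\<close> have laws read off the environment at indices below
  \<open>k\<close>; hence quenched means of past functionals are admissible past weights.\<close>

lemma nn_integral_past_cong:
  assumes G: "G \<in> borel_measurable sourceM" "\<And>y. G (restrict y (past_sources k)) = G y"
    and eq: "\<And>i. i < int k \<Longrightarrow> \<omega> i = \<omega>' i"
  shows "(\<integral>\<^sup>+y. G y \<partial>Q \<omega>) = (\<integral>\<^sup>+y. G y \<partial>Q \<omega>')"
proof -
  let ?J = "past_sources k :: 'd source set"
  let ?R = "PiM ?J (\<lambda>_. count_space UNIV) :: ('d source \<Rightarrow> nat ^ 'd) measure"
  have G': "G \<in> borel_measurable ?R"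
    by (rule measurable_compose[OF PiM_subset_source_measurable G(1)])
  have "(\<integral>\<^sup>+y. G y \<partial>Q \<omega>) = (\<integral>\<^sup>+a. G a \<partial>PiM ?J (source_law \<omega>))" for \<omega>
  proof -
    have "(\<lambda>y. restrict y ?J) \<in> Q \<omega> \<rightarrow>\<^sub>M ?R"
      using restrict_source_measurable by (simp add: measurable_cong_sets[OF sets_Q refl])
    then show ?thesis
      unfolding distr_Q_restrict[symmetric] using G' G(2) by (subst nn_integral_distr) simp_all
  qed
  moreover have "PiM ?J (source_law \<omega>) = PiM ?J (source_law \<omega>')"
    by (intro PiM_cong) (auto simp: source_law_def past_sources_def eq split: source.split)
  ultimately show ?thesis by simp
qed

text \<open>The bound is -1 and not 0 because the immigrants of time 0 have law
  \<open>q (\<omega> (-1))\<close>. This costs one unit of the mixing gap.\<close>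

lemma Q_future_cong:
  assumes "\<And>i. i \<ge> -1 \<Longrightarrow> \<omega> i = \<omega>' i"
  shows "Q \<omega> = Q \<omega>'"
  unfolding quenched_eq by (intro PiM_cong) (auto simp: source_law_def assms split: source.split)

section \<open>The annealed law\<close>

lemma annealed_kernel:
  "(\<lambda>\<omega>. distr (Q \<omega>) (P \<Otimes>\<^sub>M sourceM) (\<lambda>y. (\<omega>, y))) \<in> P \<rightarrow>\<^sub>M prob_algebra (P \<Otimes>\<^sub>M sourceM)"
  by (rule measurable_distr_prob_space2[OF Q_measurable]) simp

abbreviation joint_law :: "((int \<Rightarrow> 's) \<times> ('d source \<Rightarrow> nat ^ 'd)) measure" where
  "joint_law \<equiv> annealed P q p"

lemma sets_annealed[measurable_cong, simp]: "sets joint_law = sets (P \<Otimes>\<^sub>M sourceM)"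
  unfolding annealed_def
  by (rule sets_bind) (use P.not_empty in \<open>auto\<close>)

lemma space_annealed: "space joint_law = space P \<times> UNIV"
  using sets_eq_imp_space_eq[OF sets_annealed] by (simp add: space_pair_measure)

lemma nn_integral_annealed:
  assumes f: "f \<in> borel_measurable (P \<Otimes>\<^sub>M sourceM)"
  shows "(\<integral>\<^sup>+x. f x \<partial>joint_law) = (\<integral>\<^sup>+\<omega>. \<integral>\<^sup>+y. f (\<omega>, y) \<partial>Q \<omega> \<partial>P)"
  unfolding annealed_def
  using f by (subst nn_integral_bind[OF f measurable_prob_algebraD[OF annealed_kernel]])
    (auto intro!: nn_integral_cong simp: nn_integral_distr)

lemma prob_annealed: "prob_space joint_law"
proof
  have "emeasure joint_law (space joint_law) = (\<integral>\<^sup>+x. 1 \<partial>joint_law)" by simp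
  also have "\<dots> = (\<integral>\<^sup>+\<omega>. \<integral>\<^sup>+y. 1 \<partial>Q \<omega> \<partial>P)"
    by (rule nn_integral_annealed) simp
  also have "\<dots> = 1" using Q.emeasure_space_1 P.emeasure_space_1 by simp
  finally show "emeasure joint_law (space joint_law) = 1" .
qed

end

section \<open>Mixing of the environment for functions\<close>

lemma (in prob_space) mix_coeff_set_bounded:
  assumes "\<A> \<subseteq> events" "\<B> \<subseteq> events" "A \<in> \<A>" "B \<in> \<B>"
  shows "\<bar>prob (A \<inter> B) / prob B - prob A\<bar> \<le> 1"
proof -
  have "A \<in> events" "B \<in> events" using assms by auto
  then have "prob (A \<inter> B) \<le> prob B" by (intro finite_measure_mono) auto
  then have "prob (A \<inter> B) / prob B \<le> 1" "0 \<le> prob (A \<inter> B) / prob B"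
    by (auto simp: divide_le_eq)
  moreover have "prob A \<le> 1" "0 \<le> prob A" by auto
  ultimately show ?thesis by linarith
qed

text \<open>Multiplied by \<open>prob B\<close>, the inequality holds for null events as well;
  superlevel sets, to which it is applied, may be null.\<close>

lemma (in prob_space) mix_coeff_upper:
  assumes "\<A> \<subseteq> events" "\<B> \<subseteq> events" "A \<in> \<A>" "B \<in> \<B>"
  shows "\<bar>prob (A \<inter> B) - prob A * prob B\<bar> \<le> mix_coeff M \<A> \<B> * prob B"
proof (cases "prob B > 0")
  case True
  have "\<bar>prob (A \<inter> B) / prob B - prob A\<bar> \<le> mix_coeff M \<A> \<B>"
    unfolding mix_coeff_def
  proof (rule cSup_upper)
    show "bdd_above {\<bar>prob (A \<inter> B) / prob B - prob A\<bar> | A B. A \<in> \<A> \<and> B \<in> \<B> \<and> prob B > 0}"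
      using mix_coeff_set_bounded[OF assms(1,2)] by (auto intro!: bdd_aboveI[of _ 1])
  qed (use assms True in auto)
  then have "\<bar>prob (A \<inter> B) / prob B - prob A\<bar> * prob B \<le> mix_coeff M \<A> \<B> * prob B"
    using True by (intro mult_right_mono) auto
  moreover have "\<bar>prob (A \<inter> B) / prob B - prob A\<bar> * prob B = \<bar>(prob (A \<inter> B) / prob B - prob A) * prob B\<bar>"
    by (simp add: abs_mult)
  moreover have "(prob (A \<inter> B) / prob B - prob A) * prob B = prob (A \<inter> B) - prob A * prob B"
    using True by (simp add: left_diff_distrib)
  ultimately show ?thesis by simp
next
  case False
  then have "prob B = 0" using measure_nonneg[of M B] by linarith
  moreover have "prob (A \<inter> B) \<le> prob B"
    using assms by (intro finite_measure_mono) auto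
  ultimately have "prob (A \<inter> B) = 0" using measure_nonneg[of M "A \<inter> B"] by linarith
  with \<open>prob B = 0\<close> show ?thesis by simp
qed

lemma (in prob_space) mix_coeff_nonneg:
  assumes "\<A> \<subseteq> events" "\<B> \<subseteq> events" "space M \<in> \<A>" "space M \<in> \<B>"
  shows "0 \<le> mix_coeff M \<A> \<B>"
  using mix_coeff_upper[OF assms] by (simp add: prob_space)

text \<open>The full space in both families makes the set of values nonempty, without which its real
  \<open>Sup\<close> would be unspecified.\<close>

lemma (in prob_space) mix_coeff_least:
  assumes "space M \<in> \<A>" "space M \<in> \<B>"
    and "\<And>A B. A \<in> \<A> \<Longrightarrow> B \<in> \<B> \<Longrightarrow> prob B > 0 \<Longrightarrow> \<bar>prob (A \<inter> B) / prob B - prob A\<bar> \<le> c"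
  shows "mix_coeff M \<A> \<B> \<le> c"
  unfolding mix_coeff_def
proof (rule cSup_least)
  have "\<bar>prob (space M \<inter> space M) / prob (space M) - prob (space M)\<bar>
      \<in> {\<bar>prob (A \<inter> B) / prob B - prob A\<bar> |A B. A \<in> \<A> \<and> B \<in> \<B> \<and> 0 < prob B}"
    using assms(1,2) prob_space by fastforce
  then show "{\<bar>prob (A \<inter> B) / prob B - prob A\<bar> |A B. A \<in> \<A> \<and> B \<in> \<B> \<and> 0 < prob B} \<noteq> {}" by blast
qed (use assms(3) in auto)

lemma ennreal_layer_cake:
  fixes x :: ennreal
  assumes "x \<le> 1"
  shows "x = (\<integral>\<^sup>+t. indicator {0..1} t * (if ennreal t < x then 1 else 0) \<partial>lborel)"
proof -
  obtain r where r: "x = ennreal r" "0 \<le> r" "r \<le> 1"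
    using assms by (cases x) (auto simp: ennreal_le_1 top_unique)
  have "(\<integral>\<^sup>+t. indicator {0..1} t * (if ennreal t < x then 1 else 0) \<partial>lborel) =
      (\<integral>\<^sup>+t. indicator {0..<r} t \<partial>lborel)"
    using r by (intro nn_integral_cong) (auto simp: indicator_def ennreal_less_iff)
  also have "\<dots> = x" using r by simp
  finally show ?thesis ..
qed

text \<open>Tonelli over the superlevel sets of \<open>g\<close>; \<open>k\<close> is a spectator,
  later an indicator, the constant 1 or a second function.\<close>

lemma (in sigma_finite_measure) nn_integral_layer_cake:
  assumes g: "g \<in> borel_measurable M" "\<And>x. g x \<le> 1" and k: "k \<in> borel_measurable M"
  shows "(\<integral>\<^sup>+x. g x * k x \<partial>M) =
    (\<integral>\<^sup>+t. indicator {0..1} t * (\<integral>\<^sup>+x. (if ennreal t < g x then 1 else 0) * k x \<partial>M) \<partial>lborel)"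
proof -
  interpret L: pair_sigma_finite lborel M by unfold_locales
  note g(1)[measurable] k[measurable]
  have "(\<integral>\<^sup>+x. g x * k x \<partial>M) =
      (\<integral>\<^sup>+x. (\<integral>\<^sup>+t. indicator {0..1} t * (if ennreal t < g x then 1 else 0) \<partial>lborel) * k x \<partial>M)"
    by (subst ennreal_layer_cake[OF g(2)]) simp
  also have "\<dots> = (\<integral>\<^sup>+x. \<integral>\<^sup>+t. indicator {0..1} t * ((if ennreal t < g x then 1 else 0) * k x) \<partial>lborel \<partial>M)"
    by (intro nn_integral_cong, subst nn_integral_multc[symmetric]) (auto simp: mult.assoc)
  also have "\<dots> = (\<integral>\<^sup>+t. \<integral>\<^sup>+x. indicator {0..1} t * ((if ennreal t < g x then 1 else 0) * k x) \<partial>M \<partial>lborel)"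
    by (rule L.Fubini') measurable
  also have "\<dots> = (\<integral>\<^sup>+t. indicator {0..1} t * (\<integral>\<^sup>+x. (if ennreal t < g x then 1 else 0) * k x \<partial>M) \<partial>lborel)"
    by (intro nn_integral_cong nn_integral_cmult) measurable
  finally show ?thesis .
qed

context branching_env
begin

text \<open>Measurability with respect to the coordinates in \<open>J\<close> is split into measurability with
  respect to \<open>P\<close> and dependence on these coordinates only.\<close>

definition env_dep :: "int set \<Rightarrow> ((int \<Rightarrow> 's) \<Rightarrow> 'b) \<Rightarrow> bool" where
  "env_dep J g \<longleftrightarrow> (\<forall>\<omega>\<in>space P. \<forall>\<omega>'\<in>space P. (\<forall>i\<in>J. \<omega> i = \<omega>' i) \<longrightarrow> g \<omega> = g \<omega>')"

lemma env_depD: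
  "env_dep J g \<Longrightarrow> \<omega> \<in> space P \<Longrightarrow> \<omega>' \<in> space P \<Longrightarrow> (\<And>i. i \<in> J \<Longrightarrow> \<omega> i = \<omega>' i) \<Longrightarrow> g \<omega> = g \<omega>'"
  unfolding env_dep_def by blast

lemma env_depI:
  "(\<And>\<omega> \<omega>'. \<omega> \<in> space P \<Longrightarrow> \<omega>' \<in> space P \<Longrightarrow> (\<And>i. i \<in> J \<Longrightarrow> \<omega> i = \<omega>' i) \<Longrightarrow> g \<omega> = g \<omega>') \<Longrightarrow> env_dep J g"
  unfolding env_dep_def by blast

lemma env_dep_mono: "env_dep J g \<Longrightarrow> J \<subseteq> K \<Longrightarrow> env_dep K g"
  unfolding env_dep_def by blast

lemma env_dep_comb: "env_dep J f \<Longrightarrow> env_dep J g \<Longrightarrow> env_dep J (\<lambda>\<omega>. h (f \<omega>) (g \<omega>))"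
  unfolding env_dep_def by metis

lemma env_dep_Collect: "env_dep J f \<Longrightarrow> env_dep J (\<lambda>\<omega>. \<omega> \<in> {\<omega>\<in>space P. R (f \<omega>)})"
proof (rule env_depI)
  fix \<omega> \<omega>' assume f: "env_dep J f" and w: "\<omega> \<in> space P" "\<omega>' \<in> space P" "\<And>i. i \<in> J \<Longrightarrow> \<omega> i = \<omega>' i"
  have "f \<omega> = f \<omega>'" by (rule env_depD[OF f w])
  with w(1,2) show "(\<omega> \<in> {\<omega>\<in>space P. R (f \<omega>)}) = (\<omega>' \<in> {\<omega>\<in>space P. R (f \<omega>)})" by simp
qed

lemma env_dep_shift: "env_dep J f \<Longrightarrow> env_dep ((+) k ` J) (\<lambda>\<omega>. f (env_shift k \<omega>))"
proof (rule env_depI)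
  fix \<omega> \<omega>' assume f: "env_dep J f" and w: "\<omega> \<in> space P" "\<omega>' \<in> space P" "\<And>i. i \<in> (+) k ` J \<Longrightarrow> \<omega> i = \<omega>' i"
  show "f (env_shift k \<omega>) = f (env_shift k \<omega>')"
  proof (rule env_depD[OF f])
    fix i assume "i \<in> J"
    then have "\<omega> (k + i) = \<omega>' (k + i)" by (intro w(3)) auto
    then show "env_shift k \<omega> i = env_shift k \<omega>' i" by (simp add: env_shift_def add.commute)
  qed (use w(1,2) in auto)
qed

text \<open>Filling up the coordinates outside \<open>J\<close> with a fixed point of
  \<open>S\<close> is a measurable section \<open>m\<close> of the restriction map; a set that
  depends on \<open>J\<close> only is the pullback of its preimage under \<open>m\<close>. No
  structure of \<open>S\<close> enters.\<close>

lemma env_dep_sets: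
  assumes "B \<in> sets P" "env_dep J (\<lambda>\<omega>. \<omega> \<in> B)"
  shows "B \<in> sets (vimage_algebra (space P) (\<lambda>\<omega>. restrict \<omega> J) (PiM J (\<lambda>_. S)))"
proof -
  \<comment> \<open>The nonempty space of a probability measure supplies the base point.\<close>
  obtain \<omega>0 where "\<omega>0 \<in> space P" using P.not_empty by auto
  then have b: "\<omega>0 0 \<in> space S" by (simp add: in_space_P)
  define m where "m a = (\<lambda>i. if i \<in> J then a i else \<omega>0 0)" for a :: "int \<Rightarrow> 's"
  have "m \<in> PiM J (\<lambda>_. S) \<rightarrow>\<^sub>M PiM UNIV (\<lambda>_. S)"
  proof (rule measurable_PiM_single')
    show "(\<lambda>a. m a i) \<in> PiM J (\<lambda>_. S) \<rightarrow>\<^sub>M S" for i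
      using b by (cases "i \<in> J") (auto simp: m_def intro!: measurable_component_singleton)
  qed (use b in \<open>auto simp: m_def space_PiM PiE_iff\<close>)
  then have m: "m \<in> PiM J (\<lambda>_. S) \<rightarrow>\<^sub>M P" by (simp add: measurable_cong_sets[OF refl sets_P])
  have r: "(\<lambda>\<omega>. restrict \<omega> J) \<in> space P \<rightarrow> space (PiM J (\<lambda>_. S))"
    by (auto simp: in_space_P space_PiM)
  have "B = (\<lambda>\<omega>. restrict \<omega> J) -` (m -` B \<inter> space (PiM J (\<lambda>_. S))) \<inter> space P"
  proof -
    have "\<omega> \<in> B \<longleftrightarrow> m (restrict \<omega> J) \<in> B" if "\<omega> \<in> space P" for \<omega>
      by (rule env_depD[OF assms(2) that])
        (use that b in \<open>auto simp: m_def in_space_P\<close>)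
    then show ?thesis using sets.sets_into_space[OF assms(1)] r by auto
  qed
  also have "\<dots> \<in> sets (vimage_algebra (space P) (\<lambda>\<omega>. restrict \<omega> J) (PiM J (\<lambda>_. S)))"
    by (intro in_vimage_algebra measurable_sets[OF m] assms(1))
  finally show ?thesis .
qed

lemma vimage_restrict_subset:
  "sets (vimage_algebra (space P) (\<lambda>\<omega>. restrict \<omega> J) (PiM J (\<lambda>_. S))) \<subseteq> sets P"
proof -
  have "(\<lambda>\<omega>. restrict \<omega> J) \<in> P \<rightarrow>\<^sub>M PiM J (\<lambda>_. S)"
    by (rule measurable_restrict) (rule coord_measurable)
  then show ?thesis
    by (subst sets_vimage_algebra2) (auto intro: measurable_sets dest: measurable_space)
qed

definition mix_rate :: "nat \<Rightarrow> real" where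
  "mix_rate n = mix_coeff P (env_future S P n) (env_past S P)"

lemma mix_rate_nonneg: "0 \<le> mix_rate n"
  unfolding mix_rate_def env_future_def env_past_def
  using sets.top[of "vimage_algebra (space P) (\<lambda>\<omega>. restrict \<omega> J) (PiM J (\<lambda>_. S))" for J]
  by (intro P.mix_coeff_nonneg vimage_restrict_subset) simp_all

lemma mixing_events:
  assumes "A \<in> sets P" "env_dep {int n..} (\<lambda>\<omega>. \<omega> \<in> A)" "B \<in> sets P" "env_dep {..<0} (\<lambda>\<omega>. \<omega> \<in> B)"
  shows "P.prob (A \<inter> B) \<le> (P.prob A + mix_rate n) * P.prob B"
    and "P.prob A * P.prob B \<le> P.prob (A \<inter> B) + mix_rate n * P.prob B"
proof -
  have "\<bar>P.prob (A \<inter> B) - P.prob A * P.prob B\<bar> \<le> mix_rate n * P.prob B"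
    unfolding mix_rate_def env_future_def env_past_def
    by (intro P.mix_coeff_upper vimage_restrict_subset env_dep_sets assms)
  then show "P.prob (A \<inter> B) \<le> (P.prob A + mix_rate n) * P.prob B"
    "P.prob A * P.prob B \<le> P.prob (A \<inter> B) + mix_rate n * P.prob B"
    by (auto simp: distrib_right abs_le_iff)
qed

text \<open>Superlevel sets of \<open>h\<close> are future events, so the bound for events
  integrates over the level \<open>t\<close> in [0,1]. The lower bound is written additively because
  subtraction truncates on \<open>ennreal\<close>.\<close>

lemma mixing_event_fun:
  assumes B: "B \<in> sets P" "env_dep {..<0} (\<lambda>\<omega>. \<omega> \<in> B)"
    and h: "h \<in> borel_measurable P" "env_dep {int n..} h" "\<And>\<omega>. h \<omega> \<le> 1"
  shows "(\<integral>\<^sup>+\<omega>. h \<omega> * indicator B \<omega> \<partial>P) \<le> ((\<integral>\<^sup>+\<omega>. h \<omega> \<partial>P) + mix_rate n) * emeasure P B"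
    and "(\<integral>\<^sup>+\<omega>. h \<omega> \<partial>P) * emeasure P B \<le> (\<integral>\<^sup>+\<omega>. h \<omega> * indicator B \<omega> \<partial>P) + mix_rate n * emeasure P B"
proof -
  note h(1)[measurable] B(1)[measurable]
  define A where "A t = {\<omega>\<in>space P. ennreal t < h \<omega>}" for t
  have A: "A t \<in> sets P" "env_dep {int n..} (\<lambda>\<omega>. \<omega> \<in> A t)" for t
  proof -
    show "A t \<in> sets P" unfolding A_def by measurable
    show "env_dep {int n..} (\<lambda>\<omega>. \<omega> \<in> A t)"
      unfolding A_def by (rule env_dep_Collect[OF h(2)])
  qed
  have e: "(\<integral>\<^sup>+\<omega>. (if ennreal t < h \<omega> then 1 else 0) * indicator B \<omega> \<partial>P) = P.prob (A t \<inter> B)" for t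
  proof -
    have "(\<integral>\<^sup>+\<omega>. (if ennreal t < h \<omega> then 1 else 0) * indicator B \<omega> \<partial>P) = (\<integral>\<^sup>+\<omega>. indicator (A t \<inter> B) \<omega> \<partial>P)"
      by (intro nn_integral_cong) (auto simp: A_def indicator_def)
    then show ?thesis using A(1) B(1) by (simp add: P.emeasure_eq_measure)
  qed
  have e1: "(\<integral>\<^sup>+\<omega>. (if ennreal t < h \<omega> then 1 else 0) \<partial>P) = P.prob (A t)" for t
  proof -
    have "(\<integral>\<^sup>+\<omega>. (if ennreal t < h \<omega> then 1 else 0) \<partial>P) = (\<integral>\<^sup>+\<omega>. indicator (A t) \<omega> \<partial>P)"
      by (intro nn_integral_cong) (auto simp: A_def indicator_def)
    then show ?thesis using A(1) by (simp add: P.emeasure_eq_measure)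
  qed
  have hB: "(\<integral>\<^sup>+\<omega>. h \<omega> * indicator B \<omega> \<partial>P) = (\<integral>\<^sup>+t. indicator {0..1} t * ennreal (P.prob (A t \<inter> B)) \<partial>lborel)"
    using P.nn_integral_layer_cake[OF h(1,3), of "indicator B"] B(1) by (simp add: e)
  have h1: "(\<integral>\<^sup>+\<omega>. h \<omega> \<partial>P) = (\<integral>\<^sup>+t. indicator {0..1} t * ennreal (P.prob (A t)) \<partial>lborel)"
    using P.nn_integral_layer_cake[OF h(1,3), of "\<lambda>_. 1"] by (simp add: e1)
  have m1[measurable]: "(\<lambda>t. ennreal (P.prob (A t \<inter> B))) \<in> borel_measurable lborel"
    unfolding e[symmetric] by measurable
  have m2[measurable]: "(\<lambda>t. ennreal (P.prob (A t))) \<in> borel_measurable lborel"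
    unfolding e1[symmetric] by measurable
  have c: "(\<integral>\<^sup>+t. indicator {0..1} t * c \<partial>(lborel :: real measure)) = c" for c :: ennreal
    by (subst nn_integral_multc) simp_all
  have "(\<integral>\<^sup>+t. indicator {0..1} t * ennreal (P.prob (A t \<inter> B)) \<partial>lborel) \<le>
      (\<integral>\<^sup>+t. (indicator {0..1} t * ennreal (P.prob (A t)) + indicator {0..1} t * ennreal (mix_rate n)) * ennreal (P.prob B) \<partial>lborel)"
  proof (intro nn_integral_mono)
    fix t :: real
    have "ennreal (P.prob (A t \<inter> B)) \<le> (ennreal (P.prob (A t)) + mix_rate n) * ennreal (P.prob B)"
      using mixing_events(1)[OF A B, of t] mix_rate_nonneg
      by (simp add: ennreal_plus[symmetric] ennreal_mult[symmetric] del: ennreal_plus)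
    then show "indicator {0..1} t * ennreal (P.prob (A t \<inter> B)) \<le>
        (indicator {0..1} t * ennreal (P.prob (A t)) + indicator {0..1} t * ennreal (mix_rate n)) * ennreal (P.prob B)"
      by (auto simp: indicator_def)
  qed
  also have "\<dots> = ((\<integral>\<^sup>+\<omega>. h \<omega> \<partial>P) + mix_rate n) * emeasure P B"
    by (subst nn_integral_multc, simp, subst nn_integral_add, simp, simp)
      (simp add: c h1 P.emeasure_eq_measure)
  finally show "(\<integral>\<^sup>+\<omega>. h \<omega> * indicator B \<omega> \<partial>P) \<le> ((\<integral>\<^sup>+\<omega>. h \<omega> \<partial>P) + mix_rate n) * emeasure P B"
    unfolding hB .
  have "(\<integral>\<^sup>+\<omega>. h \<omega> \<partial>P) * emeasure P B = (\<integral>\<^sup>+t. indicator {0..1} t * ennreal (P.prob (A t)) * emeasure P B \<partial>lborel)"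
    unfolding h1 by (subst nn_integral_multc) simp_all
  also have "\<dots> \<le> (\<integral>\<^sup>+t. indicator {0..1} t * ennreal (P.prob (A t \<inter> B)) + indicator {0..1} t * (mix_rate n * emeasure P B) \<partial>lborel)"
  proof (intro nn_integral_mono)
    fix t :: real
    have "ennreal (P.prob (A t)) * emeasure P B \<le> ennreal (P.prob (A t \<inter> B)) + mix_rate n * emeasure P B"
      using mixing_events(2)[OF A B, of t] mix_rate_nonneg
      by (simp add: P.emeasure_eq_measure ennreal_plus[symmetric] ennreal_mult[symmetric] del: ennreal_plus)
    then show "indicator {0..1} t * ennreal (P.prob (A t)) * emeasure P B \<le>
        indicator {0..1} t * ennreal (P.prob (A t \<inter> B)) + indicator {0..1} t * (mix_rate n * emeasure P B)"
      by (auto simp: indicator_def)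
  qed
  also have "\<dots> = (\<integral>\<^sup>+\<omega>. h \<omega> * indicator B \<omega> \<partial>P) + mix_rate n * emeasure P B"
    by (subst nn_integral_add, simp, simp) (simp add: c hB)
  finally show "(\<integral>\<^sup>+\<omega>. h \<omega> \<partial>P) * emeasure P B \<le> (\<integral>\<^sup>+\<omega>. h \<omega> * indicator B \<omega> \<partial>P) + mix_rate n * emeasure P B" .
qed

text \<open>The same argument once more, now in the weight \<open>g\<close>. The error is
  proportional to the integral of \<open>g\<close>, which is the strength of uniform mixing and what
  bounds on conditional expectations require.\<close>

lemma mixing_fun:
  assumes g: "g \<in> borel_measurable P" "env_dep {..<0} g" "\<And>\<omega>. g \<omega> \<le> 1"
    and h: "h \<in> borel_measurable P" "env_dep {int n..} h" "\<And>\<omega>. h \<omega> \<le> 1"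
  shows "(\<integral>\<^sup>+\<omega>. g \<omega> * h \<omega> \<partial>P) \<le> ((\<integral>\<^sup>+\<omega>. h \<omega> \<partial>P) + mix_rate n) * (\<integral>\<^sup>+\<omega>. g \<omega> \<partial>P)"
    and "(\<integral>\<^sup>+\<omega>. h \<omega> \<partial>P) * (\<integral>\<^sup>+\<omega>. g \<omega> \<partial>P) \<le> (\<integral>\<^sup>+\<omega>. g \<omega> * h \<omega> \<partial>P) + mix_rate n * (\<integral>\<^sup>+\<omega>. g \<omega> \<partial>P)"
proof -
  note h(1)[measurable] g(1)[measurable]
  define B where "B t = {\<omega>\<in>space P. ennreal t < g \<omega>}" for t
  have B: "B t \<in> sets P" "env_dep {..<0} (\<lambda>\<omega>. \<omega> \<in> B t)" for t
  proof -
    show "B t \<in> sets P" unfolding B_def by measurable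
    show "env_dep {..<0} (\<lambda>\<omega>. \<omega> \<in> B t)"
      unfolding B_def by (rule env_dep_Collect[OF g(2)])
  qed
  let ?h = "\<integral>\<^sup>+\<omega>. h \<omega> \<partial>P" and ?I = "\<lambda>t. indicator {0..1} t :: ennreal"
  define u where "u t = (\<integral>\<^sup>+\<omega>. (if ennreal t < g \<omega> then 1 else 0) * h \<omega> \<partial>P)" for t
  define v where "v t = (\<integral>\<^sup>+\<omega>. (if ennreal t < g \<omega> then 1 else 0) \<partial>P)" for t
  have [measurable]: "u \<in> borel_measurable lborel" "v \<in> borel_measurable lborel"
    unfolding u_def v_def by measurable
  have u: "u t = (\<integral>\<^sup>+\<omega>. h \<omega> * indicator (B t) \<omega> \<partial>P)" for t
    unfolding u_def by (intro nn_integral_cong) (auto simp: B_def indicator_def)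
  have v: "v t = emeasure P (B t)" for t
  proof -
    have "v t = (\<integral>\<^sup>+\<omega>. indicator (B t) \<omega> \<partial>P)"
      unfolding v_def by (intro nn_integral_cong) (auto simp: B_def indicator_def)
    then show ?thesis using B(1) by simp
  qed
  have gh: "(\<integral>\<^sup>+\<omega>. g \<omega> * h \<omega> \<partial>P) = (\<integral>\<^sup>+t. ?I t * u t \<partial>lborel)"
    unfolding u_def by (rule P.nn_integral_layer_cake[OF g(1,3) h(1)])
  have g1: "(\<integral>\<^sup>+\<omega>. g \<omega> \<partial>P) = (\<integral>\<^sup>+t. ?I t * v t \<partial>lborel)"
    using P.nn_integral_layer_cake[OF g(1,3), of "\<lambda>_. 1"] by (simp add: v_def)
  note m = mixing_event_fun[OF B h, folded u v]
  have "(\<integral>\<^sup>+t. ?I t * u t \<partial>lborel) \<le> (\<integral>\<^sup>+t. (?h + mix_rate n) * (?I t * v t) \<partial>lborel)"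
    using m(1) by (intro nn_integral_mono) (auto simp: indicator_def)
  also have "\<dots> = (?h + mix_rate n) * (\<integral>\<^sup>+\<omega>. g \<omega> \<partial>P)"
    unfolding g1 by (rule nn_integral_cmult) measurable
  finally show "(\<integral>\<^sup>+\<omega>. g \<omega> * h \<omega> \<partial>P) \<le> (?h + mix_rate n) * (\<integral>\<^sup>+\<omega>. g \<omega> \<partial>P)"
    unfolding gh .
  have "?h * (\<integral>\<^sup>+\<omega>. g \<omega> \<partial>P) = (\<integral>\<^sup>+t. ?h * (?I t * v t) \<partial>lborel)"
    unfolding g1 by (rule nn_integral_cmult[symmetric]) measurable
  also have "\<dots> \<le> (\<integral>\<^sup>+t. ?I t * u t + mix_rate n * (?I t * v t) \<partial>lborel)"
    using m(2) by (intro nn_integral_mono) (auto simp: indicator_def)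
  also have "\<dots> = (\<integral>\<^sup>+t. ?I t * u t \<partial>lborel) + (\<integral>\<^sup>+t. mix_rate n * (?I t * v t) \<partial>lborel)"
    by (rule nn_integral_add) measurable
  also have "(\<integral>\<^sup>+t. mix_rate n * (?I t * v t) \<partial>lborel) = mix_rate n * (\<integral>\<^sup>+\<omega>. g \<omega> \<partial>P)"
    unfolding g1 by (rule nn_integral_cmult) measurable
  finally show "?h * (\<integral>\<^sup>+\<omega>. g \<omega> \<partial>P) \<le> (\<integral>\<^sup>+\<omega>. g \<omega> * h \<omega> \<partial>P) + mix_rate n * (\<integral>\<^sup>+\<omega>. g \<omega> \<partial>P)"
    unfolding gh .
qed

end

section \<open>Loss of memory along returns to zero\<close>

declare nu.simps(2)[simp del]

text \<open>Truncation at 0 is subadditive for arbitrary signs; needed since lower ends of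
  oscillation intervals may be negative.\<close>

lemma ennreal_add_le: "ennreal (a + b) \<le> ennreal a + ennreal b"
proof (cases "0 \<le> a \<and> 0 \<le> b")
  case False
  then show ?thesis
    by (cases "0 \<le> a") (auto simp: not_le ennreal_neg intro!: ennreal_leI)
qed simp

lemma suminf_nu_cases:
  fixes X :: ennreal
  assumes "v \<noteq> \<infinity>"
  shows "(\<Sum>k. X * (if v = enat k then 1 else 0)) = X"
proof -
  obtain j where j: "v = enat j" using assms by auto
  have "(\<Sum>k. X * (if v = enat k then 1 else 0)) = (\<Sum>k\<in>{j}. X * (if v = enat k then 1 else 0))"
    by (rule suminf_finite) (auto simp: j)
  then show ?thesis by (simp add: j)
qed

context branching_env
begin

lemma nu_popul_measurable[measurable]: "(\<lambda>y. nu (popul y) N) \<in> sourceM \<rightarrow>\<^sub>M count_space UNIV"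
  using measurable_compose[OF path_popul_measurable nu_measurable] .

lemma shifted_popul_measurable[measurable]:
  "(\<lambda>y. shifted_path (popul y) N) \<in> sourceM \<rightarrow>\<^sub>M PiM UNIV (\<lambda>_. count_space UNIV)"
  using measurable_compose[OF path_popul_measurable shifted_path_measurable] .

lemma nu_eq_measurable[measurable]: "Measurable.pred sourceM (\<lambda>y. nu (popul y) N = enat k)"
  by (rule measurable_compose[OF nu_popul_measurable]) simp

definition return_prob :: "nat \<Rightarrow> nat \<Rightarrow> (int \<Rightarrow> 's) \<Rightarrow> ennreal" where
  "return_prob N k \<omega> = (\<integral>\<^sup>+y. (if nu (popul y) N = enat k then 1 else 0) \<partial>Q \<omega>)"

definition future_mean :: "((nat \<Rightarrow> (nat ^ 'd) option) \<Rightarrow> ennreal) \<Rightarrow> nat \<Rightarrow> (int \<Rightarrow> 's) \<Rightarrow> ennreal" where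
  "future_mean F n \<omega> = (\<integral>\<^sup>+y. F (shifted_path (popul y) n) \<partial>Q \<omega>)"

abbreviation opathM :: "(nat \<Rightarrow> (nat ^ 'd) option) measure" where
  "opathM \<equiv> PiM UNIV (\<lambda>_. count_space UNIV)"

lemma nu_past:
  "(nu (popul (restrict y (past_sources k))) m = enat k) = (nu (popul y) m = enat k)"
  by (rule nu_cong) (simp add: past_sources_def popul_restrict)

lemma return_prob_measurable[measurable]: "return_prob N k \<in> borel_measurable P"
  unfolding return_prob_def[abs_def] by (rule nn_integral_Q_measurable1) measurable

lemma nn_integral_Q_le_1: "(\<And>y. f y \<le> 1) \<Longrightarrow> (\<integral>\<^sup>+y. f y \<partial>Q \<omega>) \<le> 1"
  using nn_integral_mono[of "Q \<omega>" f "\<lambda>_. 1"] Q.emeasure_space_1[of \<omega>] by simp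

lemma return_prob_le_1: "return_prob N k \<omega> \<le> 1"
  unfolding return_prob_def by (rule nn_integral_Q_le_1) simp

lemma return_prob_dep: "env_dep {..<int k} (return_prob N k)"
  unfolding return_prob_def
  by (rule env_depI, rule nn_integral_past_cong[where k = k]) (auto simp: nu_past)

lemma future_mean_measurable: "F \<in> borel_measurable opathM \<Longrightarrow> future_mean F n \<in> borel_measurable P"
  unfolding future_mean_def[abs_def]
  by (rule nn_integral_Q_measurable1) (rule measurable_compose[OF shifted_popul_measurable])

lemma future_mean_le_1: "(\<And>x. F x \<le> 1) \<Longrightarrow> future_mean F n \<omega> \<le> 1"
  unfolding future_mean_def by (rule nn_integral_Q_le_1)

lemma future_mean_dep: "env_dep {-1..} (future_mean F n)"
proof (rule env_depI)
  fix \<omega> \<omega>' :: "int \<Rightarrow> 's" assume "\<And>i. i \<in> {-1..} \<Longrightarrow> \<omega> i = \<omega>' i"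
  then have "Q \<omega> = Q \<omega>'" by (intro Q_future_cong) auto
  then show "future_mean F n \<omega> = future_mean F n \<omega>'" by (simp add: future_mean_def)
qed

text \<open>Strong Markov property at the \<open>m\<close>-th return, localised to its value
  \<open>k\<close>: there the process is at 0, so the later path is a functional of the shifted
  sources. \<open>G\<close> has to be a past functional only on this event, which is what membership
  in the \<sigma>-algebra before the return provides.\<close>

lemma renewal_at:
  assumes G: "G \<in> borel_measurable sourceM"
      "\<And>y. nu (popul y) m = enat k \<Longrightarrow> G (restrict y (past_sources k)) = G y"
    and F: "F \<in> borel_measurable opathM"
  shows "(\<integral>\<^sup>+y. G y * F (shifted_path (popul y) (m + n)) * (if nu (popul y) m = enat k then 1 else 0) \<partial>Q \<omega>)
    = (\<integral>\<^sup>+y. G y * (if nu (popul y) m = enat k then 1 else 0) \<partial>Q \<omega>) * future_mean F n (env_shift (int k) \<omega>)"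
proof -
  let ?G = "\<lambda>y. G y * (if nu (popul y) m = enat k then 1 else 0)"
  let ?H = "\<lambda>y. F (shifted_path (popul y) n)"
  have "G y * F (shifted_path (popul y) (m + n)) * (if nu (popul y) m = enat k then 1 else 0) =
      ?G y * ?H (y \<circ> shift_source k)" for y
  proof (cases "nu (popul y) m = enat k")
    case True
    then have "popul y k = 0" by (rule nu_eq_0_state) simp
    then have "(\<lambda>i. popul y (k + i)) = popul (y \<circ> shift_source k)" by (simp add: popul_shift)
    then show ?thesis using shifted_path_shift[OF True, of n] True by (simp add: mult.commute)
  qed simp
  then have "(\<integral>\<^sup>+y. G y * F (shifted_path (popul y) (m + n)) * (if nu (popul y) m = enat k then 1 else 0) \<partial>Q \<omega>)
      = (\<integral>\<^sup>+y. ?G y * ?H (y \<circ> shift_source k) \<partial>Q \<omega>)" by simp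
  also have "\<dots> = (\<integral>\<^sup>+y. ?G y \<partial>Q \<omega>) * (\<integral>\<^sup>+y. ?H y \<partial>Q (env_shift (int k) \<omega>))"
  proof (rule nn_integral_indep)
    show "?G \<in> borel_measurable sourceM" using G(1) by measurable
    show "?H \<in> borel_measurable sourceM" using F by (rule measurable_compose[OF shifted_popul_measurable])
    show "?G (restrict y (past_sources k)) = ?G y" for y by (simp add: nu_past G(2))
  qed
  finally show ?thesis unfolding future_mean_def .
qed

lemma nn_integral_nu_cases:
  assumes "AE y in Q \<omega>. nu (popul y) m \<noteq> \<infinity>" "X \<in> borel_measurable sourceM"
  shows "(\<integral>\<^sup>+y. X y \<partial>Q \<omega>) = (\<Sum>k. \<integral>\<^sup>+y. X y * (if nu (popul y) m = enat k then 1 else 0) \<partial>Q \<omega>)"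
proof -
  have "(\<integral>\<^sup>+y. X y \<partial>Q \<omega>) = (\<integral>\<^sup>+y. (\<Sum>k. X y * (if nu (popul y) m = enat k then 1 else 0)) \<partial>Q \<omega>)"
  proof (rule nn_integral_cong_AE)
    show "AE y in Q \<omega>. X y = (\<Sum>k. X y * (if nu (popul y) m = enat k then 1 else 0))"
      using assms(1) by eventually_elim (rule suminf_nu_cases[symmetric])
  qed
  also have "\<dots> = (\<Sum>k. \<integral>\<^sup>+y. X y * (if nu (popul y) m = enat k then 1 else 0) \<partial>Q \<omega>)"
  proof (rule nn_integral_suminf)
    fix k
    have "(\<lambda>y. X y * (if nu (popul y) m = enat k then 1 else 0)) \<in> borel_measurable sourceM"
      using assms(2) by measurable
    then show "(\<lambda>y. X y * (if nu (popul y) m = enat k then 1 else 0)) \<in> borel_measurable (Q \<omega>)"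
      by (simp add: measurable_cong_sets[OF sets_Q refl])
  qed
  finally show ?thesis .
qed

lemma renewal_equation:
  assumes "AE y in Q \<omega>. nu (popul y) m \<noteq> \<infinity>" "F \<in> borel_measurable opathM"
  shows "future_mean F (m + n) \<omega> = (\<Sum>k. return_prob m k \<omega> * future_mean F n (env_shift (int k) \<omega>))"
  using nn_integral_nu_cases[OF assms(1) measurable_compose[OF shifted_popul_measurable assms(2)], of "m + n"]
    renewal_at[where G = "\<lambda>_. 1" and m = m and n = n and \<omega> = \<omega>, OF _ _ assms(2)]
  by (simp add: future_mean_def[of F "m + n"] return_prob_def)

lemma sum_return_prob:
  assumes "AE y in Q \<omega>. nu (popul y) m \<noteq> \<infinity>"
  shows "(\<Sum>k. return_prob m k \<omega>) = 1"
  using nn_integral_nu_cases[OF assms, of "\<lambda>_. 1"] Q.emeasure_space_1[of \<omega>] by (simp add: return_prob_def)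

text \<open>Keeps one way of decomposing the time \<open>a + b\<close>; for the lower bound by
  powers of \<delta> this suffices.\<close>

lemma return_prob_add_ge: "return_prob N a \<omega> * return_prob M b (env_shift (int a) \<omega>) \<le> return_prob (N + M) (a + b) \<omega>"
proof -
  let ?G = "\<lambda>y. if nu (popul y) N = enat a then 1 else 0 :: ennreal"
  let ?H = "\<lambda>y. if nu (popul y) M = enat b then 1 else 0 :: ennreal"
  have "return_prob N a \<omega> * return_prob M b (env_shift (int a) \<omega>) = (\<integral>\<^sup>+y. ?G y * ?H (y \<circ> shift_source a) \<partial>Q \<omega>)"
    unfolding return_prob_def by (rule nn_integral_indep[symmetric]) (auto simp: nu_past)
  also have "\<dots> \<le> (\<integral>\<^sup>+y. (if nu (popul y) (N + M) = enat (a + b) then 1 else 0) \<partial>Q \<omega>)"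
  proof (rule nn_integral_mono)
    fix y
    show "?G y * ?H (y \<circ> shift_source a) \<le> (if nu (popul y) (N + M) = enat (a + b) then 1 else 0)"
    proof (cases "nu (popul y) N = enat a")
      case True
      then have "popul y a = 0" by (rule nu_eq_0_state) simp
      then have "(\<lambda>i. popul y (a + i)) = popul (y \<circ> shift_source a)" by (simp add: popul_shift)
      then show ?thesis using nu_shift[OF True, of M] by auto
    qed simp
  qed
  finally show ?thesis unfolding return_prob_def .
qed

text \<open>The renewal equation for the indicator \<open>?F\<close> of a missing return: the next
  return can fail only if a first return fails in some shifted environment. Hence all shifts appear
  in the assumption.\<close>

lemma recurrent_all:
  assumes "\<And>k. AE y in Q (env_shift k \<omega>). nu (popul y) 1 \<noteq> \<infinity>"
  shows "AE y in Q \<omega>. nu (popul y) m \<noteq> \<infinity>"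
proof (induction m)
  case (Suc m)
  let ?F = "\<lambda>x :: nat \<Rightarrow> (nat ^ 'd) option. if x 0 = None then 1 else 0 :: ennreal"
  have F: "?F \<in> borel_measurable opathM"
    by (rule measurable_compose[OF measurable_component_singleton[of 0]]) auto
  have s: "(shifted_path z n 0 = None) = (nu z n = \<infinity>)" for z :: "nat \<Rightarrow> nat ^ 'd" and n
    by (auto simp: shifted_path_def split: enat.splits)
  have m: "{y :: 'd source \<Rightarrow> nat ^ 'd. nu (popul y) n = \<infinity>} \<in> sets sourceM" for n
    using measurable_sets[OF nu_popul_measurable, of "{\<infinity>}" n] by (simp add: vimage_def)
  have e: "future_mean ?F n \<omega>' = emeasure (Q \<omega>') {y. nu (popul y) n = \<infinity>}" for n \<omega>'
  proof -
    have "future_mean ?F n \<omega>' = (\<integral>\<^sup>+y. indicator {y. nu (popul y) n = \<infinity>} y \<partial>Q \<omega>')"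
      unfolding future_mean_def by (intro nn_integral_cong) (auto simp: s)
    then show ?thesis using nn_integral_indicator[of "{y. nu (popul y) n = \<infinity>}" "Q \<omega>'"] m by simp
  qed
  have iff: "(AE y in Q \<omega>'. nu (popul y) n \<noteq> \<infinity>) \<longleftrightarrow> future_mean ?F n \<omega>' = 0" for n \<omega>'
    unfolding e using m[of n] by (subst AE_iff_measurable[of "{y. nu (popul y) n = \<infinity>}"]) auto
  have "future_mean ?F (Suc m) \<omega> = (\<Sum>k. return_prob m k \<omega> * future_mean ?F 1 (env_shift (int k) \<omega>))"
    using renewal_equation[OF Suc F, of 1] by simp
  moreover have "future_mean ?F 1 (env_shift (int k) \<omega>) = 0" for k
    using assms[of "int k"] iff by blast
  ultimately show ?case using iff by simp
qed simp

end

text \<open>The input of the mixing argument. The moment conditions reach it only through finiteness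
  of the first return, which is proved separately further below.\<close>

locale recurrent_env = branching_env S P q p
  for S :: "'s measure"
    and P :: "(int \<Rightarrow> 's) measure"
    and q :: "'s \<Rightarrow> (nat ^ 'd::finite) pmf"
    and p :: "'d \<Rightarrow> 's \<Rightarrow> (nat ^ 'd) pmf" +
  fixes \<delta> :: real
  assumes \<delta>_pos: "0 < \<delta>"
    and return_prob_lower: "AE \<omega> in P. ennreal \<delta> \<le> return_prob 1 1 \<omega>"
    and recurrent: "AE \<omega> in P. AE y in Q \<omega>. nu (popul y) 1 \<noteq> \<infinity>"
    and mixing: "mix_rate \<longlonglongrightarrow> 0"
begin

lemma recurrent_AE: "AE \<omega> in P. \<forall>m. AE y in Q \<omega>. nu (popul y) m \<noteq> \<infinity>"
  using AE_env_shift[OF recurrent] by eventually_elim (blast intro: recurrent_all)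

lemma \<delta>_le_1: "\<delta> \<le> 1"
proof -
  have "AE \<omega> in P. \<delta> \<le> 1"
    using return_prob_lower
  proof eventually_elim
    fix \<omega> assume "ennreal \<delta> \<le> return_prob 1 1 \<omega>"
    also have "\<dots> \<le> 1" by (rule return_prob_le_1)
    finally show "\<delta> \<le> 1" by (simp add: ennreal_le_1)
  qed
  then show ?thesis using P.AE_const by simp
qed

text \<open>\<open>N\<close> immediate returns in a row put the \<open>N\<close>-th return at time
  \<open>N\<close>; stationarity extends the one-step bound to all shifted environments at
  once.\<close>

lemma return_prob_diag: "AE \<omega> in P. \<forall>N. ennreal (\<delta> ^ N) \<le> return_prob N N \<omega>"
  using AE_env_shift[OF return_prob_lower]
proof eventually_elim
  fix \<omega> assume \<omega>: "\<forall>k. ennreal \<delta> \<le> return_prob 1 1 (env_shift k \<omega>)"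
  show "\<forall>N. ennreal (\<delta> ^ N) \<le> return_prob N N \<omega>"
  proof
    fix N show "ennreal (\<delta> ^ N) \<le> return_prob N N \<omega>"
    proof (induction N)
      case 0
      show ?case using Q.emeasure_space_1[of \<omega>] by (simp add: return_prob_def zero_enat_def)
    next
      case (Suc N)
      have "ennreal (\<delta> ^ Suc N) = ennreal (\<delta> ^ N) * ennreal \<delta>"
        using \<delta>_pos by (simp add: ennreal_mult mult.commute)
      also have "\<dots> \<le> return_prob N N \<omega> * return_prob 1 1 (env_shift (int N) \<omega>)"
        using Suc \<omega> by (intro mult_mono) auto
      also have "\<dots> \<le> return_prob (N + 1) (N + 1) \<omega>" by (rule return_prob_add_ge)
      finally show ?case by simp
    qed
  qed
qed

text \<open>The conditional expectation of \<open>h\<close> given the past of the environment lies in \<open>[a, b]\<close>,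
  stated by testing against past-measurable weights. \<open>ennreal\<close> maps negative bounds to \<open>0\<close>.\<close>

definition osc :: "((int \<Rightarrow> 's) \<Rightarrow> ennreal) \<Rightarrow> real \<Rightarrow> real \<Rightarrow> bool" where
  "osc h a b \<longleftrightarrow> (\<forall>g\<in>borel_measurable P. (\<forall>\<omega>. g \<omega> \<le> 1) \<longrightarrow> env_dep {..<0} g \<longrightarrow>
     ennreal a * (\<integral>\<^sup>+\<omega>. g \<omega> \<partial>P) \<le> (\<integral>\<^sup>+\<omega>. g \<omega> * h \<omega> \<partial>P) \<and>
     (\<integral>\<^sup>+\<omega>. g \<omega> * h \<omega> \<partial>P) \<le> ennreal b * (\<integral>\<^sup>+\<omega>. g \<omega> \<partial>P))"

text \<open>Stationarity moves the present from 0 to \<open>k\<close>, in the weight and in the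
  functional together.\<close>

lemma osc_shift:
  assumes h: "h \<in> borel_measurable P" "osc h a b"
    and g: "g \<in> borel_measurable P" "\<And>\<omega>. g \<omega> \<le> 1" "env_dep {..<k} g"
  shows "ennreal a * (\<integral>\<^sup>+\<omega>. g \<omega> \<partial>P) \<le> (\<integral>\<^sup>+\<omega>. g \<omega> * h (env_shift k \<omega>) \<partial>P)"
    and "(\<integral>\<^sup>+\<omega>. g \<omega> * h (env_shift k \<omega>) \<partial>P) \<le> ennreal b * (\<integral>\<^sup>+\<omega>. g \<omega> \<partial>P)"
proof -
  note h(1)[measurable] g(1)[measurable]
  let ?g = "\<lambda>\<omega>. g (env_shift (- k) \<omega>)"
  have "x \<in> (+) (- k) ` {..<k}" if "x < 0" for x
    using that by (intro image_eqI[of _ _ "x + k"]) auto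
  then have "(+) (- k) ` {..<k} = {..<0}" by auto
  with env_dep_shift[OF g(3), of "- k"] have d: "env_dep {..<0} ?g" by simp
  have e: "(\<integral>\<^sup>+\<omega>. g \<omega> * h (env_shift k \<omega>) \<partial>P) = (\<integral>\<^sup>+\<omega>. ?g \<omega> * h \<omega> \<partial>P)"
    using nn_integral_env_shift[of "\<lambda>\<omega>. g \<omega> * h (env_shift k \<omega>)" "- k"] by simp
  have e1: "(\<integral>\<^sup>+\<omega>. ?g \<omega> \<partial>P) = (\<integral>\<^sup>+\<omega>. g \<omega> \<partial>P)"
    by (rule nn_integral_env_shift) measurable
  have "?g \<in> borel_measurable P" by measurable
  from h(2)[unfolded osc_def, rule_format, OF this g(2) d]
  show "ennreal a * (\<integral>\<^sup>+\<omega>. g \<omega> \<partial>P) \<le> (\<integral>\<^sup>+\<omega>. g \<omega> * h (env_shift k \<omega>) \<partial>P)"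
    "(\<integral>\<^sup>+\<omega>. g \<omega> * h (env_shift k \<omega>) \<partial>P) \<le> ennreal b * (\<integral>\<^sup>+\<omega>. g \<omega> \<partial>P)"
    by (simp_all only: e e1)
qed

text \<open>The law of the return of index \<open>Suc N\<close> is split into mass \<open>D\<close>
  at time \<open>Suc N\<close>, constant in the environment, and a remainder \<open>r\<close>. On
  the first part mixing replaces the functional by its mean \<open>c\<close>, up to the rate. On the
  second, the weight \<open>g * r k\<close> depends on the environment before \<open>k\<close>, so
  the old bounds apply after shifting, with total mass \<open>1 - D\<close>. The new interval is the
  convex combination of the two.\<close>

lemma osc_step:
  assumes F: "F \<in> borel_measurable opathM" "\<And>x. F x \<le> 1"
    and o: "osc (future_mean F n) a b" and ab: "0 \<le> b"
  shows "\<exists>a' b'. 0 \<le> b' \<and> b' - a' = 2 * \<delta> ^ Suc N * mix_rate N + (1 - \<delta> ^ Suc N) * (b - a) \<and>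
    osc (future_mean F (Suc N + n)) a' b'"
proof -
  define D where "D = \<delta> ^ Suc N"
  have D: "0 \<le> D" "D \<le> 1" using \<delta>_pos \<delta>_le_1 by (auto simp: D_def intro!: mult_le_one power_le_one)
  let ?h = "future_mean F n"
  note hm[measurable] = future_mean_measurable[OF F(1)]
  have h1: "?h \<omega> \<le> 1" for \<omega> using F(2) by (rule future_mean_le_1)
  \<comment> \<open>Unconditional mean of the functional, finite because \<open>F\<close> is at most
    1.\<close>
  define c where "c = enn2real (\<integral>\<^sup>+\<omega>. ?h \<omega> \<partial>P)"
  have c: "ennreal c = (\<integral>\<^sup>+\<omega>. ?h \<omega> \<partial>P)" "0 \<le> c"
  proof -
    have "(\<integral>\<^sup>+\<omega>. ?h \<omega> \<partial>P) \<le> (\<integral>\<^sup>+\<omega>. 1 \<partial>P)" by (intro nn_integral_mono h1)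
    then have "(\<integral>\<^sup>+\<omega>. ?h \<omega> \<partial>P) < \<top>" using P.emeasure_space_1 by (simp add: le_less_trans)
    then show "ennreal c = (\<integral>\<^sup>+\<omega>. ?h \<omega> \<partial>P)" "0 \<le> c" by (auto simp: c_def)
  qed
  \<comment> \<open>Truncated subtraction keeps \<open>r\<close> measurable, bounded and
    past-dependent everywhere; that nothing is truncated is known only almost surely, from
    \<open>return_prob_diag\<close>.\<close>
  define r where "r k \<omega> = return_prob (Suc N) k \<omega> - (if k = Suc N then ennreal D else 0)" for k \<omega>
  have rm[measurable]: "r k \<in> borel_measurable P" for k unfolding r_def by measurable
  have r1: "r k \<omega> \<le> 1" for k \<omega>
    unfolding r_def using return_prob_le_1[of "Suc N" k \<omega>] by (meson diff_le_self_ennreal order_trans)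
  have rd: "env_dep {..<int k} (r k)" for k
    unfolding r_def by (rule env_dep_comb[where h = "\<lambda>a b. a - (if k = Suc N then ennreal D else 0)", OF return_prob_dep return_prob_dep])
  have AEr: "AE \<omega> in P. (\<forall>k. return_prob (Suc N) k \<omega> = (if k = Suc N then ennreal D else 0) + r k \<omega>) \<and>
      (\<Sum>k. r k \<omega>) = ennreal (1 - D) \<and>
      future_mean F (Suc N + n) \<omega> = (\<Sum>k. return_prob (Suc N) k \<omega> * ?h (env_shift (int k) \<omega>))"
    using return_prob_diag recurrent_AE
  proof eventually_elim
    fix \<omega> assume *: "\<forall>N. ennreal (\<delta> ^ N) \<le> return_prob N N \<omega>" "\<forall>m. AE y in Q \<omega>. nu (popul y) m \<noteq> \<infinity>"
    have 1: "return_prob (Suc N) k \<omega> = (if k = Suc N then ennreal D else 0) + r k \<omega>" for k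
    proof (cases "k = Suc N")
      case True
      have "ennreal D \<le> return_prob (Suc N) (Suc N) \<omega>" using *(1) unfolding D_def by blast
      then show ?thesis using True by (simp add: r_def add_diff_inverse_ennreal)
    qed (simp add: r_def)
    have "1 = (\<Sum>k. return_prob (Suc N) k \<omega>)" using sum_return_prob *(2) by simp
    also have "\<dots> = (\<Sum>k. (if k = Suc N then ennreal D else 0) + r k \<omega>)" using 1 by simp
    also have "\<dots> = (\<Sum>k. (if k = Suc N then ennreal D else 0)) + (\<Sum>k. r k \<omega>)"
      by (rule suminf_add[symmetric]) auto
    also have "(\<Sum>k. (if k = Suc N then ennreal D else 0)) = ennreal D"
      by (subst suminf_finite[of "{Suc N}"]) auto
    finally have "ennreal D + (\<Sum>k. r k \<omega>) = 1" by simp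
    from arg_cong[OF this, of "\<lambda>x. x - ennreal D"] have "(\<Sum>k. r k \<omega>) = 1 - ennreal D"
      by simp
    then have 2: "(\<Sum>k. r k \<omega>) = ennreal (1 - D)" using D by (simp add: ennreal_minus flip: ennreal_1)
    show "(\<forall>k. return_prob (Suc N) k \<omega> = (if k = Suc N then ennreal D else 0) + r k \<omega>) \<and>
      (\<Sum>k. r k \<omega>) = ennreal (1 - D) \<and>
      future_mean F (Suc N + n) \<omega> = (\<Sum>k. return_prob (Suc N) k \<omega> * ?h (env_shift (int k) \<omega>))"
      using 1 2 renewal_equation[OF *(2)[rule_format] F(1)] by blast
  qed
  have "osc (future_mean F (Suc N + n)) (D * (c - mix_rate N) + (1 - D) * a) (D * (c + mix_rate N) + (1 - D) * b)"
    unfolding osc_def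
  proof (intro ballI impI)
    fix g :: "(int \<Rightarrow> 's) \<Rightarrow> ennreal"
    assume g[measurable]: "g \<in> borel_measurable P" and g1: "\<forall>\<omega>. g \<omega> \<le> 1" and gd: "env_dep {..<0} g"
    let ?G = "\<integral>\<^sup>+\<omega>. g \<omega> \<partial>P"
    have "?G \<le> (\<integral>\<^sup>+\<omega>. 1 \<partial>P)" using g1 by (intro nn_integral_mono) auto
    then have Gfin: "?G < \<top>" using P.emeasure_space_1 by (simp add: le_less_trans)
    let ?X = "\<integral>\<^sup>+\<omega>. g \<omega> * ?h (env_shift (int (Suc N)) \<omega>) \<partial>P"
    let ?Y = "\<lambda>k. \<integral>\<^sup>+\<omega>. (g \<omega> * r k \<omega>) * ?h (env_shift (int k) \<omega>) \<partial>P"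
    have "(\<integral>\<^sup>+\<omega>. g \<omega> * future_mean F (Suc N + n) \<omega> \<partial>P) =
      (\<integral>\<^sup>+\<omega>. (ennreal D * (g \<omega> * ?h (env_shift (int (Suc N)) \<omega>)) + (\<Sum>k. (g \<omega> * r k \<omega>) * ?h (env_shift (int k) \<omega>))) \<partial>P)"
      using AEr
    proof (intro nn_integral_cong_AE, eventually_elim)
      fix \<omega> assume *: "(\<forall>k. return_prob (Suc N) k \<omega> = (if k = Suc N then ennreal D else 0) + r k \<omega>) \<and>
        (\<Sum>k. r k \<omega>) = ennreal (1 - D) \<and>
        future_mean F (Suc N + n) \<omega> = (\<Sum>k. return_prob (Suc N) k \<omega> * ?h (env_shift (int k) \<omega>))"
      let ?t = "\<lambda>k. ?h (env_shift (int k) \<omega>)"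
      have "g \<omega> * future_mean F (Suc N + n) \<omega> = (\<Sum>k. g \<omega> * (return_prob (Suc N) k \<omega> * ?t k))"
        using * by simp
      also have "\<dots> = (\<Sum>k. g \<omega> * ((if k = Suc N then ennreal D else 0) * ?t k) + g \<omega> * r k \<omega> * ?t k)"
        using * by (simp add: distrib_right distrib_left mult.assoc)
      also have "\<dots> = (\<Sum>k. g \<omega> * ((if k = Suc N then ennreal D else 0) * ?t k)) + (\<Sum>k. g \<omega> * r k \<omega> * ?t k)"
        by (rule suminf_add[symmetric]) auto
      also have "(\<Sum>k. g \<omega> * ((if k = Suc N then ennreal D else 0) * ?t k)) = ennreal D * (g \<omega> * ?t (Suc N))"
        by (subst suminf_finite[of "{Suc N}"]) (auto simp: mult_ac)
      finally show "g \<omega> * future_mean F (Suc N + n) \<omega> =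
        ennreal D * (g \<omega> * ?t (Suc N)) + (\<Sum>k. g \<omega> * r k \<omega> * ?t k)" .
    qed
    also have "\<dots> = (\<integral>\<^sup>+\<omega>. ennreal D * (g \<omega> * ?h (env_shift (int (Suc N)) \<omega>)) \<partial>P) +
        (\<integral>\<^sup>+\<omega>. (\<Sum>k. (g \<omega> * r k \<omega>) * ?h (env_shift (int k) \<omega>)) \<partial>P)"
      by (rule nn_integral_add) measurable
    also have "(\<integral>\<^sup>+\<omega>. ennreal D * (g \<omega> * ?h (env_shift (int (Suc N)) \<omega>)) \<partial>P) = ennreal D * ?X"
      by (rule nn_integral_cmult) measurable
    also have "(\<integral>\<^sup>+\<omega>. (\<Sum>k. (g \<omega> * r k \<omega>) * ?h (env_shift (int k) \<omega>)) \<partial>P) = (\<Sum>k. ?Y k)"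
      by (rule nn_integral_suminf) measurable
    finally have eq: "(\<integral>\<^sup>+\<omega>. g \<omega> * future_mean F (Suc N + n) \<omega> \<partial>P) = ennreal D * ?X + (\<Sum>k. ?Y k)" .
    have gr: "(\<Sum>k. \<integral>\<^sup>+\<omega>. g \<omega> * r k \<omega> \<partial>P) = ennreal (1 - D) * ?G"
    proof -
      have "(\<Sum>k. \<integral>\<^sup>+\<omega>. g \<omega> * r k \<omega> \<partial>P) = (\<integral>\<^sup>+\<omega>. (\<Sum>k. g \<omega> * r k \<omega>) \<partial>P)"
        by (rule nn_integral_suminf[symmetric]) measurable
      also have "\<dots> = (\<integral>\<^sup>+\<omega>. ennreal (1 - D) * g \<omega> \<partial>P)"
        using AEr by (intro nn_integral_cong_AE) (auto simp: mult.commute)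
      also have "\<dots> = ennreal (1 - D) * ?G" by (rule nn_integral_cmult) measurable
      finally show ?thesis .
    qed
    have Y: "ennreal a * (\<integral>\<^sup>+\<omega>. g \<omega> * r k \<omega> \<partial>P) \<le> ?Y k" "?Y k \<le> ennreal b * (\<integral>\<^sup>+\<omega>. g \<omega> * r k \<omega> \<partial>P)" for k
    proof -
      have 1: "g \<omega> * r k \<omega> \<le> 1" for \<omega> using g1 r1[of k \<omega>] mult_mono[of "g \<omega>" 1 "r k \<omega>" 1] by auto
      have 2: "env_dep {..<int k} (\<lambda>\<omega>. g \<omega> * r k \<omega>)"
        by (rule env_dep_comb[OF env_dep_mono[OF gd] rd]) auto
      show "ennreal a * (\<integral>\<^sup>+\<omega>. g \<omega> * r k \<omega> \<partial>P) \<le> ?Y k" "?Y k \<le> ennreal b * (\<integral>\<^sup>+\<omega>. g \<omega> * r k \<omega> \<partial>P)"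
        using osc_shift[OF hm o _ 1 2] by measurable
    qed
    have Ysum: "ennreal ((1 - D) * a) * ?G \<le> (\<Sum>k. ?Y k)" "(\<Sum>k. ?Y k) \<le> ennreal ((1 - D) * b) * ?G"
    proof -
      have "ennreal ((1 - D) * a) * ?G = ennreal a * (ennreal (1 - D) * ?G)"
        using D by (subst ennreal_mult') (simp_all only: mult_ac diff_ge_0_iff_ge)
      also have "\<dots> = (\<Sum>k. ennreal a * (\<integral>\<^sup>+\<omega>. g \<omega> * r k \<omega> \<partial>P))" by (simp add: gr)
      also have "\<dots> \<le> (\<Sum>k. ?Y k)" by (intro suminf_le Y) auto
      finally show "ennreal ((1 - D) * a) * ?G \<le> (\<Sum>k. ?Y k)" .
      have "(\<Sum>k. ?Y k) \<le> (\<Sum>k. ennreal b * (\<integral>\<^sup>+\<omega>. g \<omega> * r k \<omega> \<partial>P))" by (intro suminf_le Y) auto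
      also have "\<dots> = ennreal b * (ennreal (1 - D) * ?G)" by (simp add: gr)
      also have "\<dots> = ennreal ((1 - D) * b) * ?G"
        using D by (subst ennreal_mult') (simp_all only: mult_ac diff_ge_0_iff_ge)
      finally show "(\<Sum>k. ?Y k) \<le> ennreal ((1 - D) * b) * ?G" .
    qed
    \<comment> \<open>The functional reads indices from -1 on; shifted by \<open>Suc N\<close> it
      starts at \<open>N\<close>, which is the available gap.\<close>
    have hd: "env_dep {int N..} (\<lambda>\<omega>. ?h (env_shift (int (Suc N)) \<omega>))"
      by (rule env_dep_mono[OF env_dep_shift[OF future_mean_dep]]) auto
    have hE: "(\<integral>\<^sup>+\<omega>. ?h (env_shift (int (Suc N)) \<omega>) \<partial>P) = ennreal c"
      unfolding c(1) by (rule nn_integral_env_shift) measurable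
    note mx = mixing_fun[OF g gd g1[rule_format] _ hd h1, unfolded hE]
    have X: "?X \<le> ennreal (c + mix_rate N) * ?G"
      using mx(1) c(2) mix_rate_nonneg[of N] by simp
    \<comment> \<open>If the rate exceeds \<open>c\<close>, the left side is truncated to 0.
      Otherwise the common term is finite and can be cancelled.\<close>
    have X': "ennreal (c - mix_rate N) * ?G \<le> ?X"
    proof -
      have "ennreal c \<ge> ennreal (mix_rate N) + ennreal (c - mix_rate N)" if "mix_rate N \<le> c"
        using that mix_rate_nonneg[of N] by (simp flip: ennreal_plus)
      then have "ennreal (mix_rate N) * ?G + ennreal (c - mix_rate N) * ?G \<le> ennreal c * ?G" if "mix_rate N \<le> c"
        using that mult_right_mono by (fastforce simp flip: distrib_right)
      also have "ennreal c * ?G \<le> ennreal (mix_rate N) * ?G + ?X"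
        using mx(2) by (simp add: add.commute)
      finally have "ennreal (c - mix_rate N) * ?G \<le> ?X" if "mix_rate N \<le> c"
        using that Gfin by (auto simp: ennreal_add_left_cancel_le ennreal_mult_eq_top_iff)
      then show ?thesis by (cases "mix_rate N \<le> c") (auto simp: ennreal_neg)
    qed
    show "ennreal (D * (c - mix_rate N) + (1 - D) * a) * ?G \<le> (\<integral>\<^sup>+\<omega>. g \<omega> * future_mean F (Suc N + n) \<omega> \<partial>P) \<and>
        (\<integral>\<^sup>+\<omega>. g \<omega> * future_mean F (Suc N + n) \<omega> \<partial>P) \<le> ennreal (D * (c + mix_rate N) + (1 - D) * b) * ?G"
    proof
      have "ennreal (D * (c - mix_rate N) + (1 - D) * a) * ?G \<le>
          (ennreal (D * (c - mix_rate N)) + ennreal ((1 - D) * a)) * ?G"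
        by (intro mult_right_mono ennreal_add_le) auto
      also have "\<dots> = ennreal D * (ennreal (c - mix_rate N) * ?G) + ennreal ((1 - D) * a) * ?G"
        using D by (simp add: ennreal_mult' distrib_right mult.assoc)
      also have "\<dots> \<le> ennreal D * ?X + (\<Sum>k. ?Y k)"
        by (intro add_mono mult_left_mono X' Ysum) auto
      finally show "ennreal (D * (c - mix_rate N) + (1 - D) * a) * ?G \<le> (\<integral>\<^sup>+\<omega>. g \<omega> * future_mean F (Suc N + n) \<omega> \<partial>P)"
        unfolding eq .
      have "ennreal D * ?X + (\<Sum>k. ?Y k) \<le> ennreal D * (ennreal (c + mix_rate N) * ?G) + ennreal ((1 - D) * b) * ?G"
        by (intro add_mono mult_left_mono X Ysum) auto
      also have "\<dots> = ennreal (D * (c + mix_rate N) + (1 - D) * b) * ?G"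
        using D c(2) mix_rate_nonneg[of N] ab by (simp add: ennreal_mult distrib_right mult.assoc)
      finally show "(\<integral>\<^sup>+\<omega>. g \<omega> * future_mean F (Suc N + n) \<omega> \<partial>P) \<le> ennreal (D * (c + mix_rate N) + (1 - D) * b) * ?G"
        unfolding eq .
    qed
  qed
  moreover have "0 \<le> D * (c + mix_rate N) + (1 - D) * b"
    using D c(2) mix_rate_nonneg[of N] ab by (intro add_nonneg_nonneg mult_nonneg_nonneg) auto
  moreover have "(D * (c + mix_rate N) + (1 - D) * b) - (D * (c - mix_rate N) + (1 - D) * a) = 2 * D * mix_rate N + (1 - D) * (b - a)"
    by (simp add: algebra_simps)
  ultimately show ?thesis unfolding D_def by blast
qed

text \<open>The recursion for the length, \<open>l' = 2 D f + (1 - D) l\<close> with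
  \<open>f\<close> the mixing rate, has the fixed point \<open>2 f\<close>, and the distance to it
  contracts by \<open>1 - D\<close>. The start is [0,1], as \<open>F\<close> takes values there;
  \<open>r\<close> absorbs the remainder of \<open>n\<close> modulo \<open>Suc N\<close>.\<close>

lemma osc_geometric:
  assumes F: "F \<in> borel_measurable opathM" "\<And>x. F x \<le> 1"
  shows "\<exists>a b. 0 \<le> b \<and> b - a \<le> (1 - \<delta> ^ Suc N) ^ j + 2 * mix_rate N \<and> osc (future_mean F (j * Suc N + r)) a b"
proof (induction j)
  case 0
  have "osc (future_mean F r) 0 1"
    unfolding osc_def
  proof (intro ballI impI conjI)
    fix g :: "_ \<Rightarrow> ennreal"
    have "g \<omega> * future_mean F r \<omega> \<le> g \<omega>" for \<omega>
      using mult_left_mono[OF future_mean_le_1[OF F(2)], where c = "g \<omega>"] by simp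
    then show "(\<integral>\<^sup>+\<omega>. g \<omega> * future_mean F r \<omega> \<partial>P) \<le> ennreal 1 * (\<integral>\<^sup>+\<omega>. g \<omega> \<partial>P)"
      by (simp add: nn_integral_mono)
  qed simp
  then show ?case using mix_rate_nonneg[of N] by (rule_tac exI[of _ "0 :: real"], rule_tac exI[of _ "1 :: real"]) simp
next
  case (Suc j)
  then obtain a b where ab: "0 \<le> b" "b - a \<le> (1 - \<delta> ^ Suc N) ^ j + 2 * mix_rate N" "osc (future_mean F (j * Suc N + r)) a b"
    by blast
  from osc_step[OF F ab(3,1), of N] obtain a' b' where ab': "0 \<le> b'"
    "b' - a' = 2 * \<delta> ^ Suc N * mix_rate N + (1 - \<delta> ^ Suc N) * (b - a)" "osc (future_mean F (Suc N + (j * Suc N + r))) a' b'"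
    by blast
  have "\<delta> ^ Suc N \<le> 1" using \<delta>_pos \<delta>_le_1 by (intro power_le_one) auto
  then have "(1 - \<delta> ^ Suc N) * (b - a) \<le> (1 - \<delta> ^ Suc N) * ((1 - \<delta> ^ Suc N) ^ j + 2 * mix_rate N)"
    using ab(2) by (intro mult_left_mono) auto
  then have "b' - a' \<le> (1 - \<delta> ^ Suc N) ^ Suc j + 2 * mix_rate N"
    unfolding ab'(2) by (simp add: algebra_simps)
  moreover have "Suc N + (j * Suc N + r) = Suc j * Suc N + r" by simp
  ultimately show ?case using ab'(1,3) by metis
qed

text \<open>\<open>N\<close> is chosen from the mixing rate, then the number \<open>j\<close> of
  iterations with \<open>N\<close> fixed. Neither depends on \<open>F\<close>, whence the
  uniformity.\<close>

lemma osc_tendsto_0: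
  assumes "0 < \<eta>"
  shows "\<exists>n0. \<forall>n\<ge>n0. \<forall>F\<in>borel_measurable opathM. (\<forall>x. F x \<le> 1) \<longrightarrow>
    (\<exists>a b. 0 \<le> b \<and> b - a \<le> \<eta> \<and> osc (future_mean F n) a b)"
proof -
  have "eventually (\<lambda>N. mix_rate N < \<eta> / 4) sequentially"
    using order_tendstoD(2)[OF mixing, of "\<eta> / 4"] assms by simp
  then obtain N where N: "mix_rate N < \<eta> / 4" by (auto simp: eventually_sequentially)
  let ?c = "1 - \<delta> ^ Suc N"
  have "0 < \<delta> ^ Suc N" "\<delta> ^ Suc N \<le> 1" using \<delta>_pos \<delta>_le_1 by (auto intro!: power_le_one simp del: power_Suc)
  then have c: "0 \<le> ?c" "?c < 1" by auto
  then have "(\<lambda>j. ?c ^ j) \<longlonglongrightarrow> 0" by (intro LIMSEQ_power_zero) auto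
  then have "eventually (\<lambda>j. ?c ^ j < \<eta> / 2) sequentially"
    using assms by (intro order_tendstoD(2)) auto
  then obtain j0 where j0: "\<And>j. j \<ge> j0 \<Longrightarrow> ?c ^ j < \<eta> / 2" by (auto simp: eventually_sequentially)
  show ?thesis
  proof (intro exI[of _ "j0 * Suc N"] allI impI ballI)
    fix n and F :: "(nat \<Rightarrow> (nat ^ 'd) option) \<Rightarrow> ennreal" assume n: "j0 * Suc N \<le> n" and F: "F \<in> borel_measurable opathM" "\<forall>x. F x \<le> 1"
    have "j0 \<le> n div Suc N" using n by (simp add: less_eq_div_iff_mult_less_eq)
    with j0 have "?c ^ (n div Suc N) < \<eta> / 2" by blast
    moreover obtain a b where ab: "0 \<le> b" "b - a \<le> ?c ^ (n div Suc N) + 2 * mix_rate N"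
        "osc (future_mean F ((n div Suc N) * Suc N + n mod Suc N)) a b"
      using osc_geometric[OF F(1) F(2)[rule_format]] by blast
    moreover have "osc (future_mean F n) a b" using ab(3) unfolding div_mult_mod_eq .
    ultimately have "0 \<le> b \<and> b - a \<le> \<eta> \<and> osc (future_mean F n) a b"
      using N ab(1,2) by (intro conjI) linarith+
    then show "\<exists>a b. 0 \<le> b \<and> b - a \<le> \<eta> \<and> osc (future_mean F n) a b" by blast
  qed
qed

end

section \<open>Mixing of the excursions\<close>

lemma tendsto_SUP_0:
  fixes f :: "nat \<Rightarrow> nat \<Rightarrow> real"
  assumes f: "\<And>n m. 0 \<le> f n m" "\<And>n m. f n m \<le> c"
    and small: "\<And>\<eta>. 0 < \<eta> \<Longrightarrow> \<exists>n0. \<forall>n\<ge>n0. \<forall>m\<ge>1. f n m \<le> \<eta>"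
  shows "(\<lambda>n. SUP m\<in>{1..}. f n m) \<longlonglongrightarrow> 0"
proof (rule LIMSEQ_I)
  fix \<eta> :: real assume "0 < \<eta>"
  with small[of "\<eta> / 2"] obtain n0 where n0: "\<And>n m. n \<ge> n0 \<Longrightarrow> m \<ge> 1 \<Longrightarrow> f n m \<le> \<eta> / 2" by auto
  show "\<exists>no. \<forall>n\<ge>no. norm ((SUP m\<in>{1..}. f n m) - 0) < \<eta>"
  proof (intro exI[of _ n0] allI impI)
    fix n assume "n0 \<le> n"
    then have "(SUP m\<in>{1..}. f n m) \<le> \<eta> / 2" using n0 by (intro cSUP_least) auto
    moreover have "0 \<le> (SUP m\<in>{1..}. f n m)"
      by (rule cSUP_upper2[where x = 1]) (use f in \<open>auto intro!: bdd_aboveI2[of _ _ c]\<close>)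
    ultimately show "norm ((SUP m\<in>{1..}. f n m) - 0) < \<eta>" using \<open>0 < \<eta>\<close> by simp
  qed
qed

text \<open>If the return is at time \<open>n\<close>, the missing state at \<open>n\<close> is 0,
  so continuing the strict past by 0 reproduces the path up to and including
  \<open>n\<close>.\<close>

definition path_cut :: "nat \<Rightarrow> (nat \<Rightarrow> nat ^ 'd::finite) \<Rightarrow> nat \<Rightarrow> nat ^ 'd" where
  "path_cut n z = (\<lambda>i. if i < n then z i else 0)"

lemma path_cut_measurable: "path_cut n \<in> PiM {..<n} (\<lambda>_. count_space UNIV) \<rightarrow>\<^sub>M pathM"
proof (rule measurable_PiM_single')
  show "(\<lambda>z. path_cut n z i) \<in> PiM {..<n} (\<lambda>_. count_space UNIV) \<rightarrow>\<^sub>M count_space UNIV" for i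
    by (cases "i < n") (auto simp: path_cut_def intro!: measurable_component_singleton)
qed auto

text \<open>The value at \<open>None\<close> is that of \<open>excursion_infinity\<close>, so that
  excursions are functionals of the shifted path on every path, not just almost surely.\<close>

definition opath_excursion :: "nat \<Rightarrow> (nat \<Rightarrow> (nat ^ 'd::finite) option) \<Rightarrow> enat \<times> (nat ^ 'd) list" where
  "opath_excursion j x = (if x 0 = None then (\<infinity>, []) else excursion (\<lambda>i. the (x i)) j)"

lemma opath_excursion_shifted_path:
  "0 < j \<Longrightarrow> opath_excursion j (shifted_path z K) = excursion z (K + j)"
  by (cases "nu z K") (auto simp: opath_excursion_def shifted_path_def excursion_infinity excursion_shift)

lemma opath_excursion_measurable:
  "opath_excursion j \<in> PiM UNIV (\<lambda>_. count_space UNIV) \<rightarrow>\<^sub>M count_space UNIV"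
proof -
  let ?O = "PiM UNIV (\<lambda>_. count_space UNIV) :: (nat \<Rightarrow> (nat ^ 'a) option) measure"
  have "(\<lambda>x i. the (x i)) \<in> ?O \<rightarrow>\<^sub>M pathM"
    by (rule measurable_PiM_single')
      (auto intro!: measurable_compose[OF measurable_component_singleton])
  from measurable_compose[OF this excursion_measurable]
  have "(\<lambda>x. excursion (\<lambda>i. the (x i)) j) \<in> ?O \<rightarrow>\<^sub>M count_space UNIV" .
  moreover have "Measurable.pred ?O (\<lambda>x. x 0 = None)"
    by (rule measurable_compose[OF measurable_component_singleton]) auto
  ultimately show ?thesis
    unfolding opath_excursion_def by (intro measurable_If) (auto simp: pred_def)
qed

context branching_env
begin

sublocale joint_law: prob_space joint_law by (rule prob_annealed)

lemma snd_popul_measurable: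
  "f \<in> sourceM \<rightarrow>\<^sub>M N \<Longrightarrow> (\<lambda>(\<omega>, y). f y) \<in> joint_law \<rightarrow>\<^sub>M N"
  unfolding measurable_cong_sets[OF sets_annealed refl] split_beta
  by (rule measurable_compose[OF measurable_snd])

lemma future_at_nuE:
  assumes "A \<in> future_at_nu joint_law k"
  obtains C where "C \<in> sets opathM" "A = {(\<omega>, y)\<in>space joint_law. shifted_path (popul y) k \<in> C}"
proof -
  have "A \<in> {(\<lambda>(\<omega>, y). shifted_path (popul y) k) -` C \<inter> space joint_law | C. C \<in> sets opathM}"
    using assms unfolding future_at_nu_def
    by (subst (asm) sets_vimage_algebra2) (auto simp: space_PiM)
  then obtain C where "C \<in> sets opathM" "A = (\<lambda>(\<omega>, y). shifted_path (popul y) k) -` C \<inter> space joint_law" by blast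
  then show thesis by (intro that[of C]) auto
qed

lemma future_at_nu_events: "future_at_nu joint_law k \<subseteq> sets joint_law"
proof
  fix A assume "A \<in> future_at_nu joint_law k"
  then obtain C where C: "C \<in> sets opathM" "A = {(\<omega>, y)\<in>space joint_law. shifted_path (popul y) k \<in> C}"
    by (rule future_at_nuE)
  have "A = (\<lambda>(\<omega>, y). shifted_path (popul y) k) -` C \<inter> space joint_law" unfolding C(2) by auto
  then show "A \<in> sets joint_law"
    using measurable_sets[OF snd_popul_measurable[OF shifted_popul_measurable] C(1)] by simp
qed

lemma space_future_at_nu: "space joint_law \<in> future_at_nu joint_law k"
  unfolding future_at_nu_def using sets.top[of "vimage_algebra (space joint_law) _ _"] by simp

lemma past_before_nu_events: "past_before_nu S joint_law k \<subseteq> sets joint_law"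
  unfolding past_before_nu_def by auto

lemma space_past_before_nu: "space joint_law \<in> past_before_nu S joint_law k"
proof -
  have "space joint_law \<in> past_before S joint_law n" for n
    unfolding past_before_def using sets.top[of "vimage_algebra (space joint_law) _ _"] by simp
  then show ?thesis unfolding past_before_nu_def
    by (intro CollectI conjI allI sets.top) blast
qed

lemma past_before_map:
  "(\<lambda>(\<omega>, y). (restrict (popul y) {..<n}, restrict \<omega> {..<int n}))
    \<in> space joint_law \<rightarrow> space (PiM {..<n} (\<lambda>_. count_space UNIV) \<Otimes>\<^sub>M PiM {..<int n} (\<lambda>_. S))"
  by (auto simp: space_annealed in_space_P space_pair_measure space_PiM split: if_splits)

text \<open>Turns membership in the \<sigma>-algebra strictly before the return into pointwise
  dependence: on the event that the return is at \<open>k\<close>, the trace of \<open>B\<close> is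
  a preimage under the restrictions to times below \<open>k\<close>.\<close>

lemma past_before_nu_dep:
  assumes B: "B \<in> past_before_nu S joint_law m"
    and nu: "nu (popul y) m = enat k" "nu (popul y') m = enat k"
    and \<omega>: "\<omega> \<in> space P" "\<omega>' \<in> space P"
    and eq: "\<And>i. i < k \<Longrightarrow> popul y i = popul y' i" "\<And>i. i < int k \<Longrightarrow> \<omega> i = \<omega>' i"
  shows "(\<omega>, y) \<in> B \<longleftrightarrow> (\<omega>', y') \<in> B"
proof -
  let ?f = "\<lambda>(\<omega>, y :: 'd source \<Rightarrow> nat ^ 'd). (restrict (popul y) {..<k}, restrict \<omega> {..<int k})"
  obtain B' where B': "B' \<in> past_before S joint_law k"
    "B \<inter> {(\<omega>, y). nu (popul y) m = enat k} = B' \<inter> {(\<omega>, y). nu (popul y) m = enat k}"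
    using B unfolding past_before_nu_def by blast
  obtain D where D: "B' = ?f -` D \<inter> space joint_law"
    using B'(1) unfolding past_before_def sets_vimage_algebra2[OF past_before_map] by blast
  have "?f (\<omega>, y) = ?f (\<omega>', y')" using eq by (auto simp: restrict_def)
  then have "(\<omega>, y) \<in> B' \<longleftrightarrow> (\<omega>', y') \<in> B'" unfolding D using \<omega> by (auto simp: space_annealed)
  with B'(2) nu show ?thesis by blast
qed

end

context recurrent_env
begin

text \<open>Split by the value \<open>k\<close> of the \<open>m\<close>-th return; the quenched
  probability of \<open>B\<close> on this event is a weight of the environment before
  \<open>k\<close>, so shifted oscillation bounds apply term by term, whatever \<open>m\<close>
  is.\<close>

lemma past_future_bound:
  assumes F: "F \<in> borel_measurable opathM"
    and o: "osc (future_mean F n) a b" and B: "B \<in> past_before_nu S joint_law m"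
  shows "ennreal a * emeasure joint_law B \<le> (\<integral>\<^sup>+(\<omega>, y). indicator B (\<omega>, y) * F (shifted_path (popul y) (m + n)) \<partial>joint_law)"
    and "(\<integral>\<^sup>+(\<omega>, y). indicator B (\<omega>, y) * F (shifted_path (popul y) (m + n)) \<partial>joint_law) \<le> ennreal b * emeasure joint_law B"
proof -
  have Bs: "B \<in> sets joint_law" using B past_before_nu_events by auto
  then have [measurable]: "B \<in> sets (P \<Otimes>\<^sub>M sourceM)" by simp
  note F' [measurable] = measurable_compose[OF shifted_popul_measurable F]
  let ?one = "\<lambda>y k. if nu (popul y) m = enat k then 1 else 0 :: ennreal"
  \<comment> \<open>Quenched probability of \<open>B\<close> together with the \<open>m\<close>-th
    return at \<open>k\<close>; the test weight for the shift \<open>k\<close>.\<close>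
  define G where "G k \<omega> = (\<integral>\<^sup>+y. indicator B (\<omega>, y) * ?one y k \<partial>Q \<omega>)" for k \<omega>
  have Gm[measurable]: "G k \<in> borel_measurable P" for k
    unfolding G_def[abs_def] by (rule nn_integral_Q_measurable) measurable
  have G1: "G k \<omega> \<le> 1" for k \<omega>
    unfolding G_def by (rule nn_integral_Q_le_1) (auto simp: indicator_def)
  have sec: "(\<lambda>y. indicator B (\<omega>, y) :: ennreal) \<in> borel_measurable sourceM" if "\<omega> \<in> space P" for \<omega>
    using that by measurable
  have dep: "indicator B (\<omega>, restrict y (past_sources k)) = (indicator B (\<omega>, y) :: ennreal)"
    if "nu (popul y) m = enat k" "\<omega> \<in> space P" for \<omega> y k
  proof -
    have "nu (popul (restrict y (past_sources k))) m = enat k"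
      using that(1) by (simp only: nu_past)
    moreover have "popul (restrict y (past_sources k)) i = popul y i" if "i < k" for i
      using that by (simp add: past_sources_def popul_restrict)
    ultimately have "(\<omega>, restrict y (past_sources k)) \<in> B \<longleftrightarrow> (\<omega>, y) \<in> B"
      by (intro past_before_nu_dep[OF B _ that(1) that(2,2)]) simp_all
    then show ?thesis by (simp add: indicator_def)
  qed
  have Gd: "env_dep {..<int k} (G k)" for k
  proof (rule env_depI)
    fix \<omega> \<omega>' assume w: "\<omega> \<in> space P" "\<omega>' \<in> space P" "\<And>i. i \<in> {..<int k} \<Longrightarrow> \<omega> i = \<omega>' i"
    have eq: "indicator B (\<omega>', y) * ?one y k = indicator B (\<omega>, y) * ?one y k" for y
      using past_before_nu_dep[OF B, of y k y \<omega> \<omega>'] w by (auto simp: indicator_def)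
    show "G k \<omega> = G k \<omega>'"
      unfolding G_def eq
    proof (rule nn_integral_past_cong)
      show "(\<lambda>y. indicator B (\<omega>, y) * ?one y k) \<in> borel_measurable sourceM"
        using sec[OF w(1)] by measurable
    qed (use w dep in \<open>auto simp: nu_past\<close>)
  qed
  have *: "AE \<omega> in P. (\<integral>\<^sup>+y. indicator B (\<omega>, y) * H (shifted_path (popul y) (m + n)) \<partial>Q \<omega>) =
      (\<Sum>k. G k \<omega> * future_mean H n (env_shift (int k) \<omega>))" if H: "H \<in> borel_measurable opathM" for H
    using recurrent_AE AE_space
  proof eventually_elim
    fix \<omega> assume w: "\<forall>m. AE y in Q \<omega>. nu (popul y) m \<noteq> \<infinity>" "\<omega> \<in> space P"
    note H' = measurable_compose[OF shifted_popul_measurable H]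
    have "(\<integral>\<^sup>+y. indicator B (\<omega>, y) * H (shifted_path (popul y) (m + n)) \<partial>Q \<omega>) =
        (\<Sum>k. \<integral>\<^sup>+y. indicator B (\<omega>, y) * H (shifted_path (popul y) (m + n)) * ?one y k \<partial>Q \<omega>)"
      using w sec H' by (intro nn_integral_nu_cases) measurable
    also have "\<dots> = (\<Sum>k. G k \<omega> * future_mean H n (env_shift (int k) \<omega>))"
      unfolding G_def using w dep sec H by (subst renewal_at) auto
    finally show "(\<integral>\<^sup>+y. indicator B (\<omega>, y) * H (shifted_path (popul y) (m + n)) \<partial>Q \<omega>) =
      (\<Sum>k. G k \<omega> * future_mean H n (env_shift (int k) \<omega>))" .
  qed
  have X: "(\<integral>\<^sup>+(\<omega>, y). indicator B (\<omega>, y) * H (shifted_path (popul y) (m + n)) \<partial>joint_law) =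
      (\<Sum>k. \<integral>\<^sup>+\<omega>. G k \<omega> * future_mean H n (env_shift (int k) \<omega>) \<partial>P)" if H: "H \<in> borel_measurable opathM" for H
  proof -
    note H' [measurable] = measurable_compose[OF shifted_popul_measurable H] future_mean_measurable[OF H]
    have "(\<integral>\<^sup>+(\<omega>, y). indicator B (\<omega>, y) * H (shifted_path (popul y) (m + n)) \<partial>joint_law) =
      (\<integral>\<^sup>+\<omega>. \<integral>\<^sup>+y. indicator B (\<omega>, y) * H (shifted_path (popul y) (m + n)) \<partial>Q \<omega> \<partial>P)"
    proof (subst nn_integral_annealed)
      show "(\<lambda>(\<omega>, y). indicator B (\<omega>, y) * H (shifted_path (popul y) (m + n))) \<in> borel_measurable (P \<Otimes>\<^sub>M sourceM)"
        unfolding split_beta prod.collapse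
        by (intro borel_measurable_times_ennreal measurable_compose[OF measurable_snd H'(1)]) simp
    qed simp
    also have "\<dots> = (\<integral>\<^sup>+\<omega>. (\<Sum>k. G k \<omega> * future_mean H n (env_shift (int k) \<omega>)) \<partial>P)"
      by (rule nn_integral_cong_AE) (rule *[OF H])
    also have "\<dots> = (\<Sum>k. \<integral>\<^sup>+\<omega>. G k \<omega> * future_mean H n (env_shift (int k) \<omega>) \<partial>P)"
      by (rule nn_integral_suminf) measurable
    finally show ?thesis .
  qed
  \<comment> \<open>The identity for general \<open>H\<close> is specialised to the constant 1, so
    that the weights are seen to sum up to the probability of \<open>B\<close>.\<close>
  have "future_mean (\<lambda>_. 1) n \<omega> = 1" for \<omega> using Q.emeasure_space_1[of \<omega>] by (simp add: future_mean_def)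
  then have PB: "emeasure joint_law B = (\<Sum>k. \<integral>\<^sup>+\<omega>. G k \<omega> \<partial>P)"
    using X[of "\<lambda>_. 1"] Bs by simp
  note os = osc_shift[OF future_mean_measurable[OF F] o Gm G1 Gd]
  have "ennreal a * emeasure joint_law B = (\<Sum>k. ennreal a * (\<integral>\<^sup>+\<omega>. G k \<omega> \<partial>P))" unfolding PB by simp
  also have "\<dots> \<le> (\<Sum>k. \<integral>\<^sup>+\<omega>. G k \<omega> * future_mean F n (env_shift (int k) \<omega>) \<partial>P)" by (intro suminf_le os) auto
  finally show "ennreal a * emeasure joint_law B \<le> (\<integral>\<^sup>+(\<omega>, y). indicator B (\<omega>, y) * F (shifted_path (popul y) (m + n)) \<partial>joint_law)"
    unfolding X[OF F] .
  have "(\<Sum>k. \<integral>\<^sup>+\<omega>. G k \<omega> * future_mean F n (env_shift (int k) \<omega>) \<partial>P) \<le> (\<Sum>k. ennreal b * (\<integral>\<^sup>+\<omega>. G k \<omega> \<partial>P))"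
    by (intro suminf_le os) auto
  also have "\<dots> = ennreal b * emeasure joint_law B" unfolding PB by simp
  finally show "(\<integral>\<^sup>+(\<omega>, y). indicator B (\<omega>, y) * F (shifted_path (popul y) (m + n)) \<partial>joint_law) \<le> ennreal b * emeasure joint_law B"
    unfolding X[OF F] .
qed

text \<open>The conditional probability given \<open>B\<close> and the unconditional one, which is
  the case of the full space, lie in one interval of length at most \<eta>. Its choice depends on
  \<open>n\<close> and \<open>A\<close>, but the threshold \<open>n0\<close> does not depend on
  \<open>m\<close>.\<close>

lemma past_future_mixing:
  assumes "0 < \<eta>"
  shows "\<exists>n0. \<forall>n\<ge>n0. \<forall>m. \<forall>A\<in>future_at_nu joint_law (n + m). \<forall>B\<in>past_before_nu S joint_law m.
    joint_law.prob B > 0 \<longrightarrow> \<bar>joint_law.prob (A \<inter> B) / joint_law.prob B - joint_law.prob A\<bar> \<le> \<eta>"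
proof -
  obtain n0 where n0: "\<And>n F. n \<ge> n0 \<Longrightarrow> F \<in> borel_measurable opathM \<Longrightarrow> (\<And>x. F x \<le> 1) \<Longrightarrow>
    \<exists>a b. 0 \<le> b \<and> b - a \<le> \<eta> \<and> osc (future_mean F n) a b"
    using osc_tendsto_0[OF assms] by metis
  show ?thesis
  proof (intro exI[of _ n0] allI ballI impI)
    fix n m A B assume n: "n0 \<le> n" and A: "A \<in> future_at_nu joint_law (n + m)"
      and B: "B \<in> past_before_nu S joint_law m" and pos: "0 < joint_law.prob B"
    obtain C where C: "C \<in> sets opathM" "A = {(\<omega>, y)\<in>space joint_law. shifted_path (popul y) (n + m) \<in> C}"
      using A by (rule future_at_nuE)
    have "(indicator C :: _ \<Rightarrow> ennreal) \<in> borel_measurable opathM" "\<And>x. (indicator C x :: ennreal) \<le> 1"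
      using C(1) by (auto simp: indicator_def)
    with n0[OF n this] obtain a b where ab: "0 \<le> b" "b - a \<le> \<eta>" "osc (future_mean (indicator C) n) a b" by blast
    have e: "(\<integral>\<^sup>+(\<omega>, y). indicator B (\<omega>, y) * indicator C (shifted_path (popul y) (m + n)) \<partial>joint_law) = joint_law.prob (A \<inter> B)"
      if "B \<in> sets joint_law" for B
    proof -
      have "(\<integral>\<^sup>+(\<omega>, y). indicator B (\<omega>, y) * indicator C (shifted_path (popul y) (m + n)) \<partial>joint_law) =
          (\<integral>\<^sup>+x. indicator (A \<inter> B) x \<partial>joint_law)"
        using sets.sets_into_space[OF that]
        by (intro nn_integral_cong) (auto simp: C(2) indicator_def add.commute)
      also have "\<dots> = emeasure joint_law (A \<inter> B)"
        using A future_at_nu_events that by (intro nn_integral_indicator) auto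
      finally show ?thesis by (simp add: joint_law.emeasure_eq_measure)
    qed
    have bd: "a * joint_law.prob B \<le> joint_law.prob (A \<inter> B)" "joint_law.prob (A \<inter> B) \<le> b * joint_law.prob B"
      if "B \<in> past_before_nu S joint_law m" for B
    proof -
      have "B \<in> sets joint_law" using that past_before_nu_events by auto
      from past_future_bound[OF _ ab(3) that] C(1)
      have 1: "ennreal a * ennreal (joint_law.prob B) \<le> ennreal (joint_law.prob (A \<inter> B))"
        and 2: "ennreal (joint_law.prob (A \<inter> B)) \<le> ennreal b * ennreal (joint_law.prob B)"
        unfolding e[OF \<open>B \<in> sets joint_law\<close>] by (simp_all add: joint_law.emeasure_eq_measure)
      from 2 ab(1) show "joint_law.prob (A \<inter> B) \<le> b * joint_law.prob B"
        by (simp add: ennreal_mult[symmetric] ennreal_le_iff)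
      \<comment> \<open>For negative \<open>a\<close> the bound in \<open>ennreal\<close> says
        nothing, but the real inequality is trivial.\<close>
      show "a * joint_law.prob B \<le> joint_law.prob (A \<inter> B)"
      proof (cases "0 \<le> a")
        case True then show ?thesis using 1 by (simp add: ennreal_mult[symmetric])
      next
        case False
        then have "a * joint_law.prob B \<le> 0" by (intro mult_nonpos_nonneg) auto
        then show ?thesis by (rule order_trans) simp
      qed
    qed
    \<comment> \<open>The full space belongs to the past of every return, which bounds the
      unconditional probability.\<close>
    have "A \<inter> space joint_law = A" unfolding C(2) by auto
    with bd[OF space_past_before_nu] have "a \<le> joint_law.prob A" "joint_law.prob A \<le> b"
      by (simp_all add: joint_law.prob_space)
    moreover have "a \<le> joint_law.prob (A \<inter> B) / joint_law.prob B" "joint_law.prob (A \<inter> B) / joint_law.prob B \<le> b"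
      using bd[OF B] pos by (simp_all add: field_simps)
    ultimately show "\<bar>joint_law.prob (A \<inter> B) / joint_law.prob B - joint_law.prob A\<bar> \<le> \<eta>" using ab(2) by linarith
  qed
qed

lemma nu_mixing:
  "(\<lambda>n. SUP m\<in>{1..}. mix_coeff joint_law (future_at_nu joint_law (n + m)) (past_before_nu S joint_law m)) \<longlonglongrightarrow> 0"
proof (rule tendsto_SUP_0)
  fix n m
  note ev = future_at_nu_events past_before_nu_events
  note sp = space_future_at_nu space_past_before_nu
  show "0 \<le> mix_coeff joint_law (future_at_nu joint_law (n + m)) (past_before_nu S joint_law m)"
    by (rule joint_law.mix_coeff_nonneg[OF ev sp])
  show "mix_coeff joint_law (future_at_nu joint_law (n + m)) (past_before_nu S joint_law m) \<le> 1"
    by (rule joint_law.mix_coeff_least[OF sp joint_law.mix_coeff_set_bounded[OF ev]])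
next
  fix \<eta> :: real assume "0 < \<eta>"
  from past_future_mixing[OF this]
  show "\<exists>n0. \<forall>n\<ge>n0. \<forall>m\<ge>1. mix_coeff joint_law (future_at_nu joint_law (n + m)) (past_before_nu S joint_law m) \<le> \<eta>"
    by (meson joint_law.mix_coeff_least space_future_at_nu space_past_before_nu)
qed

abbreviation exc_seq :: "nat \<Rightarrow> (int \<Rightarrow> 's) \<times> ('d source \<Rightarrow> nat ^ 'd) \<Rightarrow> enat \<times> (nat ^ 'd) list" where
  "exc_seq n \<equiv> \<lambda>(\<omega>, y). excursion (popul y) n"

lemma seq_sigma_vimage:
  "seq_sigma joint_law exc_seq K =
     {(\<lambda>x. \<lambda>k\<in>K. exc_seq k x) -` C \<inter> space joint_law | C. C \<in> sets (PiM K (\<lambda>_. count_space UNIV))}"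
  unfolding seq_sigma_def by (rule sets_vimage_algebra2) (auto simp: space_PiM)

lemma exc_seq_measurable:
  "(\<lambda>x. \<lambda>k\<in>K. exc_seq k x) \<in> joint_law \<rightarrow>\<^sub>M PiM K (\<lambda>_. count_space UNIV)"
  by (rule measurable_restrict)
    (rule snd_popul_measurable[OF measurable_compose[OF path_popul_measurable excursion_measurable]])

lemma seq_sigma_future: "seq_sigma joint_law exc_seq {Suc K..} \<subseteq> future_at_nu joint_law K"
proof
  fix A assume "A \<in> seq_sigma joint_law exc_seq {Suc K..}"
  then obtain C where C: "C \<in> sets (PiM {Suc K..} (\<lambda>_. count_space UNIV))"
    "A = (\<lambda>x. \<lambda>k\<in>{Suc K..}. exc_seq k x) -` C \<inter> space joint_law"
    unfolding seq_sigma_vimage by blast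
  let ?\<psi> = "\<lambda>x :: nat \<Rightarrow> (nat ^ 'd) option. \<lambda>k\<in>{Suc K..}. opath_excursion (k - K) x"
  have \<psi>: "?\<psi> \<in> opathM \<rightarrow>\<^sub>M PiM {Suc K..} (\<lambda>_. count_space UNIV)"
    by (rule measurable_restrict) (rule opath_excursion_measurable)
  have "(\<lambda>k\<in>{Suc K..}. exc_seq k (\<omega>, y)) = ?\<psi> (shifted_path (popul y) K)" for \<omega> y
    by (auto simp: restrict_def opath_excursion_shifted_path fun_eq_iff)
  then have A: "A = (\<lambda>(\<omega>, y). shifted_path (popul y) K) -` (?\<psi> -` C \<inter> space opathM) \<inter> space joint_law"
    unfolding C(2) by (auto simp: space_PiM)
  show "A \<in> future_at_nu joint_law K"
    unfolding future_at_nu_def A by (rule in_vimage_algebra) (rule measurable_sets[OF \<psi> C(1)])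
qed

text \<open>The last of the first \<open>m\<close> excursions ends with the state 0 at the return
  itself, so they are all functionals of the path strictly before it; this is where
  \<open>path_cut\<close> enters.\<close>

lemma seq_sigma_past: "seq_sigma joint_law exc_seq {1..m} \<subseteq> past_before_nu S joint_law m"
proof
  fix B assume "B \<in> seq_sigma joint_law exc_seq {1..m}"
  then obtain C where C: "C \<in> sets (PiM {1..m} (\<lambda>_. count_space UNIV))"
    "B = (\<lambda>x. \<lambda>k\<in>{1..m}. exc_seq k x) -` C \<inter> space joint_law"
    unfolding seq_sigma_vimage by blast
  have "\<exists>B'\<in>past_before S joint_law n. B \<inter> {(\<omega>, y). nu (popul y) m = enat n} = B' \<inter> {(\<omega>, y). nu (popul y) m = enat n}" for n
  proof -
    let ?N = "PiM {..<n} (\<lambda>_. count_space UNIV) \<Otimes>\<^sub>M PiM {..<int n} (\<lambda>_. S) :: ((nat \<Rightarrow> nat ^ 'd) \<times> (int \<Rightarrow> 's)) measure"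
    let ?f = "\<lambda>(\<omega>, y). (restrict (popul y) {..<n}, restrict \<omega> {..<int n})"
    let ?\<psi> = "\<lambda>x :: (nat \<Rightarrow> nat ^ 'd) \<times> (int \<Rightarrow> 's). \<lambda>k\<in>{1..m}. excursion (path_cut n (fst x)) k"
    have \<psi>: "?\<psi> \<in> ?N \<rightarrow>\<^sub>M PiM {1..m} (\<lambda>_. count_space UNIV)"
      by (rule measurable_restrict)
        (rule measurable_compose[OF measurable_compose[OF measurable_fst path_cut_measurable] excursion_measurable])
    have eq: "(\<lambda>k\<in>{1..m}. exc_seq k (\<omega>, y)) = ?\<psi> (?f (\<omega>, y))" if "nu (popul y) m = enat n" for \<omega> y
    proof -
      have "popul y n = 0" using that by (rule nu_eq_0_state) simp
      then have "excursion (popul y) k = excursion (path_cut n (restrict (popul y) {..<n})) k" if "k \<le> m" for k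
        using that by (intro excursion_cong[OF \<open>nu (popul y) m = enat n\<close>]) (auto simp: path_cut_def order_le_less)
      then show ?thesis by (auto simp: restrict_def fun_eq_iff)
    qed
    let ?B = "?f -` (?\<psi> -` C \<inter> space ?N) \<inter> space joint_law"
    have "?B \<in> past_before S joint_law n"
      unfolding past_before_def using measurable_sets[OF \<psi> C(1)] by (rule in_vimage_algebra)
    moreover have "B \<inter> {(\<omega>, y). nu (popul y) m = enat n} = ?B \<inter> {(\<omega>, y). nu (popul y) m = enat n}"
    proof -
      have "x \<in> B \<longleftrightarrow> x \<in> ?B" if "x = (\<omega>, y)" "nu (popul y) m = enat n" for x \<omega> y
      proof (cases "x \<in> space joint_law")
        case True
        then have "?f x \<in> space ?N" using past_before_map by blast
        then show ?thesis using True eq[OF that(2), of \<omega>] unfolding C(2) that(1) by auto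
      qed (simp add: C(2))
      then show ?thesis by auto
    qed
    ultimately show ?thesis by blast
  qed
  moreover have "B \<in> sets joint_law"
    unfolding C(2) by (rule measurable_sets[OF exc_seq_measurable C(1)])
  ultimately show "B \<in> past_before_nu S joint_law m" unfolding past_before_nu_def by blast
qed

lemma excursion_mixing: "unif_mixing_seq joint_law exc_seq"
  unfolding unif_mixing_seq_def
proof (rule tendsto_SUP_0)
  have ev: "seq_sigma joint_law exc_seq K \<subseteq> sets joint_law" for K
    unfolding seq_sigma_vimage using measurable_sets[OF exc_seq_measurable] by blast
  have sp: "space joint_law \<in> seq_sigma joint_law exc_seq K" for K
    unfolding seq_sigma_def using sets.top[of "vimage_algebra (space joint_law) _ _"] by simp
  fix n m
  show "0 \<le> mix_coeff joint_law (seq_sigma joint_law exc_seq {m + n..}) (seq_sigma joint_law exc_seq {1..m})"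
    by (rule joint_law.mix_coeff_nonneg[OF ev ev sp sp])
  show "mix_coeff joint_law (seq_sigma joint_law exc_seq {m + n..}) (seq_sigma joint_law exc_seq {1..m}) \<le> 1"
    by (rule joint_law.mix_coeff_least[OF sp sp joint_law.mix_coeff_set_bounded[OF ev ev]])
next
  have sp: "space joint_law \<in> seq_sigma joint_law exc_seq K" for K
    unfolding seq_sigma_def using sets.top[of "vimage_algebra (space joint_law) _ _"] by simp
  fix \<eta> :: real assume "0 < \<eta>"
  from past_future_mixing[OF this] obtain n0 where n0: "\<And>n m A B. n \<ge> n0 \<Longrightarrow>
    A \<in> future_at_nu joint_law (n + m) \<Longrightarrow> B \<in> past_before_nu S joint_law m \<Longrightarrow> joint_law.prob B > 0 \<Longrightarrow>
    \<bar>joint_law.prob (A \<inter> B) / joint_law.prob B - joint_law.prob A\<bar> \<le> \<eta>" by blast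
  show "\<exists>n0. \<forall>n\<ge>n0. \<forall>m\<ge>1. mix_coeff joint_law (seq_sigma joint_law exc_seq {m + n..}) (seq_sigma joint_law exc_seq {1..m}) \<le> \<eta>"
  proof (intro exI[of _ "Suc n0"] allI impI joint_law.mix_coeff_least sp)
    fix n m A B assume n: "Suc n0 \<le> n" and A: "A \<in> seq_sigma joint_law exc_seq {m + n..}"
      and B: "B \<in> seq_sigma joint_law exc_seq {1..m}" "0 < joint_law.prob B"
    \<comment> \<open>The excursion of index \<open>m + n\<close> begins right after the return of
      index \<open>m + n - 1\<close>, so one unit of the gap is lost.\<close>
    have "m + n = Suc ((n - 1) + m)" using n by simp
    with A have "A \<in> seq_sigma joint_law exc_seq {Suc ((n - 1) + m)..}" by metis
    then have "A \<in> future_at_nu joint_law ((n - 1) + m)" using seq_sigma_future by blast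
    moreover have "B \<in> past_before_nu S joint_law m" using B(1) seq_sigma_past by blast
    moreover have "n0 \<le> n - 1" using n by simp
    ultimately show "\<bar>joint_law.prob (A \<inter> B) / joint_law.prob B - joint_law.prob A\<bar> \<le> \<eta>" using n0 B(2) by blast
  qed
qed

end

section \<open>Generating functions\<close>

definition vec_power :: "('d::finite \<Rightarrow> ennreal) \<Rightarrow> nat ^ 'd \<Rightarrow> ennreal" where
  "vec_power t v = (\<Prod>j\<in>UNIV. t j ^ (v $ j))"

lemma vec_power_zero[simp]: "vec_power t 0 = 1"
  by (simp add: vec_power_def)

lemma vec_power_add: "vec_power t (v + w) = vec_power t v * vec_power t w"
  by (simp add: vec_power_def power_add prod.distrib)

lemma vec_power_sum: "finite I \<Longrightarrow> vec_power t (\<Sum>i\<in>I. f i) = (\<Prod>i\<in>I. vec_power t (f i))"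
  by (induction I rule: finite_induct) (auto simp: vec_power_add)

text \<open>Relies on \<open>0 ^ 0 = 1\<close>: at the argument 0 a generating function is the
  probability of the zero vector.\<close>

lemma vec_power_0: "vec_power (\<lambda>_. 0) v = (if v = 0 then 1 else 0)"
proof (cases "v = 0")
  case False
  then obtain j where "v $ j \<noteq> 0" by (auto simp: vec_eq_iff)
  then show ?thesis using False by (auto simp: vec_power_def)
qed simp

text \<open>Bernoulli's inequality is stated additively because subtraction truncates on
  \<open>ennreal\<close>; \<open>x\<close> plays the role of \<open>1 - a\<close>.\<close>

lemma Bernoulli_mult:
  fixes a b x y :: ennreal
  assumes "1 \<le> a + x" "1 \<le> b + y"
  shows "1 \<le> a * b + (x + y)"
proof (cases "a \<le> 1")
  case True
  have "1 \<le> a * 1 + x" using assms by simp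
  also have "\<dots> \<le> a * (b + y) + x" using assms by (intro add_right_mono mult_left_mono) auto
  also have "\<dots> \<le> a * b + (x + y)"
    using mult_right_mono[OF True, of y] by (simp add: distrib_left add_ac add_left_mono)
  finally show ?thesis .
next
  case False
  then have "1 * b \<le> a * b" by (intro mult_right_mono) auto
  then have "b + y \<le> a * b + (x + y)" by (intro add_mono) (auto simp: add_increasing)
  with assms(2) show ?thesis by (rule order_trans)
qed

lemma Bernoulli_prod:
  fixes f x :: "'a \<Rightarrow> ennreal"
  assumes "\<And>i. i \<in> I \<Longrightarrow> 1 \<le> f i + x i"
  shows "1 \<le> (\<Prod>i\<in>I. f i) + (\<Sum>i\<in>I. x i)"
  using assms by (induction I rule: infinite_finite_induct) (auto intro!: Bernoulli_mult)

lemma Bernoulli_vec_power: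
  assumes "\<And>j. 1 \<le> t j + u j"
  shows "1 \<le> vec_power t v + (\<Sum>j\<in>UNIV. of_nat (v $ j) * u j)"
  unfolding vec_power_def
proof (rule Bernoulli_prod)
  fix j
  have "1 \<le> (\<Prod>i<v $ j. t j) + (\<Sum>i<v $ j. u j)"
    by (rule Bernoulli_prod) (rule assms)
  then show "1 \<le> t j ^ (v $ j) + of_nat (v $ j) * u j" by simp
qed

lemma offspring_measurable_comp:
  fixes f :: "'a \<Rightarrow> 'd::finite source \<Rightarrow> nat ^ 'd"
  assumes f: "f \<in> M \<rightarrow>\<^sub>M sourceM" and N: "N \<in> M \<rightarrow>\<^sub>M count_space UNIV"
  shows "(\<lambda>x. \<Sum>i\<in>UNIV. \<Sum>m\<in>{1..N x $ i}. f x (Off n m i)) \<in> M \<rightarrow>\<^sub>M count_space UNIV"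
proof -
  have "(\<lambda>x. \<Sum>i\<in>UNIV. \<Sum>m\<in>{1..v $ i}. f x (Off n m i)) \<in> M \<rightarrow>\<^sub>M count_space UNIV" for v :: "nat ^ 'd"
    by (intro measurable_count_space_sum measurable_compose[OF f source_measurable])
  from measurable_compose_countable[where f = "\<lambda>v x. \<Sum>i\<in>UNIV. \<Sum>m\<in>{1..v $ i}. f x (Off n m i)", OF this N]
  show ?thesis .
qed

context branching_env
begin

definition off_pgf :: "'s \<Rightarrow> ('d \<Rightarrow> ennreal) \<Rightarrow> 'd \<Rightarrow> ennreal" where
  "off_pgf s t i = (\<integral>\<^sup>+v. vec_power t v \<partial>measure_pmf (p i s))"

definition imm_pgf :: "'s \<Rightarrow> ('d \<Rightarrow> ennreal) \<Rightarrow> ennreal" where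
  "imm_pgf s t = (\<integral>\<^sup>+v. vec_power t v \<partial>measure_pmf (q s))"

text \<open>The latest generation acts innermost: with one-generation maps \<open>f_k\<close> given
  by \<open>\<omega> k\<close>, this is \<open>f_0 (f_1 (... f_{n-1} t))\<close>.\<close>

primrec off_pgf_iter :: "nat \<Rightarrow> (int \<Rightarrow> 's) \<Rightarrow> ('d \<Rightarrow> ennreal) \<Rightarrow> 'd \<Rightarrow> ennreal" where
  "off_pgf_iter 0 \<omega> t = t"
| "off_pgf_iter (Suc n) \<omega> t = off_pgf_iter n \<omega> (off_pgf (\<omega> (int n)) t)"

lemma nn_integral_prod_sources:
  assumes "finite K"
  shows "(\<integral>\<^sup>+y. (\<Prod>s\<in>K. \<phi> s (y s)) \<partial>Q \<omega>) = (\<Prod>s\<in>K. \<integral>\<^sup>+v. \<phi> s v \<partial>source_law \<omega> s)"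
proof -
  have "Q.indep_vars \<omega> (\<lambda>_. borel) (\<lambda>s y. \<phi> s (y s)) K"
    by (rule Q.indep_vars_compose2[OF Q.indep_vars_subset[OF indep_sources]]) auto
  then have "(\<integral>\<^sup>+y. (\<Prod>s\<in>K. \<phi> s (y s)) \<partial>Q \<omega>) = (\<Prod>s\<in>K. \<integral>\<^sup>+y. \<phi> s (y s) \<partial>Q \<omega>)"
    by (intro Q.indep_vars_nn_integral assms) auto
  also have "\<dots> = (\<Prod>s\<in>K. \<integral>\<^sup>+v. \<phi> s v \<partial>source_law \<omega> s)"
  proof (intro prod.cong refl)
    fix s
    have "(\<lambda>y. y s) \<in> Q \<omega> \<rightarrow>\<^sub>M count_space UNIV"
      using source_measurable by (simp add: measurable_cong_sets[OF sets_Q refl])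
    then show "(\<integral>\<^sup>+y. \<phi> s (y s) \<partial>Q \<omega>) = (\<integral>\<^sup>+v. \<phi> s v \<partial>source_law \<omega> s)"
      unfolding distr_source[symmetric, of \<omega> s] by (subst nn_integral_distr) simp_all
  qed
  finally show ?thesis .
qed

text \<open>For a fixed number of particles all sources involved are distinct and independent. The
  factor \<phi> of the immigration vector is carried along so that its value can be fixed by an
  indicator afterwards.\<close>

lemma offspring_gf_imm:
  "(\<integral>\<^sup>+y. \<phi> (y (Imm n)) * vec_power t (\<Sum>i\<in>UNIV. \<Sum>m\<in>{1..z $ i}. y (Off n m i)) \<partial>Q \<omega>) =
     (\<integral>\<^sup>+v. \<phi> v \<partial>measure_pmf (q (\<omega> (int n - 1)))) * vec_power (off_pgf (\<omega> (int n)) t) z"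
proof -
  let ?S = "SIGMA i:UNIV. {1..z $ i}" and ?g = "\<lambda>(i, m). Off n m i"
  let ?K = "?g ` ?S"
  \<comment> \<open>One family of factors for both kinds of sources, so that a single product
    formula applies.\<close>
  define \<psi> where "\<psi> s v = (case s of Imm _ \<Rightarrow> \<phi> v | Off _ _ _ \<Rightarrow> vec_power t v)" for s :: "'d source" and v
  have inj: "inj_on ?g ?S" by (auto simp: inj_on_def)
  have "\<phi> (y (Imm n)) * vec_power t (\<Sum>i\<in>UNIV. \<Sum>m\<in>{1..z $ i}. y (Off n m i)) = (\<Prod>s\<in>insert (Imm n) ?K. \<psi> s (y s))" for y
  proof -
    have "vec_power t (\<Sum>i\<in>UNIV. \<Sum>m\<in>{1..z $ i}. y (Off n m i)) = (\<Prod>x\<in>?S. vec_power t (y (?g x)))"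
      by (simp add: vec_power_sum prod.Sigma split_beta)
    also have "\<dots> = (\<Prod>s\<in>?K. \<psi> s (y s))"
      by (subst prod.reindex[OF inj]) (auto simp: \<psi>_def split_beta)
    finally show ?thesis by (subst prod.insert) (auto simp: \<psi>_def)
  qed
  then have "(\<integral>\<^sup>+y. \<phi> (y (Imm n)) * vec_power t (\<Sum>i\<in>UNIV. \<Sum>m\<in>{1..z $ i}. y (Off n m i)) \<partial>Q \<omega>) =
      (\<Prod>s\<in>insert (Imm n) ?K. \<integral>\<^sup>+v. \<psi> s v \<partial>source_law \<omega> s)"
    by (simp only:) (rule nn_integral_prod_sources, simp)
  also have "\<dots> = (\<integral>\<^sup>+v. \<phi> v \<partial>measure_pmf (q (\<omega> (int n - 1)))) * (\<Prod>s\<in>?K. \<integral>\<^sup>+v. \<psi> s v \<partial>source_law \<omega> s)"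
  proof -
    have "\<psi> (Imm n) = \<phi>" by (auto simp: fun_eq_iff \<psi>_def)
    then show ?thesis by (subst prod.insert) (auto simp: source_law_def)
  qed
  also have "(\<Prod>s\<in>?K. \<integral>\<^sup>+v. \<psi> s v \<partial>source_law \<omega> s) = (\<Prod>(i, m)\<in>?S. off_pgf (\<omega> (int n)) t i)"
  proof -
    have "\<psi> (Off n m i) = vec_power t" for m i by (auto simp: fun_eq_iff \<psi>_def)
    then show ?thesis
      by (subst prod.reindex[OF inj]) (auto simp: source_law_def off_pgf_def intro!: prod.cong)
  qed
  also have "\<dots> = vec_power (off_pgf (\<omega> (int n)) t) z"
    by (subst prod.Sigma[symmetric]) (auto simp: vec_power_def)
  finally show ?thesis .
qed

lemma offspring_gf:
  "(\<integral>\<^sup>+y. vec_power t (\<Sum>i\<in>UNIV. \<Sum>m\<in>{1..z $ i}. y (Off n m i)) \<partial>Q \<omega>) = vec_power (off_pgf (\<omega> (int n)) t) z"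
  using offspring_gf_imm[where \<phi> = "\<lambda>_. 1" and n = n and t = t and z = z and \<omega> = \<omega>] by (simp add: measure_pmf.emeasure_space_1)

text \<open>Here the number of summands is itself random; the integral is summed over the values
  \<open>x\<close> of the immigration vector, for each of which the number is fixed.\<close>

lemma offspring_gf_with_imm:
  "(\<integral>\<^sup>+y. vec_power t (\<Sum>i\<in>UNIV. \<Sum>m\<in>{1..z $ i + y (Imm n) $ i}. y (Off n m i)) \<partial>Q \<omega>) =
     vec_power (off_pgf (\<omega> (int n)) t) z * imm_pgf (\<omega> (int n - 1)) (off_pgf (\<omega> (int n)) t)"
proof -
  let ?Z = "\<lambda>x y. \<Sum>i\<in>UNIV. \<Sum>m\<in>{1..(z + x) $ i}. y (Off n m i)"
  have m: "(\<lambda>y. indicator {x} (y (Imm n)) * vec_power t (?Z x y)) \<in> borel_measurable sourceM" for x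
    by (intro borel_measurable_times_ennreal measurable_compose[OF source_measurable]
        measurable_compose[OF offspring_measurable_comp[where f = "\<lambda>y. y"]]) simp_all
  have "(\<integral>\<^sup>+y. vec_power t (\<Sum>i\<in>UNIV. \<Sum>m\<in>{1..z $ i + y (Imm n) $ i}. y (Off n m i)) \<partial>Q \<omega>) =
      (\<integral>\<^sup>+y. \<integral>\<^sup>+x. indicator {x} (y (Imm n)) * vec_power t (?Z x y) \<partial>count_space UNIV \<partial>Q \<omega>)"
  proof (rule nn_integral_cong)
    fix y
    have "(\<integral>\<^sup>+x. indicator {x} (y (Imm n)) * vec_power t (?Z x y) \<partial>count_space UNIV) =
        (\<integral>\<^sup>+x. vec_power t (?Z (y (Imm n)) y) * indicator {y (Imm n)} x \<partial>count_space UNIV)"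
      by (intro nn_integral_cong) (auto simp: indicator_def)
    also have "\<dots> = vec_power t (?Z (y (Imm n)) y)"
      by (subst nn_integral_cmult_indicator) auto
    finally show "vec_power t (\<Sum>i\<in>UNIV. \<Sum>m\<in>{1..z $ i + y (Imm n) $ i}. y (Off n m i)) =
        (\<integral>\<^sup>+x. indicator {x} (y (Imm n)) * vec_power t (?Z x y) \<partial>count_space UNIV)" by simp
  qed
  also have "\<dots> = (\<integral>\<^sup>+x. \<integral>\<^sup>+y. indicator {x} (y (Imm n)) * vec_power t (?Z x y) \<partial>Q \<omega> \<partial>count_space UNIV)"
    using m by (intro nn_integral_count_space_nn_integral) (auto simp: measurable_cong_sets[OF sets_Q refl])
  also have "\<dots> = (\<integral>\<^sup>+x. vec_power (off_pgf (\<omega> (int n)) t) z * (pmf (q (\<omega> (int n - 1))) x * vec_power (off_pgf (\<omega> (int n)) t) x) \<partial>count_space UNIV)"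
    by (intro nn_integral_cong, subst offspring_gf_imm) (simp add: vec_power_add emeasure_pmf_single mult_ac)
  also have "\<dots> = vec_power (off_pgf (\<omega> (int n)) t) z * imm_pgf (\<omega> (int n - 1)) (off_pgf (\<omega> (int n)) t)"
    unfolding imm_pgf_def nn_integral_measure_pmf by (rule nn_integral_cmult) simp
  finally show ?thesis .
qed

lemma popul_gf_step:
  "(\<integral>\<^sup>+y. vec_power t (popul y (Suc n)) \<partial>Q \<omega>) =
     (\<integral>\<^sup>+y. vec_power (off_pgf (\<omega> (int n)) t) (popul y n) \<partial>Q \<omega>) * imm_pgf (\<omega> (int n - 1)) (off_pgf (\<omega> (int n)) t)"
proof -
  let ?J = "past_sources n :: 'd source set"
  let ?F = "\<lambda>(a :: 'd source \<Rightarrow> nat ^ 'd, b :: 'd source \<Rightarrow> nat ^ 'd).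
    vec_power t (\<Sum>i\<in>UNIV. \<Sum>m\<in>{1..(popul a n + b (Imm n)) $ i}. b (Off n m i))"
  have "(\<lambda>x. popul (fst x) n + snd x (Imm n)) \<in> sourceM \<Otimes>\<^sub>M sourceM \<rightarrow>\<^sub>M (count_space UNIV :: (nat ^ 'd) measure)"
    by (rule measurable_count_space_binop[where h = "(+)", OF measurable_compose[OF measurable_fst popul_measurable]
          measurable_compose[OF measurable_snd source_measurable]])
  from measurable_compose[OF offspring_measurable_comp[OF measurable_snd this], of "vec_power t" borel]
  have "?F \<in> borel_measurable (sourceM \<Otimes>\<^sub>M sourceM)" by (simp add: split_beta)
  from nn_integral_split_sources[OF this, of \<omega> ?J]
  have "(\<integral>\<^sup>+y. ?F (restrict y ?J, restrict y (- ?J)) \<partial>Q \<omega>) =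
    (\<integral>\<^sup>+a. \<integral>\<^sup>+b. ?F (restrict a ?J, restrict b (- ?J)) \<partial>Q \<omega> \<partial>Q \<omega>)" .
  moreover have "?F (restrict a ?J, restrict b (- ?J)) =
      vec_power t (\<Sum>i\<in>UNIV. \<Sum>m\<in>{1..popul a n $ i + b (Imm n) $ i}. b (Off n m i))" for a b
    by (simp add: past_sources_def popul_restrict)
  ultimately have "(\<integral>\<^sup>+y. vec_power t (popul y (Suc n)) \<partial>Q \<omega>) =
    (\<integral>\<^sup>+a. \<integral>\<^sup>+b. vec_power t (\<Sum>i\<in>UNIV. \<Sum>m\<in>{1..popul a n $ i + b (Imm n) $ i}. b (Off n m i)) \<partial>Q \<omega> \<partial>Q \<omega>)"
    by simp
  also have "\<dots> = (\<integral>\<^sup>+y. vec_power (off_pgf (\<omega> (int n)) t) (popul y n) \<partial>Q \<omega>) * imm_pgf (\<omega> (int n - 1)) (off_pgf (\<omega> (int n)) t)"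
    unfolding offspring_gf_with_imm
    by (rule nn_integral_multc)
      (simp add: measurable_cong_sets[OF sets_Q refl] measurable_compose[OF popul_measurable])
  finally show ?thesis .
qed

lemma lineage_gf_step:
  "(\<integral>\<^sup>+y. vec_power t (lineage y (Suc n) 0) \<partial>Q \<omega>) =
     (\<integral>\<^sup>+y. vec_power (off_pgf (\<omega> (int n)) t) (lineage y n 0) \<partial>Q \<omega>)"
proof -
  \<comment> \<open>\<open>Imm 0\<close> has to be added because for \<open>n = 0\<close> the past
    sources are empty, yet the lineage already depends on it.\<close>
  let ?J = "insert (Imm 0) (past_sources n) :: 'd source set"
  let ?F = "\<lambda>(a :: 'd source \<Rightarrow> nat ^ 'd, b :: 'd source \<Rightarrow> nat ^ 'd).
    vec_power t (\<Sum>i\<in>UNIV. \<Sum>m\<in>{1..lineage a n 0 $ i}. b (Off n m i))"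
  from measurable_compose[OF offspring_measurable_comp[OF measurable_snd
        measurable_compose[OF measurable_fst lineage_measurable[of n 0]]], of "vec_power t" borel]
  have "?F \<in> borel_measurable (sourceM \<Otimes>\<^sub>M sourceM)" by (simp add: split_beta)
  from nn_integral_split_sources[OF this, of \<omega> ?J]
  have "(\<integral>\<^sup>+y. ?F (restrict y ?J, restrict y (- ?J)) \<partial>Q \<omega>) =
    (\<integral>\<^sup>+a. \<integral>\<^sup>+b. ?F (restrict a ?J, restrict b (- ?J)) \<partial>Q \<omega> \<partial>Q \<omega>)" .
  moreover have "?F (restrict a ?J, restrict b (- ?J)) =
      vec_power t (\<Sum>i\<in>UNIV. \<Sum>m\<in>{1..lineage a n 0 $ i}. b (Off n m i))" for a b
  proof -
    have "lineage (restrict a ?J) n 0 = lineage a n 0"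
      by (rule lineage_cong[of n]) (auto simp: past_sources_def)
    then show ?thesis by (simp add: past_sources_def)
  qed
  \<comment> \<open>The immigrants of time 0 are the oldest, so their descendants bear the first
    labels.\<close>
  moreover have "lineage y (Suc n) 0 = (\<Sum>i\<in>UNIV. \<Sum>m\<in>{1..lineage y n 0 $ i}. y (Off n m i))" for y :: "'d source \<Rightarrow> nat ^ 'd"
    by (simp add: atLeastSucAtMost_greaterThanAtMost)
  ultimately have "(\<integral>\<^sup>+y. vec_power t (lineage y (Suc n) 0) \<partial>Q \<omega>) =
    (\<integral>\<^sup>+a. \<integral>\<^sup>+b. vec_power t (\<Sum>i\<in>UNIV. \<Sum>m\<in>{1..lineage a n 0 $ i}. b (Off n m i)) \<partial>Q \<omega> \<partial>Q \<omega>)"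
    by simp
  then show ?thesis unfolding offspring_gf .
qed

lemma lineage_gf: "(\<integral>\<^sup>+y. vec_power t (lineage y n 0) \<partial>Q \<omega>) = imm_pgf (\<omega> (-1)) (off_pgf_iter n \<omega> t)"
proof (induction n arbitrary: t)
  case 0
  show ?case
    using offspring_gf_imm[where \<phi> = "vec_power t" and n = 0 and t = t and z = 0 and \<omega> = \<omega>] by (simp add: imm_pgf_def)
next
  case (Suc n)
  show ?case by (simp only: lineage_gf_step Suc off_pgf_iter.simps)
qed

text \<open>Each factor is, by \<open>lineage_gf\<close>, the generating function of one lineage
  started in a shifted environment. The factorisation comes from the recursion for generating
  functions and stands in for a proof that the lineages built from common sources are
  independent.\<close>

lemma popul_gf:
  "(\<integral>\<^sup>+y. vec_power t (popul y n) \<partial>Q \<omega>) =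
     (\<Prod>i<n. imm_pgf (\<omega> (int i - 1)) (off_pgf_iter (n - i) (env_shift (int i) \<omega>) t))"
proof (induction n arbitrary: t)
  case 0
  show ?case using Q.emeasure_space_1[of \<omega>] by simp
next
  case (Suc n)
  have "off_pgf_iter (Suc n - i) (env_shift (int i) \<omega>) t = off_pgf_iter (n - i) (env_shift (int i) \<omega>) (off_pgf (\<omega> (int n)) t)"
    if "i \<le> n" for i
    using that by (simp add: Suc_diff_le env_shift_def of_nat_diff)
  then show ?case unfolding popul_gf_step Suc by (simp del: off_pgf_iter.simps(2))
qed

section \<open>Extinction of one lineage and emptiness of the population\<close>

definition lineage_zero_prob :: "nat \<Rightarrow> (int \<Rightarrow> 's) \<Rightarrow> ennreal" where
  "lineage_zero_prob n \<omega> = (\<integral>\<^sup>+y. (if lineage y n 0 = 0 then 1 else 0) \<partial>Q \<omega>)"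

definition zero_prob :: "nat \<Rightarrow> (int \<Rightarrow> 's) \<Rightarrow> ennreal" where
  "zero_prob n \<omega> = (\<integral>\<^sup>+y. (if popul y n = 0 then 1 else 0) \<partial>Q \<omega>)"

lemma lineage_zero_prob_eq: "lineage_zero_prob n \<omega> = imm_pgf (\<omega> (-1)) (off_pgf_iter n \<omega> (\<lambda>_. 0))"
  unfolding lineage_gf[symmetric] lineage_zero_prob_def vec_power_0 ..

lemma zero_prob_eq_prod: "zero_prob n \<omega> = (\<Prod>i<n. lineage_zero_prob (n - i) (env_shift (int i) \<omega>))"
proof -
  have "zero_prob n \<omega> = (\<integral>\<^sup>+y. vec_power (\<lambda>_. 0) (popul y n) \<partial>Q \<omega>)"
    unfolding zero_prob_def vec_power_0 ..
  then show ?thesis unfolding popul_gf lineage_zero_prob_eq by (simp add: env_shift_def)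
qed

text \<open>Seen from the fixed final time 0, starting earlier only appends factors. This makes the
  probability monotone in the starting time and its limit an infinite product.\<close>

lemma zero_prob_shift: "zero_prob n (env_shift (- int n) \<omega>) = (\<Prod>j=1..n. lineage_zero_prob j (env_shift (- int j) \<omega>))"
proof -
  have "zero_prob n (env_shift (- int n) \<omega>) = (\<Prod>i<n. lineage_zero_prob (n - i) (env_shift (- int (n - i)) \<omega>))"
    unfolding zero_prob_eq_prod by (intro prod.cong refl) (simp add: of_nat_diff)
  also have "\<dots> = (\<Prod>j=1..n. lineage_zero_prob j (env_shift (- int j) \<omega>))"
    by (rule prod.reindex_bij_witness[of _ "\<lambda>j. n - j" "\<lambda>i. n - i"]) auto
  finally show ?thesis .
qed

lemma lineage_zero_prob_measurable[measurable]: "lineage_zero_prob n \<in> borel_measurable P"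
  unfolding lineage_zero_prob_def[abs_def]
  by (rule nn_integral_Q_measurable1) (rule measurable_compose[OF lineage_measurable], simp)

lemma zero_prob_measurable[measurable]: "zero_prob n \<in> borel_measurable P"
  unfolding zero_prob_def[abs_def]
  by (rule nn_integral_Q_measurable1) (rule measurable_compose[OF popul_measurable], simp)

lemma lineage_zero_prob_le_1: "lineage_zero_prob n \<omega> \<le> 1"
  unfolding lineage_zero_prob_def by (rule nn_integral_Q_le_1) simp

section \<open>First-moment bounds for survival\<close>

definition imm_moment :: "'s \<Rightarrow> 'd \<Rightarrow> ennreal" where
  "imm_moment s j = (\<integral>\<^sup>+v. of_nat (v $ j) \<partial>measure_pmf (q s))"

definition off_moment :: "'s \<Rightarrow> 'd \<Rightarrow> 'd \<Rightarrow> ennreal" where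
  "off_moment s i j = (\<integral>\<^sup>+v. of_nat (v $ j) \<partial>measure_pmf (p i s))"

text \<open>The quenched mean vector, that is \<open>M_{n-1} ... M_0 I_0\<close>, with values in
  [0,\<infinity>] so that no finiteness is required.\<close>

primrec lineage_mean :: "nat \<Rightarrow> (int \<Rightarrow> 's) \<Rightarrow> 'd \<Rightarrow> ennreal" where
  "lineage_mean 0 \<omega> j = imm_moment (\<omega> (-1)) j"
| "lineage_mean (Suc n) \<omega> j = (\<Sum>i\<in>UNIV. lineage_mean n \<omega> i * off_moment (\<omega> (int n)) i j)"

lemma Bernoulli_pmf:
  assumes "\<And>j. 1 \<le> t j + u j"
  shows "1 \<le> (\<integral>\<^sup>+v. vec_power t v \<partial>measure_pmf M) + (\<Sum>j\<in>UNIV. (\<integral>\<^sup>+v. of_nat (v $ j) \<partial>measure_pmf M) * u j)"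
proof -
  have "1 = (\<integral>\<^sup>+v. 1 \<partial>measure_pmf M)" by (simp add: measure_pmf.emeasure_space_1)
  also have "\<dots> \<le> (\<integral>\<^sup>+v. vec_power t v + (\<Sum>j\<in>UNIV. of_nat (v $ j) * u j) \<partial>measure_pmf M)"
    by (intro nn_integral_mono Bernoulli_vec_power assms)
  also have "\<dots> = (\<integral>\<^sup>+v. vec_power t v \<partial>measure_pmf M) + (\<Sum>j\<in>UNIV. (\<integral>\<^sup>+v. of_nat (v $ j) \<partial>measure_pmf M) * u j)"
    by (simp add: nn_integral_add nn_integral_sum nn_integral_multc)
  finally show ?thesis .
qed

text \<open>The inequality 1 - f(t) \<le> mean * (1 - t) for generating functions survives
  composition; \<open>u\<close> stands for \<open>1 - t\<close>, and a generation maps it by the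
  mean matrix.\<close>

lemma Bernoulli_lineage:
  assumes "\<And>j. 1 \<le> t j + u j"
  shows "1 \<le> imm_pgf (\<omega> (-1)) (off_pgf_iter n \<omega> t) + (\<Sum>j\<in>UNIV. lineage_mean n \<omega> j * u j)"
  using assms
proof (induction n arbitrary: t u)
  case 0
  then show ?case using Bernoulli_pmf[OF 0, of "q (\<omega> (-1))"] by (simp add: imm_pgf_def imm_moment_def)
next
  case (Suc n)
  let ?u = "\<lambda>i. \<Sum>j\<in>UNIV. off_moment (\<omega> (int n)) i j * u j"
  have "1 \<le> off_pgf (\<omega> (int n)) t i + ?u i" for i
    unfolding off_pgf_def off_moment_def by (rule Bernoulli_pmf) (rule Suc.prems)
  from Suc.IH[of "off_pgf (\<omega> (int n)) t" ?u, OF this]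
  have "1 \<le> imm_pgf (\<omega> (-1)) (off_pgf_iter (Suc n) \<omega> t) + (\<Sum>i\<in>UNIV. lineage_mean n \<omega> i * ?u i)" by simp
  also have "(\<Sum>i\<in>UNIV. lineage_mean n \<omega> i * ?u i) = (\<Sum>j\<in>UNIV. lineage_mean (Suc n) \<omega> j * u j)"
    by (simp add: sum_distrib_left sum_distrib_right mult.assoc) (rule sum.swap)
  finally show ?case .
qed

text \<open>First-moment method: the probability of survival is at most the mean number of
  survivors.\<close>

lemma lineage_zero_prob_lower: "1 \<le> lineage_zero_prob n \<omega> + (\<Sum>j\<in>UNIV. lineage_mean n \<omega> j)"
  using Bernoulli_lineage[where t = "\<lambda>_. 0" and u = "\<lambda>_. 1" and \<omega> = \<omega> and n = n] by (simp add: lineage_zero_prob_eq)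

text \<open>With no immigrant there is no lineage, and this alone has positive probability.\<close>

lemma lineage_zero_prob_pos:
  assumes "pmf (q (\<omega> (-1))) 0 > 0"
  shows "lineage_zero_prob n \<omega> > 0"
proof -
  have "0 < ennreal (pmf (q (\<omega> (-1))) 0) * vec_power (off_pgf_iter n \<omega> (\<lambda>_. 0)) 0" using assms by simp
  also have "\<dots> = (\<integral>\<^sup>+v. vec_power (off_pgf_iter n \<omega> (\<lambda>_. 0)) v * indicator {0} v \<partial>measure_pmf (q (\<omega> (-1))))"
    by (subst nn_integral_indicator_finite) (auto simp: mult.commute emeasure_pmf_single)
  also have "\<dots> \<le> lineage_zero_prob n \<omega>"
    unfolding lineage_zero_prob_eq imm_pgf_def by (intro nn_integral_mono) (auto simp: indicator_def)
  finally show ?thesis .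
qed

text \<open>Scenario: exactly \<open>v0\<close> immigrants arrive at time 0 and all of them die
  childless.\<close>

lemma return_prob_1_lower:
  "ennreal (pmf (q (\<omega> (-1))) v0) * (\<Prod>j\<in>UNIV. ennreal (pmf (p j (\<omega> 0)) 0) ^ (v0 $ j)) \<le> return_prob 1 1 \<omega>"
proof -
  let ?t = "off_pgf (\<omega> 0) (\<lambda>_. 0)"
  have t: "?t j = pmf (p j (\<omega> 0)) 0" for j
  proof -
    have "?t j = (\<integral>\<^sup>+v. indicator {0} v \<partial>measure_pmf (p j (\<omega> 0)))"
      unfolding off_pgf_def vec_power_0 by (intro nn_integral_cong) (auto simp: indicator_def)
    then show ?thesis by (simp add: emeasure_pmf_single)
  qed
  have "ennreal (pmf (q (\<omega> (-1))) v0) * (\<Prod>j\<in>UNIV. ennreal (pmf (p j (\<omega> 0)) 0) ^ (v0 $ j)) =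
      (\<integral>\<^sup>+v. vec_power ?t v * indicator {v0} v \<partial>measure_pmf (q (\<omega> (-1))))"
    by (subst nn_integral_indicator_finite) (auto simp: mult.commute vec_power_def t emeasure_pmf_single)
  also have "\<dots> \<le> imm_pgf (\<omega> (-1)) ?t"
    unfolding imm_pgf_def by (intro nn_integral_mono) (auto simp: indicator_def)
  also have "\<dots> = zero_prob 1 \<omega>"
    unfolding zero_prob_eq_prod lineage_zero_prob_eq by simp
  also have "\<dots> \<le> return_prob 1 1 \<omega>"
    unfolding zero_prob_def return_prob_def
  proof (intro nn_integral_mono)
    fix y :: "'d source \<Rightarrow> nat ^ 'd"
    have "nu (popul y) (Suc 0) = enat 1" if "popul y 1 = 0"
      unfolding nu_Suc_enat using that by (auto simp: zero_enat_def)
    then show "(if popul y 1 = 0 then 1 else 0) \<le> (if nu (popul y) 1 = enat 1 then 1 else 0 :: ennreal)"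
      by auto
  qed
  finally show ?thesis .
qed

end

section \<open>Decay of products of mean matrices\<close>

text \<open>Largest absolute column sum, the closed form of the operator norm for the sum norm; as a
  finite maximum it makes measurability evident.\<close>

definition colmax :: "real ^ 'd ^ 'd::finite \<Rightarrow> real" where
  "colmax A = Max (range (\<lambda>i. \<Sum>j\<in>UNIV. \<bar>A $ j $ i\<bar>))"

lemma colsum_le_colmax: "(\<Sum>j\<in>UNIV. \<bar>A $ j $ i\<bar>) \<le> colmax A"
  unfolding colmax_def by (rule Max_ge) auto

lemma colmax_nonneg: "0 \<le> colmax A"
  by (rule order_trans[OF _ colsum_le_colmax]) (simp add: sum_nonneg)

lemma norm1_nonneg: "0 \<le> norm1 v"
  by (simp add: norm1_def sum_nonneg)

lemma norm1_mult_le: "norm1 (A *v v) \<le> colmax A * norm1 v"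
proof -
  have "norm1 (A *v v) \<le> (\<Sum>j\<in>UNIV. \<Sum>i\<in>UNIV. \<bar>A $ j $ i\<bar> * \<bar>v $ i\<bar>)"
    unfolding norm1_def matrix_vector_mult_def
    by (intro sum_mono) (simp, rule order_trans[OF sum_abs], simp add: abs_mult)
  also have "\<dots> = (\<Sum>i\<in>UNIV. (\<Sum>j\<in>UNIV. \<bar>A $ j $ i\<bar>) * \<bar>v $ i\<bar>)"
    by (subst sum.swap) (simp add: sum_distrib_right)
  also have "\<dots> \<le> (\<Sum>i\<in>UNIV. colmax A * \<bar>v $ i\<bar>)"
    by (intro sum_mono mult_right_mono colsum_le_colmax) auto
  finally show ?thesis by (simp add: norm1_def sum_distrib_left)
qed

lemma opnorm1_eq_colmax: "opnorm1 A = colmax A"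
proof (rule antisym)
  \<comment> \<open>For \<open>v = 0\<close> the quotient is 0 by division by zero, so including
    this vector in the supremum does no harm.\<close>
  have le: "norm1 (A *v v) / norm1 v \<le> colmax A" for v
    using norm1_mult_le[of A v] norm1_nonneg[of v] colmax_nonneg[of A]
    by (cases "norm1 v = 0") (auto simp: divide_le_eq)
  show "opnorm1 A \<le> colmax A"
    unfolding opnorm1_def by (rule cSUP_least) (auto intro: le)
  have bdd: "bdd_above (range (\<lambda>v. norm1 (A *v v) / norm1 v))"
    using le by (auto intro!: bdd_aboveI2)
  have "(\<Sum>j\<in>UNIV. \<bar>A $ j $ i\<bar>) \<le> opnorm1 A" for i
  proof -
    have "norm1 (axis i 1 :: real ^ 'a) = 1"
      by (simp add: norm1_def axis_def if_distrib cong: if_cong)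
    moreover have "norm1 (A *v axis i 1) = (\<Sum>j\<in>UNIV. \<bar>A $ j $ i\<bar>)"
      by (simp add: norm1_def matrix_vector_mult_basis column_def)
    ultimately show ?thesis
      unfolding opnorm1_def using cSUP_upper[OF UNIV_I bdd, of "axis i 1"] by simp
  qed
  then show "colmax A \<le> opnorm1 A" unfolding colmax_def by (subst Max_le_iff) auto
qed

lemma norm1_mult_opnorm1: "norm1 (A *v v) \<le> opnorm1 A * norm1 v"
  unfolding opnorm1_eq_colmax by (rule norm1_mult_le)

lemma opnorm1_nonneg: "0 \<le> opnorm1 A"
  unfolding opnorm1_eq_colmax by (rule colmax_nonneg)

lemma opnorm1_mult_le: "opnorm1 (A ** B) \<le> opnorm1 A * opnorm1 B"
  unfolding opnorm1_def[of "A ** B"]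
proof (rule cSUP_least)
  fix v
  have "norm1 ((A ** B) *v v) \<le> opnorm1 A * norm1 (B *v v)"
    by (simp add: matrix_vector_mul_assoc[symmetric] norm1_mult_opnorm1)
  also have "\<dots> \<le> opnorm1 A * (opnorm1 B * norm1 v)"
    by (intro mult_left_mono norm1_mult_opnorm1 opnorm1_nonneg)
  finally show "norm1 ((A ** B) *v v) / norm1 v \<le> opnorm1 A * opnorm1 B"
    using norm1_nonneg[of v] opnorm1_nonneg[of A] opnorm1_nonneg[of B]
    by (cases "norm1 v = 0") (auto simp: divide_le_eq mult.assoc)
qed simp

lemma opnorm1_mat_1: "opnorm1 (mat 1 :: real ^ 'd ^ 'd::finite) = 1"
proof -
  have "(\<Sum>j\<in>UNIV. \<bar>(mat 1 :: real ^ 'd ^ 'd) $ j $ i\<bar>) = 1" for i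
    by (simp add: mat_def if_distrib cong: if_cong)
  then show ?thesis unfolding opnorm1_eq_colmax colmax_def by simp
qed

lemma opnorm1_measurable:
  assumes "\<And>i j. (\<lambda>x. A x $ j $ i) \<in> borel_measurable M"
  shows "(\<lambda>x. opnorm1 (A x)) \<in> borel_measurable M"
proof -
  have "(\<lambda>x. Max ((\<lambda>i. \<Sum>j\<in>UNIV. \<bar>A x $ j $ i\<bar>) ` UNIV)) \<in> borel_measurable M"
    using assms by (intro borel_measurable_Max) auto
  then show ?thesis unfolding opnorm1_eq_colmax colmax_def .
qed

lemma le_exp_log_plus: "x \<le> exp (log_plus x)"
proof (cases "x \<le> 0")
  case False
  then have "exp (ln x) \<le> exp (log_plus x)" unfolding exp_le_cancel_iff by (simp add: log_plus_def)
  with False show ?thesis by simp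
qed (use order_trans[OF _ exp_ge_zero] in auto)

lemma log_plus_nonneg: "0 \<le> log_plus x"
  by (simp add: log_plus_def)

text \<open>Garsia's argument: \<open>maxsum \<phi> T n\<close> is the maximum of \<open>0\<close> and the first \<open>n\<close> ergodic sums.\<close>

primrec maxsum :: "('a \<Rightarrow> real) \<Rightarrow> ('a \<Rightarrow> 'a) \<Rightarrow> nat \<Rightarrow> 'a \<Rightarrow> real" where
  "maxsum \<phi> T 0 x = 0"
| "maxsum \<phi> T (Suc n) x = max 0 (\<phi> x + maxsum \<phi> T n (T x))"

lemma maxsum_nonneg: "0 \<le> maxsum \<phi> T n x"
  by (cases n) auto

lemma maxsum_mono: "maxsum \<phi> T n x \<le> maxsum \<phi> T (Suc n) x"
proof (induction n arbitrary: x)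
  case (Suc n)
  show ?case using Suc[of "T x"] by (subst (1 2) maxsum.simps(2)) auto
qed simp

lemma sum_le_maxsum: "(\<Sum>i<n. \<phi> ((T ^^ i) x)) \<le> maxsum \<phi> T n x"
proof (induction n arbitrary: x)
  case (Suc n)
  have "(\<Sum>i<Suc n. \<phi> ((T ^^ i) x)) = \<phi> x + (\<Sum>i<n. \<phi> ((T ^^ i) (T x)))"
    by (subst sum.lessThan_Suc_shift) (simp add: funpow_swap1)
  then show ?case using Suc[of "T x"] by simp
qed simp

text \<open>On the set where the maximal sum is positive, \<phi> dominates a function minus its
  composition with \<open>T\<close>, whose integral vanishes by invariance; so \<phi> has
  nonnegative integral there. If almost every point has some positive sum, these sets exhaust the
  space and the integral of \<phi> would be nonnegative.\<close>

lemma (in prob_space) maximal_ergodic: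
  fixes \<phi> :: "'a \<Rightarrow> real"
  assumes T: "T \<in> M \<rightarrow>\<^sub>M M" "distr M M T = M"
    and \<phi>: "integrable M \<phi>" "(\<integral>x. \<phi> x \<partial>M) < 0"
  shows "\<not> (AE x in M. \<exists>n. (\<Sum>i<n. \<phi> ((T ^^ i) x)) > 0)"
proof
  assume pos: "AE x in M. \<exists>n. (\<Sum>i<n. \<phi> ((T ^^ i) x)) > 0"
  note T(1)[measurable] borel_measurable_integrable[OF \<phi>(1), measurable]
  let ?m = "maxsum \<phi> T"
  have int: "integrable M (?m n)" for n
  proof (induction n)
    case (Suc n)
    then have "integrable (distr M M T) (?m n)" by (simp add: T(2))
    then have "integrable M (\<lambda>x. ?m n (T x))" by (rule integrable_distr[OF T(1)])
    with \<phi>(1) show ?case by (simp add: integrable_max)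
  qed simp
  note borel_measurable_integrable[OF int, measurable]
  have intT: "integrable M (\<lambda>x. ?m n (T x))" for n
  proof -
    have "integrable (distr M M T) (?m n)" using int by (simp add: T(2))
    then show ?thesis by (rule integrable_distr[OF T(1)])
  qed
  have eqT: "(\<integral>x. ?m n (T x) \<partial>M) = (\<integral>x. ?m n x \<partial>M)" for n
    using integral_distr[of T M M "?m n"] by (simp add: T(2))
  define I where "I n x = (if ?m n x > 0 then 1 else 0 :: real)" for n x
  have [measurable]: "I n \<in> borel_measurable M" for n unfolding I_def by measurable
  have intI: "integrable M (\<lambda>x. \<phi> x * I n x)" for n
    by (rule Bochner_Integration.integrable_bound[OF \<phi>(1)]) (auto simp: I_def)
  have ge: "0 \<le> (\<integral>x. \<phi> x * I n x \<partial>M)" for n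
  proof -
    \<comment> \<open>Where the maximum is positive it is attained by a nonempty sum, which begins
      with \<open>\<phi> x\<close> and continues from \<open>T x\<close>; elsewhere the left side is
      at most 0.\<close>
    have "?m n x - ?m n (T x) \<le> \<phi> x * I n x" for x
    proof (cases "?m n x > 0")
      case True
      then obtain k where k: "n = Suc k" by (cases n) auto
      have "?m n x = \<phi> x + ?m k (T x)" using True unfolding k by (auto simp: max_def split: if_splits)
      also have "\<dots> \<le> \<phi> x + ?m n (T x)" unfolding k using maxsum_mono by (intro add_left_mono)
      finally show ?thesis using True by (simp add: I_def)
    qed (use maxsum_nonneg[where \<phi> = \<phi> and T = T and n = n and x = "T x"] in \<open>auto simp: I_def\<close>)
    then have "(\<integral>x. ?m n x - ?m n (T x) \<partial>M) \<le> (\<integral>x. \<phi> x * I n x \<partial>M)"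
      by (intro integral_mono intI Bochner_Integration.integrable_diff int intT)
    moreover have "(\<integral>x. ?m n x - ?m n (T x) \<partial>M) = 0"
      by (subst Bochner_Integration.integral_diff[OF int intT]) (simp add: eqT)
    ultimately show ?thesis by simp
  qed
  \<comment> \<open>By monotonicity of the maxima the indicators increase to 1 almost everywhere;
    \<phi> itself dominates.\<close>
  have "(\<lambda>n. \<integral>x. \<phi> x * I n x \<partial>M) \<longlonglongrightarrow> (\<integral>x. \<phi> x \<partial>M)"
  proof (rule integral_dominated_convergence[where w = "\<lambda>x. \<bar>\<phi> x\<bar>"])
    show "AE x in M. (\<lambda>n. \<phi> x * I n x) \<longlonglongrightarrow> \<phi> x"
      using pos
    proof eventually_elim
      fix x assume "\<exists>n. (\<Sum>i<n. \<phi> ((T ^^ i) x)) > 0"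
      then obtain n0 where n0: "?m n0 x > 0" using sum_le_maxsum[where \<phi> = \<phi> and T = T and x = x] by (meson less_le_trans)
      have "?m n x > 0" if "n \<ge> n0" for n
        using less_le_trans[OF n0 lift_Suc_mono_le[of "\<lambda>n. ?m n x", OF maxsum_mono that]] .
      then have "eventually (\<lambda>n. \<phi> x * I n x = \<phi> x) sequentially"
        by (auto simp: I_def eventually_sequentially)
      then show "(\<lambda>n. \<phi> x * I n x) \<longlonglongrightarrow> \<phi> x" by (rule tendsto_eventually)
    qed
    show "AE x in M. norm (\<phi> x * I n x) \<le> \<bar>\<phi> x\<bar>" for n by (auto simp: I_def)
  qed (use \<phi>(1) in auto)
  then have "0 \<le> (\<integral>x. \<phi> x \<partial>M)" using ge by (intro LIMSEQ_le_const) auto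
  with \<phi>(2) show False by simp
qed

lemma suminf_indicator_le:
  assumes "0 < (\<kappa>::real)" "0 \<le> x"
  shows "(\<Sum>n. if \<kappa> * real n < x then 1 else 0 :: ennreal) \<le> ennreal (x / \<kappa> + 1)"
proof -
  let ?N = "nat \<lfloor>x / \<kappa>\<rfloor>"
  have "n \<le> ?N" if "\<kappa> * real n < x" for n
  proof -
    have "real n \<le> x / \<kappa>" using that assms by (simp add: field_simps)
    then show ?thesis by (simp add: le_nat_floor)
  qed
  then have "(\<Sum>n. if \<kappa> * real n < x then 1 else 0 :: ennreal) = (\<Sum>n\<le>?N. if \<kappa> * real n < x then 1 else 0)"
    by (intro suminf_finite) auto
  also have "\<dots> \<le> (\<Sum>n\<le>?N. 1)" by (intro sum_mono) auto
  also have "\<dots> = ennreal (real (Suc ?N))" by (simp add: ennreal_of_nat_eq_real_of_nat)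
  also have "\<dots> \<le> ennreal (x / \<kappa> + 1)"
    using assms by (intro ennreal_leI) simp
  finally show ?thesis .
qed

context branching_env
begin

text \<open>Borel-Cantelli: by stationarity the \<open>n\<close>-th probability is that of
  \<open>\<kappa> * n < X\<close>, and these sum up to at most the mean of
  \<open>X / \<kappa> + 1\<close>.\<close>

lemma eventually_sublinear:
  assumes X: "integrable P X" "\<And>\<omega>. 0 \<le> X \<omega>" and \<kappa>: "0 < \<kappa>"
  shows "AE \<omega> in P. \<exists>n0. \<forall>n\<ge>n0. X (env_shift (- int n) \<omega>) \<le> \<kappa> * real n"
proof -
  note borel_measurable_integrable[OF X(1), measurable]
  define A where "A n = {\<omega>\<in>space P. \<kappa> * real n < X (env_shift (- int n) \<omega>)}" for n
  have A[measurable]: "A n \<in> sets P" for n unfolding A_def by measurable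
  have e: "ennreal (P.prob (A n)) = (\<integral>\<^sup>+\<omega>. (if \<kappa> * real n < X \<omega> then 1 else 0) \<partial>P)" for n
  proof -
    have "ennreal (P.prob (A n)) = (\<integral>\<^sup>+\<omega>. indicator (A n) \<omega> \<partial>P)"
      using A by (simp add: P.emeasure_eq_measure)
    also have "\<dots> = (\<integral>\<^sup>+\<omega>. (if \<kappa> * real n < X (env_shift (- int n) \<omega>) then 1 else 0) \<partial>P)"
      by (intro nn_integral_cong) (auto simp: A_def indicator_def)
    also have "\<dots> = (\<integral>\<^sup>+\<omega>. (if \<kappa> * real n < X \<omega> then 1 else 0) \<partial>P)"
      by (rule nn_integral_env_shift[of "\<lambda>\<omega>. if \<kappa> * real n < X \<omega> then 1 else 0"]) measurable
    finally show ?thesis .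
  qed
  have "(\<Sum>n. ennreal (P.prob (A n))) = (\<integral>\<^sup>+\<omega>. (\<Sum>n. if \<kappa> * real n < X \<omega> then 1 else 0) \<partial>P)"
    unfolding e by (rule nn_integral_suminf[symmetric]) measurable
  also have "\<dots> \<le> (\<integral>\<^sup>+\<omega>. ennreal (X \<omega> / \<kappa> + 1) \<partial>P)"
    by (intro nn_integral_mono suminf_indicator_le X(2) \<kappa>)
  also have "\<dots> = ennreal (\<integral>\<omega>. X \<omega> / \<kappa> + 1 \<partial>P)"
    using X \<kappa> by (intro nn_integral_eq_integral) auto
  finally have "(\<Sum>n. ennreal (P.prob (A n))) \<noteq> \<top>" by (auto simp: top_unique)
  then have "summable (\<lambda>n. P.prob (A n))" by (intro summable_suminf_not_top) auto
  then have "AE \<omega> in P. eventually (\<lambda>n. \<omega> \<in> space P - A n) sequentially"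
    by (intro borel_cantelli_AE1) (auto simp: P.emeasure_eq_measure)
  then show ?thesis
    by eventually_elim (force simp: A_def not_less eventually_sequentially)
qed

lemma off_moment_measurable: "(\<lambda>s. off_moment s i j) \<in> borel_measurable S"
  unfolding off_moment_def
  by (rule measurable_compose[OF p_meas nn_integral_measurable_subprob_algebra]) simp

lemma nn_integral_source: "(\<integral>\<^sup>+y. f (y s) \<partial>Q \<omega>) = (\<integral>\<^sup>+v. f v \<partial>source_law \<omega> s)"
  using nn_integral_prod_sources[where K = "{s}" and \<phi> = "\<lambda>_. f" and \<omega> = \<omega>] by simp

lemma source_real_measurable: "(\<lambda>y. real (y s $ j)) \<in> borel_measurable (Q \<omega>)"
  unfolding measurable_cong_sets[OF sets_Q refl]
  by (rule measurable_compose[OF source_measurable]) simp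

lemma imm_mean_eq: "imm_mean q p \<omega> n $ j = enn2real (imm_moment (\<omega> (int n - 1)) j)"
proof -
  have "imm_mean q p \<omega> n $ j = enn2real (\<integral>\<^sup>+y. ennreal (real (y (Imm n) $ j)) \<partial>Q \<omega>)"
    unfolding imm_mean_def using source_real_measurable by (simp add: integral_eq_nn_integral)
  also have "(\<integral>\<^sup>+y. ennreal (real (y (Imm n) $ j)) \<partial>Q \<omega>) = imm_moment (\<omega> (int n - 1)) j"
    by (subst nn_integral_source[where f = "\<lambda>v. ennreal (real (v $ j))"])
      (simp add: source_law_def imm_moment_def ennreal_of_nat_eq_real_of_nat)
  finally show ?thesis .
qed

lemma off_mean_eq: "off_mean q p \<omega> n $ j $ i = enn2real (off_moment (\<omega> (int n)) i j)"
proof -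
  have "off_mean q p \<omega> n $ j $ i = enn2real (\<integral>\<^sup>+y. ennreal (real (y (Off n 1 i) $ j)) \<partial>Q \<omega>)"
    unfolding off_mean_def using source_real_measurable by (simp add: integral_eq_nn_integral)
  also have "(\<integral>\<^sup>+y. ennreal (real (y (Off n 1 i) $ j)) \<partial>Q \<omega>) = off_moment (\<omega> (int n)) i j"
    by (subst nn_integral_source[where f = "\<lambda>v. ennreal (real (v $ j))"])
      (simp add: source_law_def off_moment_def ennreal_of_nat_eq_real_of_nat)
  finally show ?thesis .
qed

lemma integrable_source_iff:
  "integrable (Q \<omega>) (\<lambda>y. real (y s $ j)) \<longleftrightarrow> (\<integral>\<^sup>+v. of_nat (v $ j) \<partial>source_law \<omega> s) < \<infinity>"
proof -
  have "(\<integral>\<^sup>+y. ennreal (norm (real (y s $ j))) \<partial>Q \<omega>) = (\<integral>\<^sup>+v. of_nat (v $ j) \<partial>source_law \<omega> s)"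
    by (subst nn_integral_source[where f = "\<lambda>v. ennreal (norm (real (v $ j)))"])
      (simp add: ennreal_of_nat_eq_real_of_nat)
  then show ?thesis
    using source_real_measurable by (simp add: integrable_iff_bounded)
qed

lemma off_mean_shift: "off_mean q p \<omega> n = off_mean q p (env_shift (int n) \<omega>) 0"
  by (simp add: vec_eq_iff off_mean_eq env_shift_def)

lemma off_mean_prod_measurable: "(\<lambda>\<omega>. off_mean_prod q p \<omega> n $ j $ i) \<in> borel_measurable P"
proof (induction n arbitrary: i j)
  case (Suc n)
  have "(\<lambda>\<omega>. off_mean q p \<omega> n $ j $ i) \<in> borel_measurable P" for i j
    unfolding off_mean_eq
    by (intro measurable_compose[OF measurable_compose[OF coord_measurable off_moment_measurable]]) simp
  with Suc show ?case by (simp add: matrix_matrix_mult_def)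
qed simp

lemma opnorm1_prod_measurable: "(\<lambda>\<omega>. opnorm1 (off_mean_prod q p \<omega> n)) \<in> borel_measurable P"
  by (rule opnorm1_measurable) (rule off_mean_prod_measurable)

lemma off_mean_prod_add:
  "off_mean_prod q p \<omega> (r + s) = off_mean_prod q p (env_shift (int r) \<omega>) s ** off_mean_prod q p \<omega> r"
proof (induction s)
  case (Suc s)
  have "off_mean q p \<omega> (r + s) = off_mean q p (env_shift (int r) \<omega>) s"
    unfolding off_mean_shift[of \<omega>] off_mean_shift[of "env_shift (int r) \<omega>"] by (simp add: add.commute)
  then show ?case by (simp add: Suc matrix_mul_assoc)
qed (simp add: matrix_mul_lid)

text \<open>With finite moments the recursion in [0,\<infinity>] is the real matrix recursion.
  Nonnegativity is part of the induction because \<open>ennreal\<close> is multiplicative only on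
  nonnegative reals.\<close>

lemma lineage_mean_eq:
  assumes "\<And>j. imm_moment (\<omega> (-1)) j < \<infinity>" "\<And>k i j. off_moment (\<omega> k) i j < \<infinity>"
  shows "lineage_mean n \<omega> j = ennreal ((off_mean_prod q p \<omega> n *v imm_mean q p \<omega> 0) $ j) \<and>
    0 \<le> (off_mean_prod q p \<omega> n *v imm_mean q p \<omega> 0) $ j"
proof (induction n arbitrary: j)
  case 0
  then show ?case using assms(1) by (simp add: imm_mean_eq)
next
  case (Suc n)
  let ?v = "off_mean_prod q p \<omega> n *v imm_mean q p \<omega> 0"
  have v: "off_mean_prod q p \<omega> (Suc n) *v imm_mean q p \<omega> 0 = off_mean q p \<omega> n *v ?v"
    by (simp add: matrix_vector_mul_assoc)
  have c: "(off_mean q p \<omega> n *v ?v) $ j = (\<Sum>i\<in>UNIV. enn2real (off_moment (\<omega> (int n)) i j) * ?v $ i)"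
    by (simp add: matrix_vector_mult_def off_mean_eq)
  have "lineage_mean (Suc n) \<omega> j = (\<Sum>i\<in>UNIV. ennreal (?v $ i) * ennreal (enn2real (off_moment (\<omega> (int n)) i j)))"
    using Suc assms(2) by simp
  also have "\<dots> = (\<Sum>i\<in>UNIV. ennreal (enn2real (off_moment (\<omega> (int n)) i j) * ?v $ i))"
    using Suc by (intro sum.cong refl) (simp add: ennreal_mult mult.commute)
  also have "\<dots> = ennreal (\<Sum>i\<in>UNIV. enn2real (off_moment (\<omega> (int n)) i j) * ?v $ i)"
    using Suc by (intro sum_ennreal) auto
  finally show ?case unfolding v c using Suc by (auto intro!: sum_nonneg)
qed

lemma sum_lineage_mean:
  assumes "\<And>j. imm_moment (\<omega> (-1)) j < \<infinity>" "\<And>k i j. off_moment (\<omega> k) i j < \<infinity>"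
  shows "(\<Sum>j\<in>UNIV. lineage_mean n \<omega> j) = ennreal (norm1 (off_mean_prod q p \<omega> n *v imm_mean q p \<omega> 0))"
proof -
  have l: "lineage_mean n \<omega> j = ennreal ((off_mean_prod q p \<omega> n *v imm_mean q p \<omega> 0) $ j) \<and>
    0 \<le> (off_mean_prod q p \<omega> n *v imm_mean q p \<omega> 0) $ j" for j
    using assms by (rule lineage_mean_eq)
  have "(\<Sum>j\<in>UNIV. lineage_mean n \<omega> j) = (\<Sum>j\<in>UNIV. ennreal ((off_mean_prod q p \<omega> n *v imm_mean q p \<omega> 0) $ j))"
    using l by simp
  also have "\<dots> = ennreal (\<Sum>j\<in>UNIV. (off_mean_prod q p \<omega> n *v imm_mean q p \<omega> 0) $ j)"
    using l by (intro sum_ennreal) auto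
  finally show ?thesis unfolding norm1_def using l by simp
qed

text \<open>A negative limit provides one block length \<open>L\<close> with negative mean
  logarithm. That mean may be -\<infinity>, so the negative part is cut at a level \<open>K\<close>
  for which the mean stays negative; this gives an integrable bound \<open>lam\<close> of the
  logarithm.\<close>

lemma cond_A3_block:
  assumes "cond_A3 P q p"
  obtains L lam where "0 < L" "integrable P lam" "(\<integral>\<omega>. lam \<omega> \<partial>P) < 0"
    "\<And>\<omega>. opnorm1 (off_mean_prod q p \<omega> L) \<le> exp (lam \<omega>)"
proof -
  let ?o = "\<lambda>n \<omega>. opnorm1 (off_mean_prod q p \<omega> n)"
  obtain l where l: "l < 0" "(\<lambda>n. eexpectation P (\<lambda>\<omega>. elog (?o n \<omega>)) / ereal (real n)) \<longlonglongrightarrow> l"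
    using assms unfolding cond_A3_def by blast
  have "eventually (\<lambda>n. eexpectation P (\<lambda>\<omega>. elog (?o n \<omega>)) / ereal (real n) < 0) sequentially"
    using l by (intro order_tendstoD(2))
  then have "eventually (\<lambda>n. eexpectation P (\<lambda>\<omega>. elog (?o n \<omega>)) / ereal (real n) < 0 \<and> 0 < n) sequentially"
    using eventually_gt_at_top[of 0] by eventually_elim simp
  then obtain L where L: "eexpectation P (\<lambda>\<omega>. elog (?o L \<omega>)) / ereal (real L) < 0" "0 < L"
    by (auto simp: eventually_sequentially)
  have neg: "eexpectation P (\<lambda>\<omega>. elog (?o L \<omega>)) < 0"
  proof (rule ccontr)
    assume "\<not> ?thesis"
    then have "0 \<le> eexpectation P (\<lambda>\<omega>. elog (?o L \<omega>)) / ereal (real L)"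
      using L(2) by (intro zero_le_divide_ereal) auto
    with L(1) show False by simp
  qed
  define o' where "o' = ?o L"
  have om[measurable]: "o' \<in> borel_measurable P" unfolding o'_def by (rule opnorm1_prod_measurable)
  have o0: "0 \<le> o' \<omega>" for \<omega> by (simp add: o'_def opnorm1_nonneg)
  define pos where "pos \<omega> = log_plus (o' \<omega>)" for \<omega>
  \<comment> \<open>Negative part of the logarithm cut at \<open>K\<close>; where the norm is 0 the
    logarithm is -\<infinity> and the cut value is \<open>K\<close>.\<close>
  define ng where "ng K \<omega> = (if o' \<omega> \<le> 0 then real K else min (real K) (max 0 (- ln (o' \<omega>))))" for K \<omega>
  have [measurable]: "pos \<in> borel_measurable P" "ng K \<in> borel_measurable P" for K
    unfolding pos_def ng_def log_plus_def by measurable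
  have ng0: "0 \<le> ng K \<omega>" "ng K \<omega> \<le> real K" for K \<omega> by (auto simp: ng_def)
  have pos_e: "e2ennreal (elog (o' \<omega>)) = ennreal (pos \<omega>)" for \<omega>
    by (auto simp: elog_def pos_def log_plus_def e2ennreal_neg max_def ennreal.abs_eq[symmetric] e2ennreal_ereal ennreal_neg)
  have neg_e: "e2ennreal (- elog (o' \<omega>)) = (SUP K. ennreal (ng K \<omega>))" for \<omega>
  proof (cases "o' \<omega> \<le> 0")
    case True
    then show ?thesis by (simp add: elog_def ng_def ennreal_SUP_of_nat_eq_top ennreal_of_nat_eq_real_of_nat[symmetric] e2ennreal_infty)
  next
    case False
    let ?x = "max 0 (- ln (o' \<omega>))"
    obtain K0 where "?x \<le> real K0" using real_arch_simple by blast
    have "(SUP K. ennreal (ng K \<omega>)) = ennreal ?x"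
    proof (rule antisym)
      show "(SUP K. ennreal (ng K \<omega>)) \<le> ennreal ?x"
        using False by (intro SUP_least ennreal_leI) (auto simp: ng_def)
      have "ennreal ?x = ennreal (ng K0 \<omega>)" using False \<open>?x \<le> real K0\<close>
        by (simp add: ng_def min_absorb2)
      also have "\<dots> \<le> (SUP K. ennreal (ng K \<omega>))" by (rule SUP_upper) simp
      finally show "ennreal ?x \<le> (SUP K. ennreal (ng K \<omega>))" .
    qed
    with False show ?thesis by (simp add: elog_def e2ennreal_ereal max_def ennreal_neg)
  qed
  \<comment> \<open>In \<open>ereal\<close>, \<infinity> - \<infinity> is \<infinity> and hence not
    negative; so a negative mean also forces the positive part to be finite, as strictness
    records.\<close>
  have lt: "(\<integral>\<^sup>+\<omega>. ennreal (pos \<omega>) \<partial>P) < (\<integral>\<^sup>+\<omega>. (SUP K. ennreal (ng K \<omega>)) \<partial>P)"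
  proof (rule ccontr)
    assume "\<not> ?thesis"
    then have "0 \<le> eexpectation P (\<lambda>\<omega>. elog (o' \<omega>))"
      unfolding eexpectation_def pos_e neg_e not_less
      by (intro ereal_diff_positive) (simp add: less_eq_ennreal.rep_eq)
    with neg show False by (simp add: o'_def)
  qed
  also have "(\<integral>\<^sup>+\<omega>. (SUP K. ennreal (ng K \<omega>)) \<partial>P) = (SUP K. \<integral>\<^sup>+\<omega>. ennreal (ng K \<omega>) \<partial>P)"
    by (rule nn_integral_monotone_convergence_SUP) (auto simp: incseq_def le_fun_def ng_def intro!: ennreal_leI)
  finally obtain K where K: "(\<integral>\<^sup>+\<omega>. ennreal (pos \<omega>) \<partial>P) < (\<integral>\<^sup>+\<omega>. ennreal (ng K \<omega>) \<partial>P)"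
    by (auto simp: less_SUP_iff)
  have pos0: "0 \<le> pos \<omega>" for \<omega> by (simp add: pos_def log_plus_nonneg)
  have ip: "integrable P pos"
    using K pos0 by (intro integrableI_nonneg) (auto simp: less_top[symmetric] dest: less_le_trans)
  have "integrable P (ng K)"
    by (rule P.integrable_const_bound[of _ "real K"]) (use ng0 in auto)
  define lam where "lam \<omega> = pos \<omega> - ng K \<omega>" for \<omega>
  show thesis
  proof (rule that[OF L(2)])
    show "integrable P lam" unfolding lam_def using ip \<open>integrable P (ng K)\<close> by simp
    have "(\<integral>\<omega>. pos \<omega> \<partial>P) < (\<integral>\<omega>. ng K \<omega> \<partial>P)"
      using K pos0 ng0 by (simp add: nn_integral_eq_integral ip \<open>integrable P (ng K)\<close> ennreal_less_iff)
    then show "(\<integral>\<omega>. lam \<omega> \<partial>P) < 0" unfolding lam_def using ip \<open>integrable P (ng K)\<close> by simp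
    fix \<omega>
    show "?o L \<omega> \<le> exp (lam \<omega>)"
    proof (cases "o' \<omega> \<le> 0")
      case True
      then show ?thesis unfolding o'_def using order_trans[OF True[unfolded o'_def] exp_ge_zero] by blast
    next
      case False
      then have "ln (o' \<omega>) \<le> lam \<omega>" by (auto simp: lam_def pos_def log_plus_def ng_def)
      then have "exp (ln (o' \<omega>)) \<le> exp (lam \<omega>)" by (simp only: exp_le_cancel_iff)
      moreover have "exp (ln (o' \<omega>)) = o' \<omega>" using False by (intro exp_ln) simp
      ultimately show ?thesis unfolding o'_def by argo
    qed
  qed
qed

end

section \<open>Zeros of the process started in the infinite past\<close>

lemma sum_disjoint_le:
  assumes "finite K" "\<And>k. k \<in> K \<Longrightarrow> R k \<Longrightarrow> C" "\<And>k k'. k \<in> K \<Longrightarrow> k' \<in> K \<Longrightarrow> R k \<Longrightarrow> R k' \<Longrightarrow> k = k'"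
  shows "(\<Sum>k\<in>K. if R k then 1 else 0 :: ennreal) \<le> (if C then 1 else 0)"
proof (cases "\<exists>k\<in>K. R k")
  case True
  then obtain k where k: "k \<in> K" "R k" by blast
  have "(\<Sum>k\<in>K. if R k then 1 else 0 :: ennreal) = (\<Sum>j\<in>{k}. if R j then 1 else 0)"
    using assms(1,3) k by (intro sum.mono_neutral_right) auto
  then show ?thesis using assms(2) k by simp
qed simp

context branching_env
begin

text \<open>The infimum is a decreasing limit by \<open>zero_prob_shift\<close>; it is the quenched probability that
  the process started in the infinite past is at \<open>0\<close> at time \<open>0\<close>.\<close>

definition past_zero_prob :: "(int \<Rightarrow> 's) \<Rightarrow> ennreal" where
  "past_zero_prob \<omega> = (INF n. zero_prob n (env_shift (- int n) \<omega>))"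

lemma zero_prob_antimono:
  assumes "m \<le> n"
  shows "zero_prob n (env_shift (- int n) \<omega>) \<le> zero_prob m (env_shift (- int m) \<omega>)"
proof -
  have "(\<Prod>j=1..n. lineage_zero_prob j (env_shift (- int j) \<omega>)) \<le> (\<Prod>j=1..m. lineage_zero_prob j (env_shift (- int j) \<omega>))"
    using assms
  proof (induction n rule: dec_induct)
    case (step n)
    have "(\<Prod>j=1..Suc n. lineage_zero_prob j (env_shift (- int j) \<omega>)) \<le> (\<Prod>j=1..n. lineage_zero_prob j (env_shift (- int j) \<omega>)) * 1"
      unfolding prod.nat_ivl_Suc'[OF le_add1[of 1, unfolded plus_1_eq_Suc]]
      by (subst mult.commute) (intro mult_left_mono lineage_zero_prob_le_1, simp)
    with step.IH show ?case by simp
  qed simp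
  then show ?thesis by (simp only: zero_prob_shift)
qed

lemma past_zero_prob_le: "past_zero_prob \<omega> \<le> zero_prob n (env_shift (- int n) \<omega>)"
  unfolding past_zero_prob_def by (rule INF_lower) simp

lemma past_zero_prob_le_1: "past_zero_prob \<omega> \<le> 1"
  using past_zero_prob_le[of \<omega> 0] by (simp add: zero_prob_eq_prod)

lemma past_zero_prob_measurable[measurable]: "past_zero_prob \<in> borel_measurable P"
  unfolding past_zero_prob_def[abs_def] by measurable

lemma zero_prob_dep: "env_dep {..<int n} (zero_prob n)"
  unfolding zero_prob_def
proof (rule env_depI, rule nn_integral_past_cong[where k = n])
  show "(\<lambda>y. if popul y n = 0 then 1 else 0 :: ennreal) \<in> borel_measurable sourceM"
    by (rule measurable_compose[OF popul_measurable]) simp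
qed (auto simp: past_sources_def popul_restrict)

text \<open>This makes the tilting weight admissible in \<open>osc\<close>.\<close>

lemma past_zero_prob_dep: "env_dep {..<0} past_zero_prob"
proof (rule env_depI)
  fix \<omega> \<omega>' assume w: "\<omega> \<in> space P" "\<omega>' \<in> space P" "\<And>i. i \<in> {..<0} \<Longrightarrow> \<omega> i = \<omega>' i"
  have "zero_prob n (env_shift (- int n) \<omega>) = zero_prob n (env_shift (- int n) \<omega>')" for n
  proof (rule env_depD[OF zero_prob_dep])
    show "env_shift (- int n) \<omega> i = env_shift (- int n) \<omega>' i" if "i \<in> {..<int n}" for i
      unfolding env_shift_def using that by (intro w(3)) simp
  qed (use w in auto)
  then show "past_zero_prob \<omega> = past_zero_prob \<omega>'" by (simp add: past_zero_prob_def)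
qed

lemma popul_eq_0_measurable: "(\<lambda>y. if popul y n = 0 then 1 else 0 :: ennreal) \<in> borel_measurable sourceM"
  by (rule measurable_compose[OF popul_measurable]) simp

lemma zero_prob_times:
  assumes "H \<in> borel_measurable sourceM"
  shows "zero_prob k \<omega> * (\<integral>\<^sup>+y. H y \<partial>Q (env_shift (int k) \<omega>)) =
    (\<integral>\<^sup>+y. (if popul y k = 0 then 1 else 0) * H (y \<circ> shift_source k) \<partial>Q \<omega>)"
  unfolding zero_prob_def
  by (rule nn_integral_indep[symmetric])
    (auto simp: past_sources_def popul_restrict popul_eq_0_measurable assms)

lemma nu_1_iff: "nu z 1 = enat k \<longleftrightarrow> 0 < k \<and> z k = 0 \<and> (\<forall>i. 0 < i \<and> i < k \<longrightarrow> z i \<noteq> 0)"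
  unfolding One_nat_def nu_Suc_enat by (auto simp: zero_enat_def)

text \<open>Decomposition of a zero at \<open>n\<close> by the last zero before it, at
  \<open>n - k\<close>: these events are disjoint, and each consists of a zero followed by a first
  return after \<open>k\<close> steps.\<close>

lemma zero_prob_renewal_le:
  "(\<Sum>k=1..n. zero_prob (n - k) \<omega> * return_prob 1 k (env_shift (int (n - k)) \<omega>)) \<le> zero_prob n \<omega>"
proof -
  define R where "R y k \<longleftrightarrow> popul y (n - k) = 0 \<and> popul y n = 0 \<and> (\<forall>i. n - k < i \<and> i < n \<longrightarrow> popul y i \<noteq> 0)"
    for y :: "'d source \<Rightarrow> nat ^ 'd" and k
  have m: "(\<lambda>y. if nu (popul y) 1 = enat k then 1 else 0 :: ennreal) \<in> borel_measurable sourceM" for k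
    by measurable
  have eq: "(if popul y (n - k) = 0 then 1 else 0) * (if nu (popul (y \<circ> shift_source (n - k))) 1 = enat k then 1 else 0)
      = (if R y k then 1 else 0 :: ennreal)" if k: "k \<in> {1..n}" for y k
  proof (cases "popul y (n - k) = 0")
    case True
    have s: "popul (y \<circ> shift_source (n - k)) i = popul y (n - k + i)" for i
      by (rule popul_shift[OF True, symmetric])
    have "(\<forall>i. 0 < i \<and> i < k \<longrightarrow> popul y (n - k + i) \<noteq> 0) \<longleftrightarrow> (\<forall>i. n - k < i \<and> i < n \<longrightarrow> popul y i \<noteq> 0)"
    proof safe
      fix i assume *: "\<forall>i. 0 < i \<and> i < k \<longrightarrow> popul y (n - k + i) \<noteq> 0" "n - k < i" "i < n" "popul y i = 0"
      have "0 < i - (n - k)" "i - (n - k) < k" "n - k + (i - (n - k)) = i" using *(2,3) k by auto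
      with *(1,4) show False by metis
    next
      fix i assume *: "\<forall>i. n - k < i \<and> i < n \<longrightarrow> popul y i \<noteq> 0" "0 < i" "i < k" "popul y (n - k + i) = 0"
      have "n - k < n - k + i" "n - k + i < n" using *(2,3) k by auto
      with *(1,4) show False by blast
    qed
    then show ?thesis using True k unfolding R_def nu_1_iff s by auto
  qed (simp add: R_def)
  have "(\<Sum>k=1..n. zero_prob (n - k) \<omega> * return_prob 1 k (env_shift (int (n - k)) \<omega>)) =
      (\<Sum>k=1..n. \<integral>\<^sup>+y. (if R y k then 1 else 0) \<partial>Q \<omega>)"
    unfolding return_prob_def by (intro sum.cong refl, subst zero_prob_times[OF m]) (simp only: eq)
  also have "\<dots> = (\<integral>\<^sup>+y. (\<Sum>k=1..n. if R y k then 1 else 0) \<partial>Q \<omega>)"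
  proof (rule nn_integral_sum[symmetric])
    fix k assume "k \<in> {1..n}"
    have "(\<lambda>y. if R y k then 1 else 0 :: ennreal) \<in> borel_measurable sourceM"
    proof -
      have [measurable]: "Measurable.pred sourceM (\<lambda>y :: 'd source \<Rightarrow> nat ^ 'd. popul y i = 0)" for i
        by (rule measurable_compose[OF popul_measurable]) simp
      have "Measurable.pred sourceM (\<lambda>y. R y k)" unfolding R_def by measurable
      then show ?thesis by (intro measurable_If) (auto simp: pred_def)
    qed
    then show "(\<lambda>y. if R y k then 1 else 0 :: ennreal) \<in> borel_measurable (Q \<omega>)"
      by (simp add: measurable_cong_sets[OF sets_Q refl])
  qed
  also have "\<dots> \<le> (\<integral>\<^sup>+y. (if popul y n = 0 then 1 else 0) \<partial>Q \<omega>)"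
  proof (rule nn_integral_mono, rule sum_disjoint_le)
    fix y k k' assume k: "k \<in> {1..n}" "k' \<in> {1..n}" "R y k" "R y k'"
    show "k = k'"
    proof (rule ccontr)
      assume "k \<noteq> k'"
      then have "n - k < n - k' \<and> n - k' < n \<or> n - k' < n - k \<and> n - k < n" using k(1,2) by auto
      with k(3,4) show False unfolding R_def by blast
    qed
  qed (auto simp: R_def)
  finally show ?thesis unfolding zero_prob_def .
qed

text \<open>Each partial sum is compared with a process started far enough in the past. Only an
  inequality survives the limit, as mass might be lost to pasts without zeros; equality follows
  later by integration.\<close>

lemma past_zero_prob_renewal_le: "(\<Sum>k. past_zero_prob (env_shift (- int k) \<omega>) * return_prob 1 k (env_shift (- int k) \<omega>)) \<le> past_zero_prob \<omega>"
proof -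
  have part: "(\<Sum>k=1..K. past_zero_prob (env_shift (- int k) \<omega>) * return_prob 1 k (env_shift (- int k) \<omega>)) \<le> past_zero_prob \<omega>" for K
    unfolding past_zero_prob_def[of \<omega>]
  proof (rule INF_greatest)
    fix n
    \<comment> \<open>The start lies at least \<open>K\<close> back, so that all \<open>K\<close>
      terms occur, and at least \<open>n\<close> back, so that antitonicity ends at the bound for
      \<open>n\<close>.\<close>
    let ?n = "max n K" and ?\<omega> = "env_shift (- int (max n K)) \<omega>"
    have "(\<Sum>k=1..K. past_zero_prob (env_shift (- int k) \<omega>) * return_prob 1 k (env_shift (- int k) \<omega>)) \<le>
        (\<Sum>k=1..K. zero_prob (?n - k) ?\<omega> * return_prob 1 k (env_shift (int (?n - k)) ?\<omega>))"
    proof (rule sum_mono)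
      fix k assume "k \<in> {1..K}"
      then have k: "k \<le> ?n" by (simp add: le_max_iff_disj)
      have e1: "env_shift (int (?n - k)) ?\<omega> = env_shift (- int k) \<omega>" using k by (simp add: of_nat_diff)
      have e2: "env_shift (- int (?n - k)) (env_shift (- int k) \<omega>) = ?\<omega>" using k by (simp add: of_nat_diff)
      show "past_zero_prob (env_shift (- int k) \<omega>) * return_prob 1 k (env_shift (- int k) \<omega>) \<le>
          zero_prob (?n - k) ?\<omega> * return_prob 1 k (env_shift (int (?n - k)) ?\<omega>)"
        unfolding e1 using past_zero_prob_le[of "env_shift (- int k) \<omega>" "?n - k"] unfolding e2
        by (rule mult_right_mono) simp
    qed
    also have "\<dots> \<le> (\<Sum>k=1..?n. zero_prob (?n - k) ?\<omega> * return_prob 1 k (env_shift (int (?n - k)) ?\<omega>))"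
      by (rule sum_mono2) auto
    also have "\<dots> \<le> zero_prob ?n ?\<omega>" by (rule zero_prob_renewal_le)
    also have "\<dots> \<le> zero_prob n (env_shift (- int n) \<omega>)" by (rule zero_prob_antimono) simp
    finally show "(\<Sum>k=1..K. past_zero_prob (env_shift (- int k) \<omega>) * return_prob 1 k (env_shift (- int k) \<omega>)) \<le>
      zero_prob n (env_shift (- int n) \<omega>)" .
  qed
  \<comment> \<open>A return takes at least one step, so summing from 0 or from 1 is the
    same.\<close>
  have "return_prob 1 0 \<omega>' = 0" for \<omega>' by (simp add: return_prob_def nu_1_iff del: One_nat_def)
  then have "(\<Sum>k<K. past_zero_prob (env_shift (- int k) \<omega>) * return_prob 1 k (env_shift (- int k) \<omega>)) \<le>
      (\<Sum>k=1..K. past_zero_prob (env_shift (- int k) \<omega>) * return_prob 1 k (env_shift (- int k) \<omega>))" for K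
  proof -
    let ?f = "\<lambda>k. past_zero_prob (env_shift (- int k) \<omega>) * return_prob 1 k (env_shift (- int k) \<omega>)"
    have "?f 0 = 0" using \<open>\<And>\<omega>'. return_prob 1 0 \<omega>' = 0\<close> by simp
    then have "sum ?f {..<K} = sum ?f ({..<K} - {0})" by (intro sum.mono_neutral_right) auto
    also have "\<dots> \<le> sum ?f {1..K}" by (rule sum_mono2) auto
    finally show ?thesis .
  qed
  then have "(\<Sum>k<K. past_zero_prob (env_shift (- int k) \<omega>) * return_prob 1 k (env_shift (- int k) \<omega>)) \<le> past_zero_prob \<omega>" for K
    using part order_trans by blast
  then show ?thesis unfolding suminf_eq_SUP by (rule SUP_least)
qed

lemma past_zero_prob_step: "past_zero_prob \<omega> * return_prob 1 1 \<omega> \<le> past_zero_prob (env_shift 1 \<omega>)"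
proof -
  have "(\<Sum>k\<in>{1}. past_zero_prob (env_shift (- int k) (env_shift 1 \<omega>)) * return_prob 1 k (env_shift (- int k) (env_shift 1 \<omega>)))
      \<le> (\<Sum>k. past_zero_prob (env_shift (- int k) (env_shift 1 \<omega>)) * return_prob 1 k (env_shift (- int k) (env_shift 1 \<omega>)))"
    by (rule sum_le_suminf) auto
  also have "\<dots> \<le> past_zero_prob (env_shift 1 \<omega>)" by (rule past_zero_prob_renewal_le)
  finally show ?thesis by simp
qed

section \<open>Last zeros and recurrence\<close>

definition escape :: "(int \<Rightarrow> 's) \<Rightarrow> ennreal" where
  "escape \<omega> = (\<integral>\<^sup>+y. (if nu (popul y) 1 = \<infinity> then 1 else 0) \<partial>Q \<omega>)"

lemma nu_infinity_measurable: "(\<lambda>y. if nu (popul y) m = \<infinity> then 1 else 0 :: ennreal) \<in> borel_measurable sourceM"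
  by (rule measurable_compose[OF nu_popul_measurable]) simp

lemma escape_measurable[measurable]: "escape \<in> borel_measurable P"
  unfolding escape_def[abs_def] by (rule nn_integral_Q_measurable1) (rule nu_infinity_measurable)

text \<open>The \<open>k\<close>-th term is the probability that \<open>k\<close> is the last zero,
  and there is at most one last zero.\<close>

lemma escape_sum_le: "(\<Sum>k<n. zero_prob k \<omega> * escape (env_shift (int k) \<omega>)) \<le> 1"
proof -
  define R where "R y k \<longleftrightarrow> popul y k = 0 \<and> nu (popul (y \<circ> shift_source k)) 1 = \<infinity>"
    for y :: "'d source \<Rightarrow> nat ^ 'd" and k
  have R: "\<not> R y k'" if "R y k" "k < k'" for y k k'
  proof
    assume R': "R y k'"
    have p: "popul y k = 0" and inf: "nu (popul (y \<circ> shift_source k)) 1 = \<infinity>" using that(1) by (auto simp: R_def)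
    have "popul (y \<circ> shift_source k) (k' - k) = 0"
      using popul_shift[OF p, of "k' - k"] R' that(2) by (simp add: R_def)
    then have "{i. 0 < i \<and> popul (y \<circ> shift_source k) i = 0} \<noteq> {}" using that(2) by (auto intro!: exI[of _ "k' - k"])
    then have "\<exists>j. nu (popul (y \<circ> shift_source k)) 1 = enat j"
      unfolding nu_1_iff
      by (intro exI[of _ "LEAST i. 0 < i \<and> popul (y \<circ> shift_source k) i = 0"])
        (auto dest: not_less_Least intro: LeastI2)
    with inf show False by simp
  qed
  have "(\<Sum>k<n. zero_prob k \<omega> * escape (env_shift (int k) \<omega>)) = (\<Sum>k<n. \<integral>\<^sup>+y. (if R y k then 1 else 0) \<partial>Q \<omega>)"
    unfolding escape_def R_def
    by (intro sum.cong refl, subst zero_prob_times[OF nu_infinity_measurable]) (auto intro!: nn_integral_cong)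
  also have "\<dots> = (\<integral>\<^sup>+y. (\<Sum>k<n. if R y k then 1 else 0) \<partial>Q \<omega>)"
  proof (rule nn_integral_sum[symmetric])
    fix k assume "k \<in> {..<n}"
    have "(\<lambda>y. (if popul y k = 0 then 1 else 0) * (if nu (popul (y \<circ> shift_source k)) 1 = \<infinity> then 1 else 0) :: ennreal)
        \<in> borel_measurable sourceM"
      by (intro borel_measurable_times_ennreal popul_eq_0_measurable
          measurable_compose[OF shift_source_measurable nu_infinity_measurable])
    also have "(\<lambda>y. (if popul y k = 0 then 1 else 0) * (if nu (popul (y \<circ> shift_source k)) 1 = \<infinity> then 1 else 0) :: ennreal)
        = (\<lambda>y. if R y k then 1 else 0)"
      by (auto simp: R_def fun_eq_iff)
    finally show "(\<lambda>y. if R y k then 1 else 0 :: ennreal) \<in> borel_measurable (Q \<omega>)"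
      by (simp add: measurable_cong_sets[OF sets_Q refl])
  qed
  also have "\<dots> \<le> (\<integral>\<^sup>+y. (if True then 1 else 0) \<partial>Q \<omega>)"
    by (rule nn_integral_mono, rule sum_disjoint_le) (use R in \<open>auto, metis nat_neq_iff\<close>)
  also have "\<dots> = 1" using Q.emeasure_space_1[of \<omega>] by simp
  finally show ?thesis .
qed

text \<open>Replacing the weight by the larger \<open>zero_prob k\<close> and shifting by
  \<open>k\<close>, its mean product with \<open>escape\<close> is at most the annealed probability
  that \<open>k\<close> is the last zero. So \<open>n\<close> copies of one number sum to at most 1
  for every \<open>n\<close>.\<close>

lemma past_zero_prob_escape: "AE \<omega> in P. past_zero_prob \<omega> * escape \<omega> = 0"
proof -
  let ?I = "\<integral>\<^sup>+\<omega>. past_zero_prob \<omega> * escape \<omega> \<partial>P"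
  have "of_nat n * ?I \<le> 1" for n
  proof -
    have "of_nat n * ?I = (\<Sum>k<n. ?I)" by simp
    also have "\<dots> \<le> (\<Sum>k<n. \<integral>\<^sup>+\<omega>. zero_prob k (env_shift (- int k) \<omega>) * escape \<omega> \<partial>P)"
      by (intro sum_mono nn_integral_mono mult_right_mono past_zero_prob_le) simp
    also have "\<dots> = (\<Sum>k<n. \<integral>\<^sup>+\<omega>. zero_prob k \<omega> * escape (env_shift (int k) \<omega>) \<partial>P)"
    proof (rule sum.cong[OF refl])
      fix k
      show "(\<integral>\<^sup>+\<omega>. zero_prob k (env_shift (- int k) \<omega>) * escape \<omega> \<partial>P) =
          (\<integral>\<^sup>+\<omega>. zero_prob k \<omega> * escape (env_shift (int k) \<omega>) \<partial>P)"
        using nn_integral_env_shift[of "\<lambda>\<omega>. zero_prob k (env_shift (- int k) \<omega>) * escape \<omega>" "int k"] by simp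
    qed
    also have "\<dots> = (\<integral>\<^sup>+\<omega>. (\<Sum>k<n. zero_prob k \<omega> * escape (env_shift (int k) \<omega>)) \<partial>P)"
      by (rule nn_integral_sum[symmetric]) measurable
    also have "\<dots> \<le> (\<integral>\<^sup>+\<omega>. 1 \<partial>P)" by (intro nn_integral_mono escape_sum_le)
    finally show ?thesis using P.emeasure_space_1 by simp
  qed
  then have "?I = 0"
  proof (cases ?I)
    case (real r)
    have "real n * r \<le> 1" for n
      using \<open>of_nat n * ?I \<le> 1\<close> real by (simp add: ennreal_of_nat_eq_real_of_nat ennreal_mult[symmetric] ennreal_le_1)
    moreover obtain n :: nat where "1 < real n * r" if "0 < r" using reals_Archimedean3[of r] by auto
    ultimately have "r \<le> 0" by (meson not_less)
    with real show ?thesis by simp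
  next
    case top
    then show ?thesis using \<open>of_nat 1 * ?I \<le> 1\<close> by (simp add: top_unique)
  qed
  then show ?thesis by (subst (asm) nn_integral_0_iff_AE) measurable
qed

end

locale subcritical_env = branching_env S P q p
  for S :: "'s measure"
    and P :: "(int \<Rightarrow> 's) measure"
    and q :: "'s \<Rightarrow> (nat ^ 'd::finite) pmf"
    and p :: "'d \<Rightarrow> 's \<Rightarrow> (nat ^ 'd) pmf" +
  fixes \<delta> :: real
  assumes \<delta>_pos: "0 < \<delta>"
    and return_prob_lower: "AE \<omega> in P. ennreal \<delta> \<le> return_prob 1 1 \<omega>"
    and q_0_pos: "AE \<omega> in P. pmf (q (\<omega> (-1))) 0 > 0"
    and ergodic: "ergodic_env P"
    and A1: "cond_A1 P q p" and A2: "cond_A2 P q p" and A3: "cond_A3 P q p"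
begin

lemma finite_moments:
  "AE \<omega> in P. \<forall>k. (\<forall>j. imm_moment (\<omega> k) j < \<infinity>) \<and> (\<forall>i j. off_moment (\<omega> k) i j < \<infinity>)"
proof -
  have "AE \<omega> in P. \<forall>j. integrable (Q \<omega>) (\<lambda>y. real (y (Imm 0) $ j))"
    "AE \<omega> in P. \<forall>i j. integrable (Q \<omega>) (\<lambda>y. real (y (Off 0 1 i) $ j))"
    using A1 A2 by (auto simp: cond_A1_def cond_A2_def)
  then have "AE \<omega> in P. \<forall>j. imm_moment (\<omega> (-1)) j < \<infinity>" "AE \<omega> in P. \<forall>i j. off_moment (\<omega> 0) i j < \<infinity>"
    unfolding integrable_source_iff by (simp_all add: source_law_def imm_moment_def off_moment_def)
  from AE_env_shift[OF this(1)] AE_env_shift[OF this(2)] show ?thesis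
  proof eventually_elim
    fix \<omega> assume *: "\<forall>k. \<forall>j. imm_moment (env_shift k \<omega> (-1)) j < \<infinity>"
      "\<forall>k. \<forall>i j. off_moment (env_shift k \<omega> 0) i j < \<infinity>"
    show "\<forall>k. (\<forall>j. imm_moment (\<omega> k) j < \<infinity>) \<and> (\<forall>i j. off_moment (\<omega> k) i j < \<infinity>)"
    proof
      fix k show "(\<forall>j. imm_moment (\<omega> k) j < \<infinity>) \<and> (\<forall>i j. off_moment (\<omega> k) i j < \<infinity>)"
        using *(1)[rule_format, of "k + 1"] *(2)[rule_format, of k] by (simp add: env_shift_def)
    qed
  qed
qed

text \<open>Quenched mean total number of descendants at time 0 of the immigrants arriving at time
  \<open>-n\<close>.\<close>

definition past_mean :: "(int \<Rightarrow> 's) \<Rightarrow> nat \<Rightarrow> real" where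
  "past_mean \<omega> n = norm1 (off_mean_prod q p (env_shift (- int n) \<omega>) n *v imm_mean q p (env_shift (- int n) \<omega>) 0)"

lemma opnorm1_prod_le:
  assumes "\<And>i. i < r \<Longrightarrow> log_plus (opnorm1 (off_mean q p \<omega> i)) \<le> c"
  shows "opnorm1 (off_mean_prod q p \<omega> r) \<le> exp (c * real r)"
  using assms
proof (induction r)
  case (Suc r)
  have "opnorm1 (off_mean_prod q p \<omega> (Suc r)) \<le> opnorm1 (off_mean q p \<omega> r) * opnorm1 (off_mean_prod q p \<omega> r)"
    by (simp add: opnorm1_mult_le)
  also have "\<dots> \<le> exp c * exp (c * real r)"
  proof (intro mult_mono opnorm1_nonneg)
    show "opnorm1 (off_mean q p \<omega> r) \<le> exp c"
      using le_exp_log_plus[of "opnorm1 (off_mean q p \<omega> r)"] Suc.prems[of r] by (smt (verit) exp_le_cancel_iff lessI)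
  qed (use Suc in auto)
  also have "\<dots> = exp (c * real (Suc r))" by (simp add: exp_add[symmetric] algebra_simps)
  finally show ?case .
qed (simp add: opnorm1_mat_1)

text \<open>At a point all of whose ergodic sums of \<phi> are nonpositive, norms of products over
  whole blocks decay like \<open>exp (- \<eta> * j)\<close>. The incomplete block and the
  immigration grow subexponentially by Borel-Cantelli, so the means are summable there. Almost sure
  divergence would thus give every point a positive sum, against Garsia's inequality.\<close>

lemma summable_past_mean: "\<not> (AE \<omega> in P. \<not> summable (past_mean \<omega>))"
proof
  assume contra: "AE \<omega> in P. \<not> summable (past_mean \<omega>)"
  obtain L lam where L: "0 < L" and lam: "integrable P lam" "(\<integral>\<omega>. lam \<omega> \<partial>P) < 0"
    and le: "\<And>\<omega>. opnorm1 (off_mean_prod q p \<omega> L) \<le> exp (lam \<omega>)"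
    using cond_A3_block[OF A3] by blast
  define T :: "(int \<Rightarrow> 's) \<Rightarrow> (int \<Rightarrow> 's)" where "T = env_shift (- int L)"
  have Ti: "(T ^^ i) \<omega> = env_shift (- int (i * L)) \<omega>" for i \<omega>
    by (induction i) (simp_all add: T_def algebra_simps)
  \<comment> \<open>Half of the available drift: \<phi> keeps the negative mean
    \<open>- \<eta>\<close>, and \<eta> becomes the decay rate per block.\<close>
  define \<eta> where "\<eta> = - (\<integral>\<omega>. lam \<omega> \<partial>P) / 2"
  have \<eta>: "0 < \<eta>" using lam by (simp add: \<eta>_def)
  define \<phi> where "\<phi> \<omega> = lam (T \<omega>) + \<eta>" for \<omega>
  note borel_measurable_integrable[OF lam(1), measurable]
  have Tm: "T \<in> P \<rightarrow>\<^sub>M P" "distr P P T = P" unfolding T_def by (simp_all add: distr_env_shift)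
  have lamT: "integrable P (\<lambda>\<omega>. lam (T \<omega>))"
    using integrable_distr[OF Tm(1), of lam] lam(1) Tm(2) by simp
  have "(\<integral>\<omega>. lam (T \<omega>) \<partial>P) = (\<integral>\<omega>. lam \<omega> \<partial>P)"
    using integral_distr[OF Tm(1), of lam] Tm(2) by simp
  then have \<phi>: "integrable P \<phi>" "(\<integral>\<omega>. \<phi> \<omega> \<partial>P) < 0"
    using lamT lam(2) by (simp_all add: \<phi>_def[abs_def] \<eta>_def P.prob_space)
  \<comment> \<open>At most \<open>L\<close> factors lie outside whole blocks, each at most
    \<open>exp (\<kappa> * n)\<close>. This value makes their total
    \<open>exp (\<eta> * n / (2 * L))\<close>, half of the decay exponent
    \<open>\<eta> * n / L\<close> of the blocks.\<close>
  define \<kappa> where "\<kappa> = \<eta> / (2 * real L * real L)"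
  have \<kappa>: "0 < \<kappa>" using \<eta> L by (simp add: \<kappa>_def)
  let ?X = "\<lambda>\<omega>. log_plus (opnorm1 (off_mean q p \<omega> 0))" and ?Y = "\<lambda>\<omega>. log_plus (norm1 (imm_mean q p \<omega> 0))"
  have XY: "integrable P ?X" "integrable P ?Y" using A1 A2 by (simp_all add: cond_A1_def cond_A2_def)
  have "AE \<omega> in P. \<exists>n0. \<forall>n\<ge>n0. ?X (env_shift (- int n) \<omega>) \<le> \<kappa> * real n"
    "AE \<omega> in P. \<exists>n0. \<forall>n\<ge>n0. ?Y (env_shift (- int n) \<omega>) \<le> \<kappa> * real n"
    by (rule eventually_sublinear[OF XY(1) log_plus_nonneg \<kappa>],
        rule eventually_sublinear[OF XY(2) log_plus_nonneg \<kappa>])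
  with contra have "AE \<omega> in P. \<exists>n. (\<Sum>i<n. \<phi> ((T ^^ i) \<omega>)) > 0"
  proof eventually_elim
    fix \<omega> assume ns: "\<not> summable (past_mean \<omega>)"
      and "\<exists>n0. \<forall>n\<ge>n0. ?X (env_shift (- int n) \<omega>) \<le> \<kappa> * real n"
      and "\<exists>n0. \<forall>n\<ge>n0. ?Y (env_shift (- int n) \<omega>) \<le> \<kappa> * real n"
    then obtain nX nY where nX: "\<And>n. n \<ge> nX \<Longrightarrow> ?X (env_shift (- int n) \<omega>) \<le> \<kappa> * real n"
      and nY: "\<And>n. n \<ge> nY \<Longrightarrow> ?Y (env_shift (- int n) \<omega>) \<le> \<kappa> * real n" by blast
    show "\<exists>n. (\<Sum>i<n. \<phi> ((T ^^ i) \<omega>)) > 0"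
    proof (rule ccontr)
      assume "\<not> ?thesis"
      then have neg: "(\<Sum>i<n. \<phi> ((T ^^ i) \<omega>)) \<le> 0" for n by (simp add: not_less)
      \<comment> \<open>Going back by one more block multiplies an older block on the right, so
        submultiplicativity adds one term of the sum along \<open>T\<close>.\<close>
      have block: "opnorm1 (off_mean_prod q p (env_shift (- int (j * L)) \<omega>) (j * L)) \<le> exp (\<Sum>i<j. lam (T ((T ^^ i) \<omega>)))" for j
      proof (induction j)
        case (Suc j)
        let ?w = "env_shift (- int (Suc j * L)) \<omega>"
        have w: "env_shift (int L) ?w = env_shift (- int (j * L)) \<omega>" by (simp add: algebra_simps)
        have w': "T ((T ^^ j) \<omega>) = ?w" unfolding Ti by (simp add: T_def algebra_simps)
        have "opnorm1 (off_mean_prod q p ?w (L + j * L)) \<le>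
            opnorm1 (off_mean_prod q p (env_shift (- int (j * L)) \<omega>) (j * L)) * opnorm1 (off_mean_prod q p ?w L)"
          unfolding off_mean_prod_add w by (rule opnorm1_mult_le)
        also have "\<dots> \<le> exp (\<Sum>i<j. lam (T ((T ^^ i) \<omega>))) * exp (lam ?w)"
          by (intro mult_mono Suc le opnorm1_nonneg) auto
        also have "\<dots> = exp (\<Sum>i<Suc j. lam (T ((T ^^ i) \<omega>)))" by (simp add: exp_add w')
        finally show ?case by simp
      qed (simp add: opnorm1_mat_1)
      have blockle: "opnorm1 (off_mean_prod q p (env_shift (- int (j * L)) \<omega>) (j * L)) \<le> exp (- \<eta> * real j)" for j
      proof -
        have "(\<Sum>i<j. lam (T ((T ^^ i) \<omega>))) \<le> - \<eta> * real j"
          using neg[of j] by (simp add: \<phi>_def sum.distrib mult.commute)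
        with block[of j] show ?thesis by (meson exp_le_cancel_iff order_trans)
      qed
      \<comment> \<open>From time \<open>-n\<close> the first \<open>r\<close> steps lead to
        \<open>- (j * L)\<close>, whence \<open>j\<close> whole blocks lead to 0. The summand
        \<open>L\<close> in the threshold keeps \<open>n - i \<ge> nX\<close> for all
        \<open>i < r\<close>.\<close>
      have tail: "past_mean \<omega> n \<le> exp \<eta> * exp (- \<eta> / (2 * real L)) ^ n" if n: "n \<ge> nX + nY + L" for n
      proof -
        let ?w = "env_shift (- int n) \<omega>"
        define j r where "j = n div L" and "r = n mod L"
        have nj: "n = r + j * L" and r: "r < L" using L by (auto simp: j_def r_def)
        have w: "env_shift (int r) ?w = env_shift (- int (j * L)) \<omega>" by (simp add: nj)
        have opr: "opnorm1 (off_mean_prod q p ?w r) \<le> exp (\<kappa> * real n * real r)"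
        proof (rule opnorm1_prod_le)
          fix i assume i: "i < r"
          have "off_mean q p ?w i = off_mean q p (env_shift (- int (n - i)) \<omega>) 0"
            using i r n by (subst off_mean_shift) (simp add: of_nat_diff)
          moreover have "?X (env_shift (- int (n - i)) \<omega>) \<le> \<kappa> * real (n - i)"
            using i r n by (intro nX) simp
          moreover have "\<kappa> * real (n - i) \<le> \<kappa> * real n" using \<kappa> by (intro mult_left_mono) auto
          ultimately show "log_plus (opnorm1 (off_mean q p ?w i)) \<le> \<kappa> * real n" by simp
        qed
        have im: "norm1 (imm_mean q p ?w 0) \<le> exp (\<kappa> * real n)"
          using le_exp_log_plus[of "norm1 (imm_mean q p ?w 0)"] nY[of n] n
          by (meson exp_le_cancel_iff order_trans le_add2 add_leE)
        have "past_mean \<omega> n \<le> opnorm1 (off_mean_prod q p ?w n) * norm1 (imm_mean q p ?w 0)"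
          unfolding past_mean_def by (rule norm1_mult_opnorm1)
        also have "opnorm1 (off_mean_prod q p ?w n) \<le>
            opnorm1 (off_mean_prod q p (env_shift (- int (j * L)) \<omega>) (j * L)) * opnorm1 (off_mean_prod q p ?w r)"
          using opnorm1_mult_le off_mean_prod_add[of ?w r "j * L"] by (simp only: w nj[symmetric])
        also have "\<dots> * norm1 (imm_mean q p ?w 0) \<le> (exp (- \<eta> * real j) * exp (\<kappa> * real n * real r)) * exp (\<kappa> * real n)"
          by (intro mult_mono blockle opr im opnorm1_nonneg norm1_nonneg mult_nonneg_nonneg) auto
        also have "\<dots> = exp (- \<eta> * real j + \<kappa> * real n * (real r + 1))"
          by (simp add: exp_add[symmetric] algebra_simps)
        also have "\<dots> \<le> exp (\<eta> + real n * (- \<eta> / (2 * real L)))"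
        proof (subst exp_le_cancel_iff)
          have "real n \<le> real L * (real j + 1)"
          proof -
            have "n \<le> L * (j + 1)" using nj r by simp
            then have "real n \<le> real (L * (j + 1))" by (simp only: of_nat_le_iff)
            then show ?thesis by (simp add: distrib_left)
          qed
          then have "real n / real L - 1 \<le> real j" using L by (simp add: field_simps)
          then have 1: "- \<eta> * real j \<le> - \<eta> * (real n / real L - 1)" using \<eta> by (intro mult_left_mono_neg) auto
          have "real r + 1 \<le> real L" using r by simp
          then have 2: "\<kappa> * real n * (real r + 1) \<le> \<kappa> * real n * real L" using \<kappa> by (intro mult_left_mono) auto
          have "- \<eta> * (real n / real L - 1) + \<kappa> * real n * real L = \<eta> + real n * (- \<eta> / (2 * real L))"
            using L by (simp add: \<kappa>_def field_simps)
          with 1 2 show "- \<eta> * real j + \<kappa> * real n * (real r + 1) \<le> \<eta> + real n * (- \<eta> / (2 * real L))" by linarith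
        qed
        also have "\<dots> = exp \<eta> * exp (- \<eta> / (2 * real L)) ^ n"
          by (simp only: exp_add exp_of_nat_mult)
        finally show ?thesis by (simp add: mult_right_mono norm1_nonneg)
      qed
      have "summable (\<lambda>n. exp \<eta> * exp (- \<eta> / (2 * real L)) ^ n)"
        using \<eta> L by (intro summable_mult summable_geometric) simp
      then have "summable (past_mean \<omega>)"
        by (rule summable_comparison_test'[where N = "nX + nY + L"])
          (use tail in \<open>simp add: past_mean_def norm1_nonneg\<close>)
      with ns show False by simp
    qed
  qed
  with P.maximal_ergodic[OF Tm \<phi>] show False by blast
qed

text \<open>An infinite product of positive factors that are at least \<open>1 - t_j\<close> with
  summable \<open>t_j\<close> is positive: finitely many factors are split off, and Bernoulli's
  inequality keeps every finite part of the rest above 1/2.\<close>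

lemma past_zero_prob_pos_if_summable:
  assumes s: "summable (past_mean \<omega>)" and pos: "\<And>j. 0 < lineage_zero_prob j (env_shift (- int j) \<omega>)"
    and mom: "\<And>k j. imm_moment (\<omega> k) j < \<infinity>" "\<And>k i j. off_moment (\<omega> k) i j < \<infinity>"
  shows "0 < past_zero_prob \<omega>"
proof -
  let ?s = "\<lambda>j. lineage_zero_prob j (env_shift (- int j) \<omega>)"
  have t0: "0 \<le> past_mean \<omega> n" for n by (simp add: past_mean_def norm1_nonneg)
  have B: "1 \<le> ?s j + ennreal (past_mean \<omega> j)" for j
    using lineage_zero_prob_lower[of j "env_shift (- int j) \<omega>"] sum_lineage_mean[of "env_shift (- int j) \<omega>" j] mom
    by (simp add: past_mean_def env_shift_def)
  obtain N0 where N0: "norm (\<Sum>i. past_mean \<omega> (i + n)) < 1 / 2" if "n \<ge> N0" for n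
    using suminf_exist_split[OF _ s, of "1 / 2"] by auto
  \<comment> \<open>The successor makes \<open>N\<close> at least 1, so that \<open>{1..<N}\<close>
    and the indices from \<open>N\<close> on partition those of the product.\<close>
  define N where "N = Suc N0"
  define c where "c = (\<Prod>j=1..<N. ?s j)"
  have "0 < (\<Prod>j\<in>J. ?s j)" if "finite J" for J
    using that by (induction J) (auto simp: pos ennreal_zero_less_mult_iff)
  then have c: "0 < c" unfolding c_def by simp
  have tail: "ennreal (1 / 2) \<le> (\<Prod>j=N..<N + m. ?s j)" for m
  proof -
    have "1 \<le> (\<Prod>j=N..<N + m. ?s j) + (\<Sum>j=N..<N + m. ennreal (past_mean \<omega> j))"
      by (rule Bernoulli_prod) (rule B)
    also have "(\<Sum>j=N..<N + m. ennreal (past_mean \<omega> j)) = ennreal (\<Sum>j=N..<N + m. past_mean \<omega> j)"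
      by (rule sum_ennreal) (rule t0)
    also have "(\<Sum>j=N..<N + m. past_mean \<omega> j) = (\<Sum>i<m. past_mean \<omega> (i + N))"
      by (rule sum.reindex_bij_witness[of _ "\<lambda>i. i + N" "\<lambda>j. j - N"]) auto
    also have "ennreal \<dots> \<le> ennreal (1 / 2)"
    proof (rule ennreal_leI)
      have "(\<Sum>i<m. past_mean \<omega> (i + N)) \<le> (\<Sum>i. past_mean \<omega> (i + N))"
        using s t0 by (intro sum_le_suminf) (auto simp: summable_iff_shift)
      with N0[of N] show "(\<Sum>i<m. past_mean \<omega> (i + N)) \<le> 1 / 2" by (simp add: N_def)
    qed
    finally have *: "1 \<le> (\<Prod>j=N..<N + m. ?s j) + ennreal (1 / 2)" by (simp add: add_left_mono)
    show ?thesis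
    proof (cases "\<Prod>j=N..<N + m. ?s j")
      case (real x)
      have "ennreal x + ennreal (1 / 2) = ennreal (x + 1 / 2)"
        using real(1) by (intro ennreal_plus[symmetric]) auto
      with * have "ennreal 1 \<le> ennreal (x + 1 / 2)" by (simp only: real(2) ennreal_1)
      then have "1 / 2 \<le> x" using real(1) by (subst (asm) ennreal_le_iff) auto
      then show ?thesis unfolding real(2) by (rule ennreal_leI)
    qed simp
  qed
  have "c * ennreal (1 / 2) \<le> zero_prob n (env_shift (- int n) \<omega>)" for n
  proof -
    \<comment> \<open>This length makes the last index \<open>N + n\<close>, hence at least
      \<open>n\<close>, as antitonicity requires.\<close>
    let ?m = "Suc n"
    have "{1..N + ?m - 1} = {1..<N} \<union> {N..<N + ?m}" by (auto simp: N_def)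
    moreover have "{1..<N} \<inter> {N..<N + ?m} = {}" by auto
    ultimately have "(\<Prod>j=1..N + ?m - 1. ?s j) = c * (\<Prod>j=N..<N + ?m. ?s j)"
      unfolding c_def by (simp only: prod.union_disjoint finite_atLeastLessThan)
    then have "c * ennreal (1 / 2) \<le> zero_prob (N + ?m - 1) (env_shift (- int (N + ?m - 1)) \<omega>)"
      unfolding zero_prob_shift using tail[of ?m] by (simp only: mult_left_mono zero_le)
    also have "\<dots> \<le> zero_prob n (env_shift (- int n) \<omega>)" by (rule zero_prob_antimono) simp
    finally show ?thesis .
  qed
  then have "c * ennreal (1 / 2) \<le> past_zero_prob \<omega>" unfolding past_zero_prob_def by (intro INF_greatest)
  moreover have "0 < ennreal (1 / 2)" by (subst ennreal_less_zero_iff) simp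
  then have "0 < c * ennreal (1 / 2)" using c by (simp only: ennreal_zero_less_mult_iff)
  ultimately show ?thesis by (rule less_le_trans[rotated])
qed

text \<open>The set \<open>D\<close> of positive weight is almost surely mapped into itself by the
  shift, whereas ergodicity is stated for exactly invariant sets; so it is applied to the set of
  environments that are eventually in \<open>D\<close>.\<close>

lemma past_zero_prob_pos: "AE \<omega> in P. 0 < past_zero_prob \<omega>"
proof -
  define D where "D = {\<omega>\<in>space P. 0 < past_zero_prob \<omega>}"
  have D[measurable]: "D \<in> sets P" unfolding D_def by measurable
  have step: "AE \<omega> in P. \<omega> \<in> D \<longrightarrow> (\<forall>n. env_shift (int n) \<omega> \<in> D)"
    using AE_env_shift[OF return_prob_lower] AE_space
  proof eventually_elim
    fix \<omega> assume r: "\<forall>k. ennreal \<delta> \<le> return_prob 1 1 (env_shift k \<omega>)" and w: "\<omega> \<in> space P"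
    show "\<omega> \<in> D \<longrightarrow> (\<forall>n. env_shift (int n) \<omega> \<in> D)"
    proof (intro impI allI)
      fix n assume "\<omega> \<in> D"
      then show "env_shift (int n) \<omega> \<in> D"
      proof (induction n)
        case (Suc n)
        then have "0 < past_zero_prob (env_shift (int n) \<omega>)" by (simp add: D_def)
        moreover have "0 < return_prob 1 1 (env_shift (int n) \<omega>)" using r \<delta>_pos by (meson ennreal_less_zero_iff less_le_trans)
        ultimately have "0 < past_zero_prob (env_shift (int n) \<omega>) * return_prob 1 1 (env_shift (int n) \<omega>)"
          by (simp add: ennreal_zero_less_mult_iff)
        also have "\<dots> \<le> past_zero_prob (env_shift 1 (env_shift (int n) \<omega>))" by (rule past_zero_prob_step)
        finally show ?case using w by (simp add: D_def add.commute)
      qed simp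
    qed
  qed
  define An where "An m = {\<omega>\<in>space P. \<forall>n\<ge>m. env_shift (int n) \<omega> \<in> D}" for m :: nat
  have Anm[measurable]: "An m \<in> sets P" for m unfolding An_def by measurable
  \<comment> \<open>Eventual membership in \<open>D\<close>: dropping or adding one initial step
    does not change it, so it is exactly invariant.\<close>
  define A where "A = (\<Union>m. An m)"
  have A[measurable]: "A \<in> sets P" unfolding A_def by measurable
  have "env_shift 1 -` A \<inter> space P = A"
  proof -
    have eqm: "env_shift 1 \<omega> \<in> An m \<longleftrightarrow> \<omega> \<in> An (Suc m)" if "\<omega> \<in> space P" for \<omega> m
    proof -
      have "(\<forall>n\<ge>m. env_shift (int n + 1) \<omega> \<in> D) \<longleftrightarrow> (\<forall>n\<ge>Suc m. env_shift (int n) \<omega> \<in> D)"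
      proof safe
        fix n assume *: "\<forall>n\<ge>m. env_shift (int n + 1) \<omega> \<in> D" "Suc m \<le> n"
        then have "m \<le> n - 1" "int (n - 1) + 1 = int n" by auto
        with *(1) show "env_shift (int n) \<omega> \<in> D" by metis
      next
        fix n assume *: "\<forall>n\<ge>Suc m. env_shift (int n) \<omega> \<in> D" "m \<le> n"
        then have "env_shift (int (Suc n)) \<omega> \<in> D" by blast
        then show "env_shift (int n + 1) \<omega> \<in> D" by (simp add: add.commute)
      qed
      then show ?thesis using that by (simp add: An_def)
    qed
    moreover have "An m \<subseteq> space P" for m by (auto simp: An_def)
    moreover have "env_shift 1 \<omega> \<in> A \<longleftrightarrow> \<omega> \<in> A" if "\<omega> \<in> space P" for \<omega>
    proof
      assume "env_shift 1 \<omega> \<in> A"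
      then obtain m where "env_shift 1 \<omega> \<in> An m" unfolding A_def by blast
      then have "\<omega> \<in> An (Suc m)" using eqm[OF that] by simp
      then show "\<omega> \<in> A" unfolding A_def by blast
    next
      assume "\<omega> \<in> A"
      then obtain m where "\<omega> \<in> An m" unfolding A_def by blast
      then have "\<omega> \<in> An (Suc m)" by (auto simp: An_def)
      then have "env_shift 1 \<omega> \<in> An m" using eqm[OF that] by simp
      then show "env_shift 1 \<omega> \<in> A" unfolding A_def by blast
    qed
    moreover have "A \<subseteq> space P" using \<open>\<And>m. An m \<subseteq> space P\<close> unfolding A_def by blast
    ultimately show ?thesis by auto
  qed
  with ergodic A have "P.prob A = 0 \<or> P.prob A = 1" unfolding ergodic_env_def by blast
  \<comment> \<open>\<open>D\<close> is contained in \<open>A\<close> up to a null set; if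
    \<open>A\<close> were null, the weight would vanish almost surely and the means could be
    summable almost nowhere.\<close>
  moreover have "P.prob A \<noteq> 0"
  proof
    assume "P.prob A = 0"
    then have "AE \<omega> in P. \<omega> \<notin> A" using A by (simp add: P.prob_eq_0)
    then have "AE \<omega> in P. \<not> 0 < past_zero_prob \<omega>"
      using step AE_space
    proof eventually_elim
      fix \<omega> assume "\<omega> \<notin> A" "\<omega> \<in> D \<longrightarrow> (\<forall>n. env_shift (int n) \<omega> \<in> D)" "\<omega> \<in> space P"
      moreover have "\<omega> \<in> An 0" if "\<forall>n. env_shift (int n) \<omega> \<in> D" using that \<open>\<omega> \<in> space P\<close> by (simp add: An_def)
      ultimately show "\<not> 0 < past_zero_prob \<omega>" unfolding A_def D_def by blast
    qed
    with AE_env_shift[OF q_0_pos] finite_moments have "AE \<omega> in P. \<not> summable (past_mean \<omega>)"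
    proof eventually_elim
      fix \<omega> assume W0: "\<not> 0 < past_zero_prob \<omega>" and q0: "\<forall>k. 0 < pmf (q (env_shift k \<omega> (-1))) 0"
        and m: "\<forall>k. (\<forall>j. imm_moment (\<omega> k) j < \<infinity>) \<and> (\<forall>i j. off_moment (\<omega> k) i j < \<infinity>)"
      show "\<not> summable (past_mean \<omega>)"
      proof
        assume "summable (past_mean \<omega>)"
        then have "0 < past_zero_prob \<omega>" using q0 m by (intro past_zero_prob_pos_if_summable lineage_zero_prob_pos) auto
        with W0 show False by simp
      qed
    qed
    with summable_past_mean show False by blast
  qed
  ultimately have "P.prob A = 1" by simp
  \<comment> \<open>\<open>An m\<close> lies in the preimage of \<open>D\<close> under the shift by
    \<open>m\<close>, which has the mass of \<open>D\<close> by stationarity. So full mass passes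
    from \<open>A\<close> to \<open>D\<close>.\<close>
  have "emeasure P A = (SUP m. emeasure P (An m))"
    unfolding A_def by (rule SUP_emeasure_incseq[symmetric]) (auto simp: incseq_def An_def)
  also have "\<dots> \<le> emeasure P D"
  proof (rule SUP_least)
    fix m
    have "emeasure P (An m) \<le> emeasure P (env_shift (int m) -` D \<inter> space P)"
      by (rule emeasure_mono) (auto simp: An_def)
    also have "\<dots> = emeasure (distr P P (env_shift (int m))) D" by (rule emeasure_distr[symmetric]) measurable
    finally show "emeasure P (An m) \<le> emeasure P D" by (simp add: distr_env_shift)
  qed
  finally have "1 \<le> P.prob D" using \<open>P.prob A = 1\<close> by (simp add: P.emeasure_eq_measure)
  then have "P.prob D = 1" using P.prob_le_1[of D] by linarith
  then have "AE \<omega> in P. \<omega> \<in> D" using D by (simp add: P.prob_eq_1)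
  then show ?thesis by eventually_elim (simp add: D_def)
qed

lemma recurrent: "AE \<omega> in P. AE y in Q \<omega>. nu (popul y) 1 \<noteq> \<infinity>"
  using past_zero_prob_pos past_zero_prob_escape
proof eventually_elim
  fix \<omega> assume pos: "0 < past_zero_prob \<omega>" and "past_zero_prob \<omega> * escape \<omega> = 0"
  then have "past_zero_prob \<omega> = 0 \<or> escape \<omega> = 0" by simp
  with pos have "escape \<omega> = 0" by (metis less_irrefl)
  then have "AE y in Q \<omega>. (if nu (popul y) 1 = \<infinity> then 1 else 0 :: ennreal) = 0"
    unfolding escape_def using nu_infinity_measurable[of 1]
    by (subst (asm) nn_integral_0_iff_AE) (simp_all add: measurable_cong_sets[OF sets_Q refl])
  then show "AE y in Q \<omega>. nu (popul y) 1 \<noteq> \<infinity>" by eventually_elim (simp split: if_splits)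
qed

end

section \<open>The tilted law\<close>

text \<open>The topology of \<open>nat\<close> is discrete, so convergence of the finite partial
  sums means that they become constant, which forces finite support.\<close>

lemma has_sum_nat_iff:
  fixes f :: "'a \<Rightarrow> nat"
  shows "(f has_sum c) A \<longleftrightarrow> finite {i\<in>A. f i \<noteq> 0} \<and> (\<Sum>i\<in>{i\<in>A. f i \<noteq> 0}. f i) = c"
proof
  assume "(f has_sum c) A"
  then have "eventually (\<lambda>X. sum f X = c) (finite_subsets_at_top A)"
    by (simp only: has_sum_def tendsto_discrete)
  then obtain X where X: "finite X" "X \<subseteq> A" "\<And>Y. finite Y \<Longrightarrow> X \<subseteq> Y \<Longrightarrow> Y \<subseteq> A \<Longrightarrow> sum f Y = c"
    by (auto simp: eventually_finite_subsets_at_top)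
  have sub: "{i\<in>A. f i \<noteq> 0} \<subseteq> X"
  proof (rule subsetI, rule ccontr)
    fix i assume i: "i \<in> {i\<in>A. f i \<noteq> 0}" "i \<notin> X"
    have "sum f (insert i X) = f i + sum f X" using X(1) i(2) by (rule sum.insert)
    moreover have "sum f (insert i X) = c"
      by (rule X(3)) (use X(1,2) i in auto)
    moreover have "sum f X = c" by (rule X(3)) (use X(1,2) in auto)
    ultimately have "f i = 0" by linarith
    with i show False by simp
  qed
  moreover have "(\<Sum>i\<in>{i\<in>A. f i \<noteq> 0}. f i) = sum f X"
    using X sub by (intro sum.mono_neutral_left) auto
  ultimately show "finite {i\<in>A. f i \<noteq> 0} \<and> (\<Sum>i\<in>{i\<in>A. f i \<noteq> 0}. f i) = c"
    using X by (auto intro: finite_subset)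
next
  assume "finite {i\<in>A. f i \<noteq> 0} \<and> (\<Sum>i\<in>{i\<in>A. f i \<noteq> 0}. f i) = c"
  then have "(f has_sum c) {i\<in>A. f i \<noteq> 0}" by (auto intro: has_sum_finiteI)
  moreover have "(f has_sum c) A \<longleftrightarrow> (f has_sum c) {i\<in>A. f i \<noteq> 0}"
    by (rule has_sum_cong_neutral) auto
  ultimately show "(f has_sum c) A" by blast
qed

lemma has_sum_0_nat_iff:
  fixes f :: "'a \<Rightarrow> nat"
  shows "(f has_sum 0) A \<longleftrightarrow> (\<forall>i\<in>A. f i = 0)"
proof
  assume "(f has_sum 0) A"
  then have fin: "finite {i\<in>A. f i \<noteq> 0}" and s: "(\<Sum>i\<in>{i\<in>A. f i \<noteq> 0}. f i) = 0"
    by (simp_all only: has_sum_nat_iff)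
  from s have "\<forall>i\<in>{i\<in>A. f i \<noteq> 0}. f i = 0" unfolding sum_eq_0_iff[OF fin] .
  then show "\<forall>i\<in>A. f i = 0" by blast
next
  assume "\<forall>i\<in>A. f i = 0"
  then have "{i\<in>A. f i \<noteq> 0} = {}" by auto
  then show "(f has_sum 0) A" by (simp only: has_sum_nat_iff finite.emptyI sum.empty)
qed

text \<open>The value 0 is excluded because \<open>infsum\<close> also takes it on divergent sums.
  Any other value has a witness cutoff \<open>m\<close>, which makes the condition
  countable.\<close>

lemma infsum_nat_eq_iff:
  fixes f :: "int \<Rightarrow> nat"
  assumes "c \<noteq> 0"
  shows "infsum f {..<N} = c \<longleftrightarrow> (\<exists>m::nat. (\<forall>i. i < - int m \<longrightarrow> i < N \<longrightarrow> f i = 0) \<and> (\<Sum>i\<in>{- int m..<N}. f i) = c)"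
proof
  assume c: "infsum f {..<N} = c"
  then have "f summable_on {..<N}" using assms infsum_not_exists by metis
  with c have "(f has_sum c) {..<N}" by auto
  then have fin: "finite {i\<in>{..<N}. f i \<noteq> 0}" and s: "(\<Sum>i\<in>{i\<in>{..<N}. f i \<noteq> 0}. f i) = c"
    by (simp_all only: has_sum_nat_iff)
  obtain b where b: "\<And>i. i \<in> {i\<in>{..<N}. f i \<noteq> 0} \<Longrightarrow> b \<le> i"
    using bdd_below_finite[OF fin] unfolding bdd_below_def by blast
  let ?m = "nat \<bar>b\<bar>"
  have z: "f i = 0" if "i < - int ?m" "i < N" for i
    using b[of i] that by (cases "f i = 0") auto
  moreover have "(\<Sum>i\<in>{- int ?m..<N}. f i) = c"
    unfolding s[symmetric] using z fin by (intro sum.mono_neutral_right) (force simp: not_le)+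
  ultimately show "\<exists>m::nat. (\<forall>i. i < - int m \<longrightarrow> i < N \<longrightarrow> f i = 0) \<and> (\<Sum>i\<in>{- int m..<N}. f i) = c" by blast
next
  assume "\<exists>m::nat. (\<forall>i. i < - int m \<longrightarrow> i < N \<longrightarrow> f i = 0) \<and> (\<Sum>i\<in>{- int m..<N}. f i) = c"
  then obtain m :: nat where m: "\<And>i. i < - int m \<Longrightarrow> i < N \<Longrightarrow> f i = 0" "(\<Sum>i\<in>{- int m..<N}. f i) = c" by blast
  have "infsum f {..<N} = infsum f {- int m..<N}"
    by (rule infsum_cong_neutral) (auto simp: m(1) not_le)
  then show "infsum f {..<N} = c" using m(2) by simp
qed

text \<open>The event of value 0, including divergence, is obtained as the complement of all other
  values.\<close>

lemma measurable_infsum_nat: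
  fixes f :: "'a \<Rightarrow> int \<Rightarrow> nat"
  assumes f: "\<And>i. (\<lambda>x. f x i) \<in> M \<rightarrow>\<^sub>M count_space UNIV"
  shows "(\<lambda>x. infsum (f x) {..<N}) \<in> M \<rightarrow>\<^sub>M count_space UNIV"
proof -
  have [measurable]: "Measurable.pred M (\<lambda>x. f x i = 0)" for i
    by (rule measurable_compose[OF f]) simp
  have [measurable]: "Measurable.pred M (\<lambda>x. (\<Sum>i\<in>I. f x i) = c)" for I c
    by (rule measurable_compose[OF measurable_count_space_sum[OF f]]) simp
  have pos: "Measurable.pred M (\<lambda>x. infsum (f x) {..<N} = c)" if "c \<noteq> 0" for c
    unfolding infsum_nat_eq_iff[OF that] by measurable
  have "Measurable.pred M (\<lambda>x. infsum (f x) {..<N} = c)" for c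
  proof (cases "c = 0")
    case True
    have "(\<lambda>x. infsum (f x) {..<N} = c) = (\<lambda>x. \<forall>c\<in>{1..}. \<not> infsum (f x) {..<N} = c)"
      using True by (auto simp: fun_eq_iff Suc_le_eq)
    also have "Measurable.pred M \<dots>"
      using pos by (intro pred_intros_countable_bounded pred_intros_logic) auto
    finally show ?thesis .
  qed (rule pos)
  then have "{x\<in>space M. infsum (f x) {..<N} = c} \<in> sets M" for c by (rule predE)
  moreover have "{x\<in>space M. infsum (f x) {..<N} = c} = (\<lambda>x. infsum (f x) {..<N}) -` {c} \<inter> space M" for c by auto
  ultimately show ?thesis by (intro measurable_count_space_eq2_countable[THEN iffD2]) auto
qed

lemma measurable_vec_count_space:
  fixes f :: "'a \<Rightarrow> 'd::finite \<Rightarrow> nat"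
  assumes f: "\<And>j. (\<lambda>x. f x j) \<in> M \<rightarrow>\<^sub>M count_space UNIV"
  shows "(\<lambda>x. \<chi> j. f x j) \<in> M \<rightarrow>\<^sub>M count_space UNIV"
proof -
  have "{x\<in>space M. \<forall>j. f x j = v $ j} \<in> sets M" for v :: "nat ^ 'd"
  proof -
    have [measurable]: "Measurable.pred M (\<lambda>x. f x j = v $ j)" for j
      by (rule measurable_compose[OF f]) simp
    show ?thesis by measurable
  qed
  moreover have "{x\<in>space M. \<forall>j. f x j = v $ j} = (\<lambda>x. \<chi> j. f x j) -` {v} \<inter> space M" for v :: "nat ^ 'd"
    by (auto simp: vec_eq_iff)
  ultimately show ?thesis by (intro measurable_count_space_eq2_countable[THEN iffD2]) auto
qed

abbreviation pastM :: "(int \<Rightarrow> nat \<Rightarrow> nat ^ 'd::finite) measure" where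
  "pastM \<equiv> PiM {..<0} (\<lambda>_. pathM)"

context branching_env
begin

section \<open>The enlarged space and its conditioning event\<close>

abbreviation enlarged_law :: "((int \<Rightarrow> 's) \<times> ('d source \<Rightarrow> nat ^ 'd) \<times> (int \<Rightarrow> nat \<Rightarrow> nat ^ 'd)) measure" where
  "enlarged_law \<equiv> enlarged P q p"

abbreviation past_law :: "(int \<Rightarrow> 's) \<Rightarrow> (int \<Rightarrow> nat \<Rightarrow> nat ^ 'd) measure" where
  "past_law \<omega> \<equiv> PiM {..<0} (\<lambda>i. lineage0_law q p (env_shift i \<omega>))"

lemma lineage0_path_measurable: "(\<lambda>y n. lineage y n 0) \<in> sourceM \<rightarrow>\<^sub>M pathM"
  by (rule measurable_PiM_single') (auto simp: lineage_measurable)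

lemma lineage0_path_measurable_Q: "(\<lambda>y n. lineage y n 0) \<in> Q \<omega> \<rightarrow>\<^sub>M pathM"
  using lineage0_path_measurable by (simp add: measurable_cong_sets[OF sets_Q refl])

lemma prob_lineage0_law: "prob_space (lineage0_law q p \<omega>)"
  unfolding lineage0_law_def by (rule Q.prob_space_distr[OF lineage0_path_measurable_Q])

lemma sets_lineage0_law[simp]: "sets (lineage0_law q p \<omega>) = sets pathM"
  by (simp add: lineage0_law_def)

lemma space_lineage0_law[simp]: "space (lineage0_law q p \<omega>) = UNIV"
  by (simp add: lineage0_law_def space_PiM)

lemma lineage0_law_measurable: "(\<lambda>\<omega>. lineage0_law q p (env_shift i \<omega>)) \<in> P \<rightarrow>\<^sub>M prob_algebra pathM"
proof -
  have "(\<lambda>\<omega>. lineage0_law q p \<omega>) \<in> P \<rightarrow>\<^sub>M prob_algebra pathM"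
    unfolding lineage0_law_def
    using measurable_compose[OF measurable_snd lineage0_path_measurable]
    by (intro measurable_distr_prob_space2[OF Q_measurable]) (simp add: case_prod_unfold)
  from measurable_compose[OF env_shift_measurable this] show ?thesis .
qed

lemma past_law_measurable: "past_law \<in> P \<rightarrow>\<^sub>M prob_algebra pastM"
  by (rule measurable_PiM_kernel) (rule lineage0_law_measurable)

lemma prob_past_law: "prob_space (past_law \<omega>)"
  by (rule prob_space_PiM) (rule prob_lineage0_law)

lemma sets_past_law[simp, measurable_cong]: "sets (past_law \<omega>) = sets pastM"
  by (intro sets_PiM_cong) auto

abbreviation enlargedM :: "((int \<Rightarrow> 's) \<times> ('d source \<Rightarrow> nat ^ 'd) \<times> (int \<Rightarrow> nat \<Rightarrow> nat ^ 'd)) measure" where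
  "enlargedM \<equiv> P \<Otimes>\<^sub>M sourceM \<Otimes>\<^sub>M pastM"

lemma enlarged_kernel:
  "(\<lambda>\<omega>. distr (Q \<omega> \<Otimes>\<^sub>M past_law \<omega>) enlargedM (\<lambda>(y, u). (\<omega>, y, u))) \<in> P \<rightarrow>\<^sub>M prob_algebra enlargedM"
proof (rule measurable_distr_prob_space2)
  show "(\<lambda>\<omega>. Q \<omega> \<Otimes>\<^sub>M past_law \<omega>) \<in> P \<rightarrow>\<^sub>M prob_algebra (sourceM \<Otimes>\<^sub>M pastM)"
    by (rule measurable_pair_prob[OF Q_measurable past_law_measurable])
qed (simp add: split_beta)

lemma sets_enlarged[simp]: "sets enlarged_law = sets enlargedM"
  unfolding enlarged_def
  by (rule sets_bind) (use P.not_empty in auto)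

lemma space_enlarged: "space enlarged_law = space P \<times> UNIV \<times> space pastM"
  using sets_eq_imp_space_eq[OF sets_enlarged] by (simp add: space_pair_measure)

lemma nn_integral_enlarged:
  assumes f: "f \<in> borel_measurable enlargedM"
  shows "(\<integral>\<^sup>+x. f x \<partial>enlarged_law) = (\<integral>\<^sup>+\<omega>. \<integral>\<^sup>+y. \<integral>\<^sup>+u. f (\<omega>, y, u) \<partial>past_law \<omega> \<partial>Q \<omega> \<partial>P)"
proof -
  have "(\<integral>\<^sup>+x. f x \<partial>enlarged_law) = (\<integral>\<^sup>+\<omega>. \<integral>\<^sup>+x. f x \<partial>distr (Q \<omega> \<Otimes>\<^sub>M past_law \<omega>) enlargedM (\<lambda>(y, u). (\<omega>, y, u)) \<partial>P)"
    unfolding enlarged_def by (rule nn_integral_bind[OF f measurable_prob_algebraD[OF enlarged_kernel]])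
  also have "\<dots> = (\<integral>\<^sup>+\<omega>. \<integral>\<^sup>+y. \<integral>\<^sup>+u. f (\<omega>, y, u) \<partial>past_law \<omega> \<partial>Q \<omega> \<partial>P)"
  proof (rule nn_integral_cong)
    fix \<omega> assume w: "\<omega> \<in> space P"
    interpret U: prob_space "past_law \<omega>" by (rule prob_past_law)
    have s: "sets (Q \<omega> \<Otimes>\<^sub>M past_law \<omega>) = sets (sourceM \<Otimes>\<^sub>M pastM)"
      by (intro sets_pair_measure_cong) simp_all
    have "(\<lambda>x. (\<omega>, x)) \<in> sourceM \<Otimes>\<^sub>M pastM \<rightarrow>\<^sub>M enlargedM"
      using w by (intro measurable_Pair1')
    then have m: "(\<lambda>(y, u). (\<omega>, y, u)) \<in> Q \<omega> \<Otimes>\<^sub>M past_law \<omega> \<rightarrow>\<^sub>M enlargedM"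
      unfolding measurable_cong_sets[OF s refl] by (simp add: split_beta)
    have "(\<integral>\<^sup>+x. f x \<partial>distr (Q \<omega> \<Otimes>\<^sub>M past_law \<omega>) enlargedM (\<lambda>(y, u). (\<omega>, y, u))) =
        (\<integral>\<^sup>+x. f (\<omega>, fst x, snd x) \<partial>(Q \<omega> \<Otimes>\<^sub>M past_law \<omega>))"
      using f by (subst nn_integral_distr[OF m]) (simp_all add: split_beta)
    also have "\<dots> = (\<integral>\<^sup>+y. \<integral>\<^sup>+u. f (\<omega>, y, u) \<partial>past_law \<omega> \<partial>Q \<omega>)"
      using measurable_compose[OF m f] by (subst U.nn_integral_fst[symmetric]) (simp_all add: split_beta)
    finally show "(\<integral>\<^sup>+x. f x \<partial>distr (Q \<omega> \<Otimes>\<^sub>M past_law \<omega>) enlargedM (\<lambda>(y, u). (\<omega>, y, u))) =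
        (\<integral>\<^sup>+y. \<integral>\<^sup>+u. f (\<omega>, y, u) \<partial>past_law \<omega> \<partial>Q \<omega>)" .
  qed
  finally show ?thesis .
qed

text \<open>Index \<open>nat (- i)\<close> is the age at time 0 of a lineage that arrived at
  \<open>i\<close>; this is the part of the conditioning event that concerns
  \<open>u\<close>.\<close>

definition extinct_past :: "(int \<Rightarrow> nat \<Rightarrow> nat ^ 'd) set" where
  "extinct_past = {u\<in>space pastM. \<forall>i<0. u i (nat (- i)) = 0}"

lemma past_component_measurable:
  assumes "i < 0"
  shows "(\<lambda>u :: int \<Rightarrow> nat \<Rightarrow> nat ^ 'd. u i k) \<in> pastM \<rightarrow>\<^sub>M count_space UNIV"
proof -
  have "(\<lambda>u :: int \<Rightarrow> nat \<Rightarrow> nat ^ 'd. u i) \<in> pastM \<rightarrow>\<^sub>M pathM"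
    using assms by (intro measurable_component_singleton) simp
  moreover have "(\<lambda>z :: nat \<Rightarrow> nat ^ 'd. z k) \<in> pathM \<rightarrow>\<^sub>M count_space UNIV"
    by (rule measurable_component_singleton) simp
  ultimately show ?thesis by (rule measurable_compose)
qed

lemma extinct_past_sets[measurable]: "extinct_past \<in> sets pastM"
proof -
  have [measurable]: "Measurable.pred pastM (\<lambda>u :: int \<Rightarrow> nat \<Rightarrow> nat ^ 'd. i < 0 \<longrightarrow> u i (nat (- i)) = 0)" for i :: int
  proof (cases "i < 0")
    case True
    then show ?thesis
      using measurable_compose[OF past_component_measurable[OF True], of "\<lambda>v. v = 0" "count_space UNIV"] by simp
  qed simp
  show ?thesis unfolding extinct_past_def by measurable
qed

text \<open>The cylinders \<open>A n\<close>, on which the immigrants arriving from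
  \<open>-n\<close> on have no descendants at time 0, decrease to the event, and their probabilities
  are the finite products of \<open>zero_prob_shift\<close>.\<close>

lemma emeasure_extinct_past: "emeasure (past_law \<omega>) extinct_past = past_zero_prob \<omega>"
proof -
  define A where "A n = prod_emb {..<0} (\<lambda>i. lineage0_law q p (env_shift i \<omega>)) {- int n..<0}
    (\<Pi>\<^sub>E i\<in>{- int n..<0}. {x. x (nat (- i)) = 0})" for n
  have zs: "{x :: nat \<Rightarrow> nat ^ 'd. x k = 0} \<in> sets pathM" for k
    using measurable_sets[OF measurable_component_singleton[of k UNIV "\<lambda>_. count_space UNIV"], of "{0}"]
    by (simp add: space_PiM vimage_def)
  have A_alt: "A n = {u\<in>space pastM. \<forall>i\<in>{- int n..<0}. u i (nat (- i)) = 0}" for n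
    by (auto simp: A_def prod_emb_def space_PiM PiE_iff restrict_def extensional_def)
  have A_sets: "A n \<in> sets (past_law \<omega>)" for n
    unfolding A_def using zs by (intro sets_PiM_I) auto
  have "emeasure (past_law \<omega>) (A n) = zero_prob n (env_shift (- int n) \<omega>)" for n
  proof -
    have "emeasure (past_law \<omega>) (A n) =
        (\<Prod>i\<in>{- int n..<0}. emeasure (lineage0_law q p (env_shift i \<omega>)) {x. x (nat (- i)) = 0})"
      unfolding A_def using zs by (intro emeasure_PiM_emb prob_lineage0_law) auto
    also have "\<dots> = (\<Prod>j=1..n. emeasure (lineage0_law q p (env_shift (- int j) \<omega>)) {x. x j = 0})"
      by (rule prod.reindex_bij_witness[of _ "\<lambda>j. - int j" "\<lambda>i. nat (- i)"]) auto
    also have "\<dots> = (\<Prod>j=1..n. lineage_zero_prob j (env_shift (- int j) \<omega>))"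
    proof (intro prod.cong refl)
      fix j
      have m: "{y. lineage y j 0 = 0} \<in> sets (Q (env_shift (- int j) \<omega>))"
        using measurable_sets[OF lineage_measurable[of j 0], of "{0}"] by (simp add: vimage_def)
      have "lineage_zero_prob j (env_shift (- int j) \<omega>) = emeasure (Q (env_shift (- int j) \<omega>)) {y. lineage y j 0 = 0}"
      proof -
        have "lineage_zero_prob j (env_shift (- int j) \<omega>) = (\<integral>\<^sup>+y. indicator {y. lineage y j 0 = 0} y \<partial>Q (env_shift (- int j) \<omega>))"
          unfolding lineage_zero_prob_def by (intro nn_integral_cong) (simp add: indicator_def)
        with m show ?thesis by (simp only: nn_integral_indicator)
      qed
      with m show "emeasure (lineage0_law q p (env_shift (- int j) \<omega>)) {x. x j = 0} = lineage_zero_prob j (env_shift (- int j) \<omega>)"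
        unfolding lineage0_law_def using zs
        by (subst emeasure_distr[OF lineage0_path_measurable_Q]) (simp_all add: vimage_def)
    qed
    finally show ?thesis by (simp only: zero_prob_shift)
  qed
  then have "past_zero_prob \<omega> = (INF n. emeasure (past_law \<omega>) (A n))" by (simp add: past_zero_prob_def)
  also have "\<dots> = emeasure (past_law \<omega>) (\<Inter>n. A n)"
  proof (rule INF_emeasure_decseq)
    show "decseq A" unfolding A_alt decseq_def by force
    show "emeasure (past_law \<omega>) (A n) \<noteq> \<infinity>" for n
      using prob_space.emeasure_le_1[OF prob_past_law, of \<omega> "A n"] by (auto simp: top_unique)
  qed (use A_sets in auto)
  also have "(\<Inter>n. A n) = extinct_past"
  proof (intro set_eqI iffI)
    fix u assume u: "u \<in> (\<Inter>n. A n)"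
    have "u i (nat (- i)) = 0" if "i < 0" for i
    proof -
      have "u \<in> A (nat (- i))" using u by blast
      then show ?thesis using that by (auto simp: A_alt)
    qed
    moreover have "u \<in> A 0" using u by blast
    ultimately show "u \<in> extinct_past" by (simp add: extinct_past_def A_alt)
  qed (auto simp: extinct_past_def A_alt)
  finally show ?thesis ..
qed

text \<open>A point \<open>u\<close> is an arbitrary family of paths; that extinction is absorbing
  holds only almost surely, since it is a property of the law of a lineage.\<close>

lemma past_stays_extinct:
  "AE u in past_law \<omega>. u \<in> extinct_past \<longrightarrow> (\<forall>i<0. \<forall>n\<ge>nat (- i). u i n = 0)"
proof -
  have l: "AE x in lineage0_law q p \<omega>'. \<forall>k. x k = 0 \<longrightarrow> (\<forall>n\<ge>k. x n = 0)" for \<omega>'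
  proof -
    have c: "(\<lambda>x :: nat \<Rightarrow> nat ^ 'd. x n) \<in> pathM \<rightarrow>\<^sub>M count_space UNIV" for n
      by (rule measurable_component_singleton) simp
    have [measurable]: "Measurable.pred pathM (\<lambda>x :: nat \<Rightarrow> nat ^ 'd. x n = 0)" for n
      by (rule measurable_compose[OF c]) simp
    have "{x\<in>space pathM. \<forall>k. x k = 0 \<longrightarrow> (\<forall>n\<ge>k. x n = (0 :: nat ^ 'd))} \<in> sets pathM" by measurable
    then show ?thesis
      unfolding lineage0_law_def
      by (subst AE_distr_iff[OF lineage0_path_measurable_Q]) (auto dest: lineage_eq_0_mono)
  qed
  have "AE u in past_law \<omega>. \<forall>i\<in>{..<0}. \<forall>k. u i k = 0 \<longrightarrow> (\<forall>n\<ge>k. u i n = 0)"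
  proof (subst AE_ball_countable)
    show "\<forall>i\<in>{..<0}. AE u in past_law \<omega>. \<forall>k. u i k = 0 \<longrightarrow> (\<forall>n\<ge>k. u i n = 0)"
      using AE_PiM_component[of "{..<0}" "\<lambda>i. lineage0_law q p (env_shift i \<omega>)", OF prob_lineage0_law _ l] by auto
  qed simp
  then show ?thesis by eventually_elim (auto simp: extinct_past_def)
qed

lemma popul_past_eq:
  assumes "u \<in> extinct_past" "\<forall>i<0. \<forall>n\<ge>nat (- i). u i n = 0"
  shows "popul_past y u (int n) = popul y n"
proof (subst vec_eq_iff, intro allI)
  fix j
  have "infsum (\<lambda>i. all_lineage y u i (int n) $ j) {..<int n} = infsum (\<lambda>i. lineage y n (nat i) $ j) {0..<int n}"
  proof (rule infsum_cong_neutral)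
    fix i assume "i \<in> {..<int n} - {0..<int n}"
    then have i: "i < 0" "nat (- i) \<le> nat (int n - i)" by auto
    then have "u i (nat (int n - i)) = 0" using assms(2) by blast
    then show "all_lineage y u i (int n) $ j = 0" using i by (simp add: all_lineage_def)
  qed (auto simp: all_lineage_def)
  also have "\<dots> = (\<Sum>i\<in>{0..<int n}. lineage y n (nat i) $ j)" by simp
  also have "\<dots> = (\<Sum>k<n. lineage y n k $ j)"
    by (rule sum.reindex_bij_witness[of _ int nat]) auto
  also have "\<dots> = popul y n $ j" by (simp add: popul_eq_sum_lineage)
  finally show "popul_past y u (int n) $ j = popul y n $ j" by (simp add: popul_past_def)
qed

lemma all_lineage_measurable:
  "(\<lambda>(\<omega>, y, u). all_lineage y u i n) \<in> enlargedM \<rightarrow>\<^sub>M count_space UNIV"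
proof (cases "i < 0")
  case True
  then show ?thesis
    unfolding all_lineage_def split_beta
    by (simp add: measurable_compose[OF measurable_compose[OF measurable_snd measurable_snd] past_component_measurable])
next
  case False
  then show ?thesis
    unfolding all_lineage_def split_beta
    by (simp add: measurable_compose[OF measurable_compose[OF measurable_snd measurable_fst] lineage_measurable])
qed

lemma popul_past_measurable:
  "(\<lambda>(\<omega>, y, u). (\<omega>, \<lambda>n. popul_past y u (int n))) \<in> enlargedM \<rightarrow>\<^sub>M P \<Otimes>\<^sub>M pathM"
proof -
  have "(\<lambda>x. popul_past (fst (snd x)) (snd (snd x)) (int n)) \<in> enlargedM \<rightarrow>\<^sub>M count_space UNIV" for n
    unfolding popul_past_def
  proof (intro measurable_vec_count_space measurable_infsum_nat)
    fix j i
    show "(\<lambda>x. all_lineage (fst (snd x)) (snd (snd x)) i (int n) $ j) \<in> enlargedM \<rightarrow>\<^sub>M count_space UNIV"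
      using measurable_compose[OF all_lineage_measurable[of i "int n"], of "\<lambda>v. v $ j" "count_space UNIV"]
      by (simp add: split_beta)
  qed
  then show ?thesis
    unfolding split_beta by (intro measurable_Pair measurable_fst measurable_PiM_single') auto
qed

definition cond_event :: "((int \<Rightarrow> 's) \<times> ('d source \<Rightarrow> nat ^ 'd) \<times> (int \<Rightarrow> nat \<Rightarrow> nat ^ 'd)) set" where
  "cond_event = {(\<omega>, y, u) \<in> space enlarged_law. \<forall>j. ((\<lambda>i. all_lineage y u i 0 $ j) has_sum 0) {..<0}}"

lemma cond_event_eq: "cond_event = space P \<times> UNIV \<times> extinct_past"
proof -
  have "(\<forall>j. ((\<lambda>i. all_lineage y u i 0 $ j) has_sum 0) {..<0}) \<longleftrightarrow> (\<forall>i<0. u i (nat (- i)) = 0)"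
    for y :: "'d source \<Rightarrow> nat ^ 'd" and u
    unfolding has_sum_0_nat_iff all_lineage_def by (auto simp: vec_eq_iff)
  then show ?thesis unfolding cond_event_def space_enlarged extinct_past_def by auto
qed

lemma cond_event_sets: "cond_event \<in> sets enlarged_law"
proof -
  have "UNIV \<in> sets (sourceM :: ('d source \<Rightarrow> nat ^ 'd) measure)" using sets.top[of sourceM] by simp
  then show ?thesis unfolding cond_event_eq by simp
qed

text \<open>Given the environment, the sources from time 0 on are independent of the past lineages.
  On the conditioning event the process is almost surely the one started at 0, so conditioning
  contributes the factor \<open>past_zero_prob \<omega>\<close> and nothing else.\<close>

lemma nn_integral_cond_event:
  assumes f: "f \<in> borel_measurable pathM"
  shows "(\<integral>\<^sup>+(\<omega>, y, u). f (\<lambda>n. popul_past y u (int n)) * indicator cond_event (\<omega>, y, u) \<partial>enlarged_law) =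
    (\<integral>\<^sup>+\<omega>. past_zero_prob \<omega> * (\<integral>\<^sup>+y. f (popul y) \<partial>Q \<omega>) \<partial>P)"
proof -
  have m: "(\<lambda>(\<omega>, y, u). f (\<lambda>n. popul_past y u (int n)) * indicator cond_event (\<omega>, y, u)) \<in> borel_measurable enlargedM"
  proof -
    have "(\<lambda>x. f (snd ((\<lambda>(\<omega>, y, u). (\<omega>, \<lambda>n. popul_past y u (int n))) x))) \<in> borel_measurable enlargedM"
      by (rule measurable_compose[OF measurable_compose[OF popul_past_measurable measurable_snd] f])
    then have "(\<lambda>x. f (\<lambda>n. popul_past (fst (snd x)) (snd (snd x)) (int n))) \<in> borel_measurable enlargedM"
      by (simp add: split_beta)
    moreover have "(indicator cond_event :: _ \<Rightarrow> ennreal) \<in> borel_measurable enlargedM"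
      using cond_event_sets by simp
    ultimately show ?thesis by (simp add: split_beta)
  qed
  have "(\<integral>\<^sup>+(\<omega>, y, u). f (\<lambda>n. popul_past y u (int n)) * indicator cond_event (\<omega>, y, u) \<partial>enlarged_law) =
      (\<integral>\<^sup>+\<omega>. \<integral>\<^sup>+y. \<integral>\<^sup>+u. f (\<lambda>n. popul_past y u (int n)) * indicator cond_event (\<omega>, y, u) \<partial>past_law \<omega> \<partial>Q \<omega> \<partial>P)"
    by (subst nn_integral_enlarged[OF m]) simp
  also have "\<dots> = (\<integral>\<^sup>+\<omega>. \<integral>\<^sup>+y. f (popul y) * past_zero_prob \<omega> \<partial>Q \<omega> \<partial>P)"
  proof (intro nn_integral_cong)
    fix \<omega> and y :: "'d source \<Rightarrow> nat ^ 'd" assume w: "\<omega> \<in> space P"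
    have "(\<integral>\<^sup>+u. f (\<lambda>n. popul_past y u (int n)) * indicator cond_event (\<omega>, y, u) \<partial>past_law \<omega>) =
        (\<integral>\<^sup>+u. f (popul y) * indicator extinct_past u \<partial>past_law \<omega>)"
    proof (rule nn_integral_cong_AE)
      show "AE u in past_law \<omega>. f (\<lambda>n. popul_past y u (int n)) * indicator cond_event (\<omega>, y, u) =
          f (popul y) * indicator extinct_past u"
        using past_stays_extinct
      proof eventually_elim
        fix u assume u: "u \<in> extinct_past \<longrightarrow> (\<forall>i<0. \<forall>n\<ge>nat (- i). u i n = 0)"
        show "f (\<lambda>n. popul_past y u (int n)) * indicator cond_event (\<omega>, y, u) = f (popul y) * indicator extinct_past u"
        proof (cases "u \<in> extinct_past")
          case True
          then have "(\<lambda>n. popul_past y u (int n)) = popul y" using u popul_past_eq by blast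
          then show ?thesis using True w by (simp add: cond_event_eq)
        qed (simp add: cond_event_eq)
      qed
    qed
    also have "\<dots> = f (popul y) * past_zero_prob \<omega>"
      unfolding emeasure_extinct_past[symmetric] by (rule nn_integral_cmult_indicator) simp
    finally show "(\<integral>\<^sup>+u. f (\<lambda>n. popul_past y u (int n)) * indicator cond_event (\<omega>, y, u) \<partial>past_law \<omega>) =
      f (popul y) * past_zero_prob \<omega>" .
  qed
  also have "\<dots> = (\<integral>\<^sup>+\<omega>. past_zero_prob \<omega> * (\<integral>\<^sup>+y. f (popul y) \<partial>Q \<omega>) \<partial>P)"
    using measurable_compose[OF path_popul_measurable f]
    by (intro nn_integral_cong) (simp add: nn_integral_multc measurable_cong_sets[OF sets_Q refl] mult.commute)
  finally show ?thesis .
qed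

abbreviation palm_law :: "((int \<Rightarrow> 's) \<times> (nat \<Rightarrow> nat ^ 'd)) measure" where
  "palm_law \<equiv> tilde_law P q p"

lemma nn_integral_tilde_law:
  assumes f: "f \<in> borel_measurable pathM"
  shows "(\<integral>\<^sup>+x. f (snd x) \<partial>palm_law) = (\<integral>\<^sup>+\<omega>. past_zero_prob \<omega> * (\<integral>\<^sup>+y. f (popul y) \<partial>Q \<omega>) \<partial>P) / (\<integral>\<^sup>+\<omega>. past_zero_prob \<omega> \<partial>P)"
proof -
  let ?g = "\<lambda>(\<omega>, y, u). (\<omega>, \<lambda>n. popul_past y u (int n))"
  have s: "sets (uniform_measure enlarged_law cond_event) = sets enlargedM" by simp
  have g: "?g \<in> uniform_measure enlarged_law cond_event \<rightarrow>\<^sub>M P \<Otimes>\<^sub>M pathM"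
    unfolding measurable_cong_sets[OF s refl] by (rule popul_past_measurable)
  have fs: "(\<lambda>x. f (snd x)) \<in> borel_measurable (P \<Otimes>\<^sub>M pathM)"
    by (rule measurable_compose[OF measurable_snd f])
  have fg: "(\<lambda>x. f (snd (?g x))) \<in> borel_measurable enlarged_law"
    unfolding measurable_cong_sets[OF sets_enlarged refl] by (rule measurable_compose[OF popul_past_measurable fs])
  have "(\<integral>\<^sup>+x. f (snd x) \<partial>palm_law) = (\<integral>\<^sup>+x. f (snd (?g x)) \<partial>uniform_measure enlarged_law cond_event)"
    unfolding tilde_law_def cond_event_def[symmetric] using fs by (subst nn_integral_distr[OF g]) simp_all
  also have "\<dots> = (\<integral>\<^sup>+x. f (snd (?g x)) * indicator cond_event x \<partial>enlarged_law) / emeasure enlarged_law cond_event"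
    by (rule nn_integral_uniform_measure[OF fg cond_event_sets])
  also have "(\<integral>\<^sup>+x. f (snd (?g x)) * indicator cond_event x \<partial>enlarged_law) =
      (\<integral>\<^sup>+\<omega>. past_zero_prob \<omega> * (\<integral>\<^sup>+y. f (popul y) \<partial>Q \<omega>) \<partial>P)"
    unfolding nn_integral_cond_event[OF f, symmetric] by (intro nn_integral_cong) auto
  also have "emeasure enlarged_law cond_event = (\<integral>\<^sup>+\<omega>. past_zero_prob \<omega> \<partial>P)"
    using nn_integral_cond_event[of "\<lambda>_. 1"] cond_event_sets Q.emeasure_space_1 by (simp add: split_beta)
  finally show ?thesis .
qed

lemma sets_tilde_law[simp]: "sets palm_law = sets (P \<Otimes>\<^sub>M pathM)"
  by (simp add: tilde_law_def)

lemma past_zero_prob_integral_finite: "(\<integral>\<^sup>+\<omega>. past_zero_prob \<omega> \<partial>P) \<le> 1"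
proof -
  have "(\<integral>\<^sup>+\<omega>. past_zero_prob \<omega> \<partial>P) \<le> (\<integral>\<^sup>+\<omega>. 1 \<partial>P)" by (intro nn_integral_mono past_zero_prob_le_1)
  then show ?thesis using P.emeasure_space_1 by simp
qed

lemma prob_tilde_law:
  assumes "(\<integral>\<^sup>+\<omega>. past_zero_prob \<omega> \<partial>P) \<noteq> 0"
  shows "prob_space palm_law"
proof
  have "emeasure palm_law (space palm_law) = (\<integral>\<^sup>+x. (\<lambda>_. 1) (snd x) \<partial>palm_law)" by simp
  also have "\<dots> = (\<integral>\<^sup>+\<omega>. past_zero_prob \<omega> \<partial>P) / (\<integral>\<^sup>+\<omega>. past_zero_prob \<omega> \<partial>P)"
    by (subst nn_integral_tilde_law) (simp_all add: Q.emeasure_space_1[simplified])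
  also have "\<dots> = 1" using assms past_zero_prob_integral_finite by (intro ennreal_divide_self) (auto intro: le_less_trans)
  finally show "emeasure palm_law (space palm_law) = 1" .
qed

end

section \<open>Convergence in law of the excursions\<close>

lemma ennreal_bounds_imp_real:
  assumes "ennreal a * c \<le> x" "x \<le> ennreal b * c" "0 \<le> b" "c \<noteq> 0" "c \<noteq> \<top>"
  shows "a \<le> enn2real (x / c) \<and> enn2real (x / c) \<le> b"
proof -
  obtain r where r: "c = ennreal r" "0 < r"
    using assms(4,5) by (cases c) (auto simp: less_le)
  have "x < \<top>" using assms(2,3) r by (auto simp: ennreal_mult[symmetric] intro: le_less_trans)
  then obtain z where z: "x = ennreal z" "0 \<le> z" by (cases x) auto
  have e: "enn2real (x / c) = z / r" using r z by (simp add: divide_ennreal)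
  have "z \<le> b * r" using assms(2,3) r z by (simp add: ennreal_mult[symmetric] ennreal_le_iff)
  moreover have "a * r \<le> z"
  proof (cases "0 \<le> a")
    case True
    then show ?thesis using assms(1) r z by (simp add: ennreal_mult[symmetric] ennreal_le_iff)
  next
    case False
    then have "a * r \<le> 0" using r by (intro mult_nonpos_nonneg) auto
    with z show ?thesis by linarith
  qed
  ultimately show ?thesis unfolding e using r by (simp add: field_simps)
qed

locale palm_env = recurrent_env +
  assumes past_zero_prob_pos: "AE \<omega> in P. 0 < past_zero_prob \<omega>"
begin

lemma past_zero_prob_integral_nonzero: "(\<integral>\<^sup>+\<omega>. past_zero_prob \<omega> \<partial>P) \<noteq> 0"
proof
  assume "(\<integral>\<^sup>+\<omega>. past_zero_prob \<omega> \<partial>P) = 0"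
  then have "AE \<omega> in P. past_zero_prob \<omega> = 0" by (subst (asm) nn_integral_0_iff_AE) measurable
  with past_zero_prob_pos have "AE \<omega> in P. False" by eventually_elim simp
  then show False using P.AE_const by simp
qed

lemma past_zero_prob_integral_not_top: "(\<integral>\<^sup>+\<omega>. past_zero_prob \<omega> \<partial>P) \<noteq> \<top>"
  using past_zero_prob_integral_finite by (auto simp: top_unique)

text \<open>The inequality is already known pointwise. By stationarity, and as the return
  probabilities sum to 1, both sides have the same finite integral, hence they agree almost
  everywhere.\<close>

lemma past_zero_prob_renewal: "AE \<omega> in P. (\<Sum>k. past_zero_prob (env_shift (- int k) \<omega>) * return_prob 1 k (env_shift (- int k) \<omega>)) = past_zero_prob \<omega>"
proof -
  let ?V = "\<lambda>\<omega>. \<Sum>k. past_zero_prob (env_shift (- int k) \<omega>) * return_prob 1 k (env_shift (- int k) \<omega>)"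
  have "(\<integral>\<^sup>+\<omega>. ?V \<omega> \<partial>P) = (\<Sum>k. \<integral>\<^sup>+\<omega>. past_zero_prob (env_shift (- int k) \<omega>) * return_prob 1 k (env_shift (- int k) \<omega>) \<partial>P)"
    by (rule nn_integral_suminf) measurable
  also have "\<dots> = (\<Sum>k. \<integral>\<^sup>+\<omega>. past_zero_prob \<omega> * return_prob 1 k \<omega> \<partial>P)"
    by (intro suminf_cong nn_integral_env_shift[of "\<lambda>\<omega>. past_zero_prob \<omega> * return_prob 1 k \<omega>" for k]) measurable
  also have "\<dots> = (\<integral>\<^sup>+\<omega>. (\<Sum>k. past_zero_prob \<omega> * return_prob 1 k \<omega>) \<partial>P)"
    by (rule nn_integral_suminf[symmetric]) measurable
  also have "\<dots> = (\<integral>\<^sup>+\<omega>. past_zero_prob \<omega> \<partial>P)"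
  proof (rule nn_integral_cong_AE)
    show "AE \<omega> in P. (\<Sum>k. past_zero_prob \<omega> * return_prob 1 k \<omega>) = past_zero_prob \<omega>"
      using recurrent_AE by eventually_elim (simp only: ennreal_suminf_cmult sum_return_prob mult_1_right)
  qed
  finally have eq: "(\<integral>\<^sup>+\<omega>. ?V \<omega> \<partial>P) = (\<integral>\<^sup>+\<omega>. past_zero_prob \<omega> \<partial>P)" .
  have "(\<integral>\<^sup>+\<omega>. past_zero_prob \<omega> - ?V \<omega> \<partial>P) = (\<integral>\<^sup>+\<omega>. past_zero_prob \<omega> \<partial>P) - (\<integral>\<^sup>+\<omega>. ?V \<omega> \<partial>P)"
    using past_zero_prob_integral_not_top eq past_zero_prob_renewal_le by (intro nn_integral_diff) (auto simp del: One_nat_def)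
  also have "\<dots> = 0" unfolding eq using past_zero_prob_integral_not_top by simp
  finally have "AE \<omega> in P. past_zero_prob \<omega> - ?V \<omega> = 0" by (subst (asm) nn_integral_0_iff_AE) measurable
  then show ?thesis
  proof eventually_elim
    fix \<omega> assume "past_zero_prob \<omega> - ?V \<omega> = 0"
    then have "past_zero_prob \<omega> \<le> ?V \<omega>" using past_zero_prob_le_1[of \<omega>] by (auto simp: diff_eq_0_iff_ennreal top_unique)
    with past_zero_prob_renewal_le[of \<omega>] show "?V \<omega> = past_zero_prob \<omega>" by (rule antisym)
  qed
qed

text \<open>One step of the renewal equation, each term shifted back by \<open>k\<close>, and
  resummation by the renewal identity of the weight: the tilted law is invariant under passing to
  the next return.\<close>

lemma palm_stationary:
  assumes F: "F \<in> borel_measurable opathM"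
  shows "(\<integral>\<^sup>+\<omega>. past_zero_prob \<omega> * future_mean F n \<omega> \<partial>P) = (\<integral>\<^sup>+\<omega>. past_zero_prob \<omega> * future_mean F 0 \<omega> \<partial>P)"
proof (induction n)
  case (Suc n)
  note future_mean_measurable[OF F, measurable]
  have "(\<integral>\<^sup>+\<omega>. past_zero_prob \<omega> * future_mean F (1 + n) \<omega> \<partial>P) =
      (\<integral>\<^sup>+\<omega>. (\<Sum>k. past_zero_prob \<omega> * return_prob 1 k \<omega> * future_mean F n (env_shift (int k) \<omega>)) \<partial>P)"
    using recurrent_AE
  proof (intro nn_integral_cong_AE, eventually_elim)
    fix \<omega> assume "\<forall>m. AE y in Q \<omega>. nu (popul y) m \<noteq> \<infinity>"
    then have "future_mean F (1 + n) \<omega> = (\<Sum>k. return_prob 1 k \<omega> * future_mean F n (env_shift (int k) \<omega>))"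
      by (intro renewal_equation F) blast
    then show "past_zero_prob \<omega> * future_mean F (1 + n) \<omega> = (\<Sum>k. past_zero_prob \<omega> * return_prob 1 k \<omega> * future_mean F n (env_shift (int k) \<omega>))"
      by (simp add: mult.assoc del: One_nat_def)
  qed
  also have "\<dots> = (\<Sum>k. \<integral>\<^sup>+\<omega>. past_zero_prob \<omega> * return_prob 1 k \<omega> * future_mean F n (env_shift (int k) \<omega>) \<partial>P)"
    by (rule nn_integral_suminf) measurable
  also have "\<dots> = (\<Sum>k. \<integral>\<^sup>+\<omega>. past_zero_prob (env_shift (- int k) \<omega>) * return_prob 1 k (env_shift (- int k) \<omega>) * future_mean F n \<omega> \<partial>P)"
  proof (rule suminf_cong)
    fix k
    show "(\<integral>\<^sup>+\<omega>. past_zero_prob \<omega> * return_prob 1 k \<omega> * future_mean F n (env_shift (int k) \<omega>) \<partial>P) =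
      (\<integral>\<^sup>+\<omega>. past_zero_prob (env_shift (- int k) \<omega>) * return_prob 1 k (env_shift (- int k) \<omega>) * future_mean F n \<omega> \<partial>P)"
      using nn_integral_env_shift[of "\<lambda>\<omega>. past_zero_prob \<omega> * return_prob 1 k \<omega> * future_mean F n (env_shift (int k) \<omega>)" "- int k"]
      by (simp del: One_nat_def)
  qed
  also have "\<dots> = (\<integral>\<^sup>+\<omega>. (\<Sum>k. past_zero_prob (env_shift (- int k) \<omega>) * return_prob 1 k (env_shift (- int k) \<omega>) * future_mean F n \<omega>) \<partial>P)"
    by (rule nn_integral_suminf[symmetric]) measurable
  also have "\<dots> = (\<integral>\<^sup>+\<omega>. past_zero_prob \<omega> * future_mean F n \<omega> \<partial>P)"
  proof (rule nn_integral_cong_AE)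
    show "AE \<omega> in P. (\<Sum>k. past_zero_prob (env_shift (- int k) \<omega>) * return_prob 1 k (env_shift (- int k) \<omega>) * future_mean F n \<omega>) =
        past_zero_prob \<omega> * future_mean F n \<omega>"
      using past_zero_prob_renewal by eventually_elim (simp del: One_nat_def)
  qed
  finally show ?case using Suc by simp
qed simp

text \<open>The annealed mean is the test of \<open>future_mean\<close> against the weight 1, the
  tilted mean the normalised test against \<open>past_zero_prob\<close>. Both therefore lie in the
  same short interval.\<close>

lemma excursion_converges:
  assumes F: "\<And>x. F x \<le> (1 :: ennreal)"
  shows "(\<lambda>n. enn2real (\<integral>\<^sup>+x. F (exc_seq (Suc n) x) \<partial>joint_law)) \<longlonglongrightarrow> enn2real (\<integral>\<^sup>+x. F (excursion (snd x) 1) \<partial>palm_law)"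
proof -
  let ?F = "\<lambda>x. F (opath_excursion 1 x)"
  have Fm: "?F \<in> borel_measurable opathM"
    by (rule measurable_compose[OF opath_excursion_measurable]) simp
  have e: "(\<integral>\<^sup>+x. F (exc_seq (Suc n) x) \<partial>joint_law) = (\<integral>\<^sup>+\<omega>. 1 * future_mean ?F n \<omega> \<partial>P)" for n
  proof -
    have "(\<lambda>x. F (exc_seq (Suc n) x)) \<in> borel_measurable joint_law"
      using snd_popul_measurable[OF measurable_compose[OF measurable_compose[OF path_popul_measurable excursion_measurable], of F borel]]
      by (simp add: case_prod_unfold)
    then have "(\<integral>\<^sup>+x. F (exc_seq (Suc n) x) \<partial>joint_law) = (\<integral>\<^sup>+\<omega>. \<integral>\<^sup>+y. F (excursion (popul y) (Suc n)) \<partial>Q \<omega> \<partial>P)"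
      by (subst nn_integral_annealed) (simp_all add: measurable_cong_sets[OF sets_annealed refl])
    also have "\<dots> = (\<integral>\<^sup>+\<omega>. 1 * future_mean ?F n \<omega> \<partial>P)"
      unfolding future_mean_def by (simp add: opath_excursion_shifted_path)
    finally show ?thesis .
  qed
  \<comment> \<open>Invariance allows the \<open>n\<close>-th return on the right for every
    \<open>n\<close>, although the left side concerns the first excursion.\<close>
  have t: "(\<integral>\<^sup>+x. F (excursion (snd x) 1) \<partial>palm_law) = (\<integral>\<^sup>+\<omega>. past_zero_prob \<omega> * future_mean ?F n \<omega> \<partial>P) / (\<integral>\<^sup>+\<omega>. past_zero_prob \<omega> \<partial>P)" for n
  proof -
    have "(\<lambda>z. F (excursion z 1)) \<in> borel_measurable pathM"
      by (rule measurable_compose[OF excursion_measurable]) simp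
    from nn_integral_tilde_law[OF this]
    have "(\<integral>\<^sup>+x. F (excursion (snd x) 1) \<partial>palm_law) =
      (\<integral>\<^sup>+\<omega>. past_zero_prob \<omega> * (\<integral>\<^sup>+y. F (excursion (popul y) 1) \<partial>Q \<omega>) \<partial>P) / (\<integral>\<^sup>+\<omega>. past_zero_prob \<omega> \<partial>P)" .
    also have "(\<lambda>\<omega>. \<integral>\<^sup>+y. F (excursion (popul y) 1) \<partial>Q \<omega>) = future_mean ?F 0"
      unfolding future_mean_def[abs_def] by (simp add: opath_excursion_shifted_path)
    finally show ?thesis using palm_stationary[OF Fm, of n] by simp
  qed
  show ?thesis
  proof (rule LIMSEQ_I)
    fix \<eta> :: real assume "0 < \<eta>"
    then have "0 < \<eta> / 2" by simp
    from osc_tendsto_0[OF this] obtain n0 where "\<forall>n\<ge>n0. \<forall>F\<in>borel_measurable opathM. (\<forall>x. F x \<le> 1) \<longrightarrow>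
        (\<exists>a b. 0 \<le> b \<and> b - a \<le> \<eta> / 2 \<and> osc (future_mean F n) a b)" by blast
    then have n0: "\<exists>a b. 0 \<le> b \<and> b - a \<le> \<eta> / 2 \<and> osc (future_mean ?F n) a b" if "n \<ge> n0" for n
      using that Fm F by simp
    show "\<exists>no. \<forall>n\<ge>no. norm (enn2real (\<integral>\<^sup>+x. F (exc_seq (Suc n) x) \<partial>joint_law) - enn2real (\<integral>\<^sup>+x. F (excursion (snd x) 1) \<partial>palm_law)) < \<eta>"
    proof (intro exI[of _ n0] allI impI)
      fix n assume "n0 \<le> n"
      from n0[OF this] obtain a b where ab: "0 \<le> b" "b - a \<le> \<eta> / 2" "osc (future_mean ?F n) a b" by blast
      have o: "ennreal a * (\<integral>\<^sup>+\<omega>. g \<omega> \<partial>P) \<le> (\<integral>\<^sup>+\<omega>. g \<omega> * future_mean ?F n \<omega> \<partial>P)"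
        "(\<integral>\<^sup>+\<omega>. g \<omega> * future_mean ?F n \<omega> \<partial>P) \<le> ennreal b * (\<integral>\<^sup>+\<omega>. g \<omega> \<partial>P)"
        if "g \<in> borel_measurable P" "\<And>\<omega>. g \<omega> \<le> 1" "env_dep {..<0} g" for g
        using ab(3)[unfolded osc_def, rule_format, OF that] by simp_all
      have "a \<le> enn2real (\<integral>\<^sup>+x. F (exc_seq (Suc n) x) \<partial>joint_law) \<and> enn2real (\<integral>\<^sup>+x. F (exc_seq (Suc n) x) \<partial>joint_law) \<le> b"
        unfolding e using ennreal_bounds_imp_real[OF o[of "\<lambda>_. 1"] ab(1)] P.emeasure_space_1
        by (simp add: env_dep_def divide_ennreal_def)
      moreover have "a \<le> enn2real (\<integral>\<^sup>+x. F (excursion (snd x) 1) \<partial>palm_law) \<and> enn2real (\<integral>\<^sup>+x. F (excursion (snd x) 1) \<partial>palm_law) \<le> b"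
        unfolding t[of n]
        by (rule ennreal_bounds_imp_real[OF o[OF past_zero_prob_measurable past_zero_prob_le_1 past_zero_prob_dep] ab(1) past_zero_prob_integral_nonzero past_zero_prob_integral_not_top])
      ultimately show "norm (enn2real (\<integral>\<^sup>+x. F (exc_seq (Suc n) x) \<partial>joint_law) - enn2real (\<integral>\<^sup>+x. F (excursion (snd x) 1) \<partial>palm_law)) < \<eta>"
        using ab(2) \<open>0 < \<eta>\<close> by (simp add: abs_less_iff)
    qed
  qed
qed

lemma excursion_conv_in_law:
  "conv_in_law_discrete (\<lambda>n. distr joint_law (count_space UNIV) (exc_seq n))
     (distr palm_law (count_space UNIV) (\<lambda>(\<omega>, z). excursion z 1))"
  unfolding conv_in_law_discrete_def
proof (intro allI impI)
  fix f :: "enat \<times> (nat ^ 'b) list \<Rightarrow> real" assume "bounded (range f)"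
  then obtain B0 where B0: "\<And>x. \<bar>f x\<bar> \<le> B0" by (auto simp: bounded_iff)
  define B where "B = \<bar>B0\<bar> + 1"
  have B: "0 < B" "\<bar>f x\<bar> \<le> B" for x using B0[of x] by (auto simp: B_def)
  \<comment> \<open>Affine rescaling of a bounded function into [0,1], the range covered by the
    oscillation bounds.\<close>
  define F where "F x = (f x + B) / (2 * B)" for x
  have F: "0 \<le> F x" "F x \<le> 1" for x using B(1) B(2)[of x] by (auto simp: F_def field_simps abs_le_iff)
  have fF: "f x = 2 * B * F x - B" for x using B(1) by (simp add: F_def)
  interpret palm_law: prob_space palm_law by (rule prob_tilde_law[OF past_zero_prob_integral_nonzero])
  have int: "(\<integral>x. f x \<partial>distr M (count_space UNIV) g) = 2 * B * enn2real (\<integral>\<^sup>+x. ennreal (F (g x)) \<partial>M) - B"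
    if "prob_space M" "g \<in> M \<rightarrow>\<^sub>M count_space UNIV" for M :: "'z measure" and g
  proof -
    interpret M: prob_space M by fact
    have Fg: "(\<lambda>x. F (g x)) \<in> borel_measurable M" by (rule measurable_compose[OF that(2)]) simp
    have i: "integrable M (\<lambda>x. F (g x))"
      by (rule M.integrable_const_bound[of _ 1]) (use F Fg in auto)
    have "(\<integral>x. f x \<partial>distr M (count_space UNIV) g) = (\<integral>x. 2 * B * F (g x) - B \<partial>M)"
      unfolding fF[symmetric] by (rule integral_distr[OF that(2)]) simp
    also have "\<dots> = 2 * B * (\<integral>x. F (g x) \<partial>M) - B" using i by (simp add: M.prob_space)
    also have "(\<integral>x. F (g x) \<partial>M) = enn2real (\<integral>\<^sup>+x. ennreal (F (g x)) \<partial>M)"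
      using F Fg by (intro integral_eq_nn_integral) auto
    finally show ?thesis .
  qed
  have m: "exc_seq n \<in> joint_law \<rightarrow>\<^sub>M count_space UNIV" for n
    by (rule snd_popul_measurable[OF measurable_compose[OF path_popul_measurable excursion_measurable]])
  have mt: "(\<lambda>(\<omega>, z). excursion z 1) \<in> palm_law \<rightarrow>\<^sub>M count_space UNIV"
    unfolding measurable_cong_sets[OF sets_tilde_law refl] split_beta
    by (rule measurable_compose[OF measurable_snd excursion_measurable])
  have "(\<lambda>n. enn2real (\<integral>\<^sup>+x. ennreal (F (exc_seq (Suc n) x)) \<partial>joint_law)) \<longlonglongrightarrow>
      enn2real (\<integral>\<^sup>+x. ennreal (F (excursion (snd x) 1)) \<partial>palm_law)"
    by (rule excursion_converges) (simp add: F ennreal_le_1)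
  then have "(\<lambda>n. 2 * B * enn2real (\<integral>\<^sup>+x. ennreal (F (exc_seq (Suc n) x)) \<partial>joint_law) - B) \<longlonglongrightarrow>
      2 * B * enn2real (\<integral>\<^sup>+x. ennreal (F (excursion (snd x) 1)) \<partial>palm_law) - B"
    by (rule tendsto_diff[OF tendsto_mult[OF tendsto_const] tendsto_const])
  also have "(\<lambda>n. 2 * B * enn2real (\<integral>\<^sup>+x. ennreal (F (exc_seq (Suc n) x)) \<partial>joint_law) - B) =
      (\<lambda>n. \<integral>x. f x \<partial>distr joint_law (count_space UNIV) (exc_seq (Suc n)))"
    using int[OF prob_annealed m] by simp
  also have "2 * B * enn2real (\<integral>\<^sup>+x. ennreal (F (excursion (snd x) 1)) \<partial>palm_law) - B =
      (\<integral>x. f x \<partial>distr palm_law (count_space UNIV) (\<lambda>(\<omega>, z). excursion z 1))"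
    using int[OF palm_law.prob_space_axioms mt] by (simp add: case_prod_unfold)
  \<comment> \<open>Excursions are numbered from 1; the index 0 does not matter for the
    limit.\<close>
  finally show "(\<lambda>n. \<integral>x. f x \<partial>distr joint_law (count_space UNIV) (exc_seq n)) \<longlonglongrightarrow>
      (\<integral>x. f x \<partial>distr palm_law (count_space UNIV) (\<lambda>(\<omega>, z). excursion z 1))"
    by (rule LIMSEQ_imp_Suc)
qed

end

theorem theorem1p6:
  fixes S :: "'s measure"
    and P :: "(int \<Rightarrow> 's) measure"
    and q :: "'s \<Rightarrow> (nat ^ 'd::finite) pmf"
    and p :: "'d \<Rightarrow> 's \<Rightarrow> (nat ^ 'd) pmf"
    and e :: "'d \<Rightarrow> (nat ^ 'd) pmf"
    and e_imm :: "(nat ^ 'd) pmf"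
    and \<epsilon> :: real
  assumes "prob_space P"
    and "sets P = sets (PiM UNIV (\<lambda>_. S))"
    and "stationary_env P"
    and "ergodic_env P"
    and "(\<lambda>s. measure_pmf (q s)) \<in> S \<rightarrow>\<^sub>M subprob_algebra (count_space UNIV)"
    and "\<And>i. (\<lambda>s. measure_pmf (p i s)) \<in> S \<rightarrow>\<^sub>M subprob_algebra (count_space UNIV)"
    and "cond_A1 P q p"
    and "cond_A2 P q p"
    and "cond_A3 P q p"
    and "unif_mixing_env S P"
    and "0 < \<epsilon>" and "\<epsilon> < 1"
    and "\<And>v. \<P>(\<omega> in P. (\<forall>i. pmf (p i (\<omega> 0)) v > \<epsilon> * pmf (e i) v)
                     \<and> pmf (q (\<omega> (- 1))) v > \<epsilon> * pmf e_imm v) = 1"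
    and "\<And>i. pmf (e i) 0 > 0"
  shows "unif_mixing_seq (annealed P q p) (\<lambda>n (\<omega>, y). excursion (popul y) n)
    \<and> (\<lambda>n. SUP m\<in>{1..}. mix_coeff (annealed P q p)
               (future_at_nu (annealed P q p) (n + m))
               (past_before_nu S (annealed P q p) m)) \<longlonglongrightarrow> 0
    \<and> conv_in_law_discrete
        (\<lambda>n. distr (annealed P q p) (count_space UNIV) (\<lambda>(\<omega>, y). excursion (popul y) n))
        (distr (tilde_law P q p) (count_space UNIV) (\<lambda>(\<omega>, z). excursion z 1))"
proof -
  interpret branching_env S P q p
    using assms(1-3,5,6) by (rule branching_env.intro)
  have elliptic: "AE \<omega> in P. (\<forall>i. pmf (p i (\<omega> 0)) v > \<epsilon> * pmf (e i) v) \<and> pmf (q (\<omega> (- 1))) v > \<epsilon> * pmf e_imm v" for v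
  proof -
    let ?E = "{\<omega>\<in>space P. (\<forall>i. pmf (p i (\<omega> 0)) v > \<epsilon> * pmf (e i) v) \<and> pmf (q (\<omega> (- 1))) v > \<epsilon> * pmf e_imm v}"
    have 1: "P.prob ?E = 1" by (rule assms(13))
    \<comment> \<open>A set outside the \<sigma>-algebra has measure 0 by convention, so probability
      1 entails measurability.\<close>
    then have "?E \<in> sets P" using measure_notin_sets by fastforce
    with 1 have "AE \<omega> in P. \<omega> \<in> ?E" by (simp only: P.prob_eq_1)
    then show ?thesis by eventually_elim simp
  qed
  \<comment> \<open>Any point charged by \<open>e_imm\<close> will do; the zero vector need not be
    one.\<close>
  obtain v0 where v0: "pmf e_imm v0 > 0"
    using set_pmf_not_empty[of e_imm] by (blast intro: pmf_positive)
  \<comment> \<open>Lower bound for the arrival of exactly \<open>v0\<close> immigrants, all of whom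
    die without children.\<close>
  define \<delta> where "\<delta> = \<epsilon> * pmf e_imm v0 * (\<Prod>j\<in>UNIV. (\<epsilon> * pmf (e j) 0) ^ (v0 $ j))"
  have \<delta>: "0 < \<delta>"
    unfolding \<delta>_def using v0 assms(11,14) by (intro mult_pos_pos prod_pos) auto
  \<comment> \<open>The strict inequality in (i) yields positivity even if
    \<open>pmf e_imm 0\<close> is 0.\<close>
  have q0: "AE \<omega> in P. 0 < pmf (q (\<omega> (- 1))) 0"
    using elliptic[of 0]
  proof eventually_elim
    fix \<omega> assume "(\<forall>i. \<epsilon> * pmf (e i) 0 < pmf (p i (\<omega> 0)) 0) \<and> \<epsilon> * pmf e_imm 0 < pmf (q (\<omega> (- 1))) 0"
    moreover have "0 \<le> \<epsilon> * pmf e_imm 0" using assms(11) by simp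
    ultimately show "0 < pmf (q (\<omega> (- 1))) 0" by linarith
  qed
  have return_prob: "AE \<omega> in P. ennreal \<delta> \<le> return_prob 1 1 \<omega>"
    using elliptic[of 0] elliptic[of v0]
  proof eventually_elim
    fix \<omega> :: "int \<Rightarrow> 's" assume e0: "(\<forall>i. \<epsilon> * pmf (e i) 0 < pmf (p i (\<omega> 0)) 0) \<and> \<epsilon> * pmf e_imm 0 < pmf (q (\<omega> (- 1))) 0"
      and ev: "(\<forall>i. \<epsilon> * pmf (e i) v0 < pmf (p i (\<omega> 0)) v0) \<and> \<epsilon> * pmf e_imm v0 < pmf (q (\<omega> (- 1))) v0"
    have "\<delta> \<le> pmf (q (\<omega> (- 1))) v0 * (\<Prod>j\<in>UNIV. pmf (p j (\<omega> 0)) 0 ^ (v0 $ j))"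
      unfolding \<delta>_def
    proof (intro mult_mono prod_mono)
      fix j
      show "0 \<le> (\<epsilon> * pmf (e j) 0) ^ v0 $ j \<and> (\<epsilon> * pmf (e j) 0) ^ v0 $ j \<le> pmf (p j (\<omega> 0)) 0 ^ v0 $ j"
        using e0 assms(11) by (intro conjI power_mono) (simp_all add: less_imp_le)
    qed (use ev assms(11) in \<open>simp_all add: prod_nonneg less_imp_le\<close>)
    then have "ennreal \<delta> \<le> ennreal (pmf (q (\<omega> (- 1))) v0 * (\<Prod>j\<in>UNIV. pmf (p j (\<omega> 0)) 0 ^ (v0 $ j)))"
      by (rule ennreal_leI)
    also have "\<dots> = ennreal (pmf (q (\<omega> (- 1))) v0) * (\<Prod>j\<in>UNIV. ennreal (pmf (p j (\<omega> 0)) 0) ^ (v0 $ j))"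
      by (simp add: ennreal_mult prod_nonneg prod_ennreal[symmetric] ennreal_power)
    also have "\<dots> \<le> return_prob 1 1 \<omega>" by (rule return_prob_1_lower)
    finally show "ennreal \<delta> \<le> return_prob 1 1 \<omega>" .
  qed
  interpret subcritical_env S P q p \<delta>
    using \<delta> return_prob q0 assms(4,7-9)
    by (intro subcritical_env.intro subcritical_env_axioms.intro branching_env_axioms)
  have "mix_rate \<longlonglongrightarrow> 0"
    using assms(10) by (simp add: unif_mixing_env_def mix_rate_def[abs_def])
  then interpret palm_env S P q p \<delta>
    using \<delta> return_prob recurrent past_zero_prob_pos
    by (intro palm_env.intro palm_env_axioms.intro recurrent_env.intro recurrent_env_axioms.intro
        branching_env_axioms)
  show ?thesis
    using excursion_mixing nu_mixing excursion_conv_in_law by blast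
qed

end
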